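(* Let $d\ge 2$ be an integer, let $c_d=\min_{0<t<1}\frac{-\ln(1-t)}{t^d}$, and let $c>c_d$ be a fixed real number. Then a random $d$-dimensional simplicial complex $X$ drawn from $X_d(n,\frac{c}{n})$ is asymptotically almost surely not collapsible; that is, $$\lim_{n\to\infty}\Pr\left[X\in X_d\left(n,\tfrac{c}{n}\right)\text{ is collapsible}\right]=0.$$
   Context: For an integer $n$ and $p\in[0,1]$, $X_d(n,p)$ denotes the probability space of $d$-dimensional simplicial complexes $X$ on the vertex set $\{1,\dots,n\}$ with full $(d-1)$-dimensional skeleton (every nonempty subset of at most $d$ vertices is a face), in which each $(d+1)$-element subset of the vertices is taken to be a $d$-dimensional face of $X$ independently with probability $p$; there are no faces of dimension greater than $d$. (For fixed $c$, the parameter $p=c/n$ lies in $[0,1]$ for all sufficiently large $n$.) A $(d-1)$-dimensional face $\tau$ of a $d$-dimensional complex $X$ is free if it is contained in exactly one $d$-dimensional face $\sigma$ of $X$. In this case the corresponding elementary collapse step removes both $\tau$ and $\sigma$ from $X$. The complex $X$ is collapsible if it is possible to eliminate all of its $d$-faces by a (finite) series of elementary collapses, each performed on the complex resulting from the previous ones. The constant $c_d$ is the number such that, for $c>c_d$, the function $f_c(t)=1-e^{-ct^d}-t$ has two roots in the open interval $(0,1)$, and for $c<c_d$ it has none. Equivalently, $c_d$ is the minimum over $(0,1)$ of $g(t)=\frac{-\ln(1-t)}{t^d}$. An event holds asymptotically almost surely if its probability tends to $1$ as $n\to\infty$. *)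

theory Defs
  imports "HOL-Probability.Probability"
begin

text \<open>A simplicial complex is a set of nonempty finite faces; a face with \<open>k + 1\<close> vertices has
  dimension \<open>k\<close>.\<close>

definition k_subsets :: "nat \<Rightarrow> nat \<Rightarrow> nat set set" where
  "k_subsets n k = {\<sigma>. \<sigma> \<subseteq> {1..n} \<and> card \<sigma> = k}"

definition full_skeleton :: "nat \<Rightarrow> nat \<Rightarrow> nat set set" where
  "full_skeleton d n = {\<tau>. \<tau> \<subseteq> {1..n} \<and> \<tau> \<noteq> {} \<and> card \<tau> \<le> d}"

text \<open>The function drawn from \<open>Pi_pmf\<close> is the indicator of the set of \<open>d\<close>-faces.\<close>

definition random_complex :: "nat \<Rightarrow> nat \<Rightarrow> real \<Rightarrow> nat set set pmf" where
  "random_complex d n p =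
     map_pmf (\<lambda>A. full_skeleton d n \<union> {\<sigma> \<in> k_subsets n (d + 1). A \<sigma>})
       (Pi_pmf (k_subsets n (d + 1)) False (\<lambda>_. bernoulli_pmf p))"

definition free_in :: "nat \<Rightarrow> 'a set set \<Rightarrow> 'a set \<Rightarrow> 'a set \<Rightarrow> bool" where
  "free_in d X \<tau> \<sigma> \<longleftrightarrow> \<tau> \<in> X \<and> card \<tau> = d \<and> {\<rho> \<in> X. card \<rho> = d + 1 \<and> \<tau> \<subseteq> \<rho>} = {\<sigma>}"

definition elementary_collapse :: "nat \<Rightarrow> 'a set set \<Rightarrow> 'a set set \<Rightarrow> bool" where
  "elementary_collapse d X Y \<longleftrightarrow> (\<exists>\<tau> \<sigma>. free_in d X \<tau> \<sigma> \<and> Y = X - {\<tau>, \<sigma>})"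

definition collapsible :: "nat \<Rightarrow> 'a set set \<Rightarrow> bool" where
  "collapsible d X \<longleftrightarrow>
     (\<exists>Y. (elementary_collapse d)\<^sup>*\<^sup>* X Y \<and> (\<forall>\<sigma>\<in>Y. card \<sigma> \<noteq> d + 1))"

definition threshold_fun :: "nat \<Rightarrow> real \<Rightarrow> real" where
  "threshold_fun d t = - ln (1 - t) / t ^ d"

definition c_crit :: "nat \<Rightarrow> real" where
  "c_crit d = (LEAST m. m \<in> threshold_fun d ` {0<..<1})"

text \<open>For \<open>d \<ge> 2\<close> the minimum is attained, so \<open>LEAST\<close> is well defined.\<close>

lemma threshold_fun_attains_min:
  assumes "d \<ge> 2"
  obtains t where "0 < t" "t < 1" "\<And>s. 0 < s \<Longrightarrow> s < 1 \<Longrightarrow> threshold_fun d t \<le> threshold_fun d s"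
proof -
  define M where "M = threshold_fun d (1/2)"
  define a where "a = min (1/2) (inverse (\<bar>M\<bar> + 1))"
  define b where "b = max (1/2) (1 - exp (- M))"
  have a: "0 < a" "a \<le> 1/2" and b: "1/2 \<le> b" "b < 1"
    by (auto simp: a_def b_def)
  have "continuous_on {a..b} (threshold_fun d)"
    unfolding threshold_fun_def using a b by (intro continuous_intros) auto
  moreover have "{a..b} \<noteq> {}" using a b by simp
  ultimately obtain t where t: "t \<in> {a..b}" "\<And>s. s \<in> {a..b} \<Longrightarrow> threshold_fun d t \<le> threshold_fun d s"
    using continuous_attains_inf[of "{a..b}" "threshold_fun d"] by auto
  have tM: "threshold_fun d t \<le> M"
    unfolding M_def using a b by (intro t) auto
  have "threshold_fun d t \<le> threshold_fun d s" if s: "0 < s" "s < 1" for s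
  proof -
    have ln: "s \<le> - ln (1 - s)"
      using ln_le_minus_one[of "1 - s"] s by simp
    consider "s < a" | "s \<in> {a..b}" | "s > b" by force
    then show ?thesis
    proof cases
      case 1
      have "M \<le> inverse a"
        using a(1) le_imp_inverse_le[of a "inverse (\<bar>M\<bar> + 1)"] by (simp add: a_def)
      also have "inverse a \<le> inverse s" using 1 s by simp
      also have "\<dots> = s / s ^ 2" using s by (simp add: power2_eq_square field_simps)
      also have "\<dots> \<le> s / s ^ d"
        using s assms by (intro divide_left_mono power_decreasing) auto
      also have "\<dots> \<le> threshold_fun d s"
        unfolding threshold_fun_def using s ln by (intro divide_right_mono) auto
      finally show ?thesis using tM by simp
    next
      case 3
      have "1 - s < exp (- M)" using 3 by (simp add: b_def)
      then have "ln (1 - s) < - M" using s by (metis diff_gt_0_iff_gt ln_exp ln_less_cancel_iff exp_gt_zero)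
      then have "M \<le> - ln (1 - s) / 1" by simp
      also have "\<dots> \<le> threshold_fun d s"
        unfolding threshold_fun_def using s ln by (intro divide_left_mono) (auto simp: power_le_one)
      finally show ?thesis using tM by simp
    qed (use t in simp)
  qed
  with that[of t] t(1) a b show thesis by auto
qed

lemma c_crit_is_min:
  assumes "d \<ge> 2"
  shows "c_crit d \<in> threshold_fun d ` {0<..<1}"
    and "0 < s \<Longrightarrow> s < 1 \<Longrightarrow> c_crit d \<le> threshold_fun d s"
proof -
  obtain t where t: "0 < t" "t < 1" "\<And>s. 0 < s \<Longrightarrow> s < 1 \<Longrightarrow> threshold_fun d t \<le> threshold_fun d s"
    using threshold_fun_attains_min[OF assms] by blast
  have "c_crit d = threshold_fun d t"
    unfolding c_crit_def using t by (intro Least_equality) auto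
  then show "c_crit d \<in> threshold_fun d ` {0<..<1}"
    and "0 < s \<Longrightarrow> s < 1 \<Longrightarrow> c_crit d \<le> threshold_fun d s"
    using t by auto
qed

end

theory Submission
  imports Defs "HOL-Real_Asymp.Real_Asymp"
begin

text \<open>Run a message passing on the pairs of a \<open>(d - 1)\<close>-face \<open>\<theta>\<close> and a \<open>d\<close>-face \<open>\<sigma> \<supseteq> \<theta>\<close>: initially
  all pairs are alive, and a pair stays alive while \<open>\<theta>\<close> lies in some \<open>\<sigma>' \<noteq> \<sigma>\<close> all of whose
  other pairs are alive. Once the messages are stationary, the pairs whose partner pairs are alive
  survive every elementary collapse, so it suffices that the messages are stationary after about
  \<open>root 8 n\<close> rounds without having died out.

  The probability of being alive follows the iteration \<open>x \<mapsto> 1 - exp (- c * x ^ d)\<close> from \<open>1\<close>, whose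
  limit \<open>t\<close> is positive for \<open>c > c_crit d\<close>. Lower bounds hold after deleting the stars of a few
  \<open>(d - 1)\<close>-faces and up to stretched exponentially small error, by concentration on blocks of
  vertices that see disjoint sets of faces. They yield matching upper bounds for finitely many
  rounds through Harris' inequality.

  A pair that dies late dies because a partner died one round earlier, and so on; this traces a long
  chain of \<open>d\<close>-faces. At each of its steps the next \<open>(d - 1)\<close>-face has no further supporting
  \<open>d\<close>-face while the remaining \<open>d - 1\<close> partners are alive, which multiplies the expected number of
  chains by about \<open>d * c * t ^ (d - 1) * exp (- c * t ^ d)\<close>. This is the derivative of the iteration
  at its stable fixed point \<open>t\<close>, hence less than \<open>1\<close>.\<close>

section \<open>Random subsets of a finite set\<close>

text \<open>The obstacle is that messages are dependent and that the number of rounds grows with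
  \<open>n\<close>. Deleting stars restores independence: what a round needs from the deeper rounds
  is decided outside the stars that it exposes itself, so the two sources of randomness separate by
  conditioning. By monotonicity the lower bounds persist when the deleted faces return.

  Upper bounds are affordable only for a fixed number \<open>K\<close> of rounds, because a target
  branches like \<open>(d + 1) ^ K\<close>; \<open>K\<close> is chosen to bring them close to
  \<open>t\<close>. Upper bounds for the living partners and lower bounds for the supporters of the
  dying facet then give a factor per chain step close to the derivative at \<open>t\<close>.

  Three demands fix the sizes. The chain length must beat \<open>ln n\<close>, since the starting
  faces cost \<open>n ^ (d + 1)\<close>. The block size must beat the number of rounds times
  \<open>ln n\<close>, since each round multiplies the error by a power of \<open>n\<close>. Rounds
  times block size must stay far below \<open>n\<close>, since that many vertices are lost to the
  deletions.\<close>

definition bexp :: "'a set \<Rightarrow> real \<Rightarrow> ('a set \<Rightarrow> real) \<Rightarrow> real" where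
  "bexp E p f = (\<Sum>X\<in>Pow E. p ^ card X * (1 - p) ^ card (E - X) * f X)"

abbreviation bprob :: "'a set \<Rightarrow> real \<Rightarrow> ('a set \<Rightarrow> bool) \<Rightarrow> real" where
  "bprob E p P \<equiv> bexp E p (\<lambda>X. of_bool (P X))"

lemma bexp_empty [simp]: "bexp {} p f = f {}"
  by (simp add: bexp_def)

lemma bexp_cong:
  assumes "\<And>X. X \<subseteq> E \<Longrightarrow> f X = g X"
  shows "bexp E p f = bexp E p g"
  unfolding bexp_def using assms by (intro sum.cong) auto

lemma bexp_insert:
  assumes "finite E" "x \<notin> E"
  shows "bexp (insert x E) p f = (1 - p) * bexp E p f + p * bexp E p (\<lambda>X. f (insert x X))"
proof -
  let ?w = "\<lambda>E X. p ^ card X * (1 - p) ^ card (E - X)"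
  have inj: "inj_on (insert x) (Pow E)"
    using assms(2) by (intro inj_onI) (metis PowD insert_ident subsetD)
  have "bexp (insert x E) p f
      = (\<Sum>X\<in>Pow E. ?w (insert x E) X * f X) + (\<Sum>X\<in>insert x ` Pow E. ?w (insert x E) X * f X)"
    unfolding bexp_def Pow_insert using assms by (intro sum.union_disjoint) auto
  also have "(\<Sum>X\<in>Pow E. ?w (insert x E) X * f X) = (1 - p) * bexp E p f"
    unfolding bexp_def sum_distrib_left
  proof (intro sum.cong refl)
    fix X assume "X \<in> Pow E"
    then have "insert x E - X = insert x (E - X)" using assms(2) by auto
    then have "card (insert x E - X) = Suc (card (E - X))" using assms by simp
    then show "?w (insert x E) X * f X = (1 - p) * (?w E X * f X)" by simp
  qed
  also have "(\<Sum>X\<in>insert x ` Pow E. ?w (insert x E) X * f X) = p * bexp E p (\<lambda>X. f (insert x X))"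
    unfolding bexp_def sum_distrib_left sum.reindex[OF inj] o_def
  proof (intro sum.cong refl)
    fix X assume X: "X \<in> Pow E"
    then have "insert x E - insert x X = E - X" using assms(2) by auto
    moreover have "card (insert x X) = Suc (card X)"
      using X assms by (meson PowD card_insert_disjoint finite_subset subsetD)
    ultimately show "?w (insert x E) (insert x X) * f (insert x X) = p * (?w E X * f (insert x X))"
      by simp
  qed
  finally show ?thesis .
qed

lemma bexp_add: "bexp E p (\<lambda>X. f X + g X) = bexp E p f + bexp E p g"
  by (simp add: bexp_def algebra_simps sum.distrib)

lemma bexp_cmult: "bexp E p (\<lambda>X. a * f X) = a * bexp E p f"
  by (simp add: bexp_def sum_distrib_left algebra_simps)

lemma bexp_sum: "bexp E p (\<lambda>X. \<Sum>i\<in>I. f i X) = (\<Sum>i\<in>I. bexp E p (f i))"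
  by (simp add: bexp_def sum_distrib_left sum.swap[of _ "Pow E" I])

lemma bexp_const:
  assumes "finite E"
  shows "bexp E p (\<lambda>X. a) = a"
  using assms by (induction E rule: finite_induct) (simp_all add: bexp_insert algebra_simps)

text \<open>Fubini for the product measure. All conditioning goes through this split: the faces in
  \<open>A\<close> are exposed before those in \<open>B\<close>, and no conditional probability
  appears.\<close>

lemma bexp_union:
  assumes "finite A" "finite B" "A \<inter> B = {}"
  shows "bexp (A \<union> B) p f = bexp A p (\<lambda>X. bexp B p (\<lambda>Y. f (X \<union> Y)))"
  using assms
proof (induction A arbitrary: f rule: finite_induct)
  case (insert x A)
  have "bexp (insert x A \<union> B) p f
      = (1 - p) * bexp (A \<union> B) p f + p * bexp (A \<union> B) p (\<lambda>X. f (insert x X))"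
    using insert by (simp add: bexp_insert)
  then show ?case using insert by (simp add: bexp_insert)
qed simp

text \<open>Planting: the right side averages over all of \<open>E\<close> again with the coordinate
  of \<open>x\<close> overwritten, so the ground set need not change after conditioning on the
  presence of \<open>x\<close>.\<close>

lemma bexp_mem:
  assumes "finite E" "x \<in> E"
  shows "bexp E p (\<lambda>X. of_bool (x \<in> X) * f X) = p * bexp E p (\<lambda>X. f (insert x X))"
proof -
  obtain E' where E: "E = insert x E'" "x \<notin> E'" "finite E'"
    using assms by (metis Set.set_insert finite_insert)
  have "bexp E' p (\<lambda>X. of_bool (x \<in> X) * f X) = bexp E' p (\<lambda>X. 0)"
    using E(2) by (intro bexp_cong) auto
  then have "bexp E' p (\<lambda>X. of_bool (x \<in> X) * f X) = 0"
    using E(3) by (simp add: bexp_const)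
  then show ?thesis
    using E by (simp add: bexp_insert algebra_simps)
qed

lemma bexp_superset:
  assumes "finite E" "S \<subseteq> E"
  shows "bexp E p (\<lambda>X. of_bool (S \<subseteq> X) * f X) = p ^ card S * bexp E p (\<lambda>X. f (X \<union> S))"
proof -
  have "finite S" using assms finite_subset by auto
  then show ?thesis using assms(2)
  proof (induction S arbitrary: f rule: finite_induct)
    case (insert x S)
    have "bexp E p (\<lambda>X. of_bool (insert x S \<subseteq> X) * f X)
        = bexp E p (\<lambda>X. of_bool (x \<in> X) * (of_bool (S \<subseteq> X) * f X))"
      by (intro bexp_cong) auto
    also have "\<dots> = p * bexp E p (\<lambda>X. of_bool (S \<subseteq> insert x X) * f (insert x X))"
      using insert by (subst bexp_mem[OF assms(1)]) auto
    also have "(\<lambda>X. of_bool (S \<subseteq> insert x X) * f (insert x X))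
        = (\<lambda>X. of_bool (S \<subseteq> X) * f (insert x X))"
      using insert.hyps by (intro ext) (auto simp: subset_insert)
    also have "p * bexp E p \<dots> = p * (p ^ card S * bexp E p (\<lambda>X. f (insert x (X \<union> S))))"
      using insert by (subst insert.IH) auto
    finally show ?case using insert by (simp add: algebra_simps)
  qed simp
qed

section \<open>Correlation, conditioning and concentration for the product measure\<close>

locale bernoulli =
  fixes p :: real
  assumes p01: "0 \<le> p" "p \<le> 1"
begin

lemma bexp_mono:
  assumes "\<And>X. X \<subseteq> E \<Longrightarrow> f X \<le> g X"
  shows "bexp E p f \<le> bexp E p g"
  unfolding bexp_def using assms p01 by (intro sum_mono mult_left_mono) auto

lemma bexp_nonneg:
  assumes "\<And>X. X \<subseteq> E \<Longrightarrow> 0 \<le> f X"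
  shows "0 \<le> bexp E p f"
  unfolding bexp_def using assms p01 by (intro sum_nonneg mult_nonneg_nonneg) auto

lemma bprob_le_1: "finite E \<Longrightarrow> bprob E p P \<le> 1"
  using bexp_mono[of E "\<lambda>X. of_bool (P X)" "\<lambda>_. 1"] by (simp add: bexp_const)

lemma bprob_mono:
  assumes "\<And>X. X \<subseteq> E \<Longrightarrow> P X \<Longrightarrow> Q X"
  shows "bprob E p P \<le> bprob E p Q"
  using assms by (intro bexp_mono) auto

lemma bprob_union_bound:
  assumes "finite I" and "\<And>X. X \<subseteq> E \<Longrightarrow> P X \<Longrightarrow> \<exists>i\<in>I. Q i X"
  shows "bprob E p P \<le> (\<Sum>i\<in>I. bprob E p (Q i))"
proof -
  have "bprob E p P \<le> bexp E p (\<lambda>X. \<Sum>i\<in>I. of_bool (Q i X))"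
  proof (intro bexp_mono)
    fix X assume X: "X \<subseteq> E"
    show "of_bool (P X) \<le> (\<Sum>i\<in>I. of_bool (Q i X) :: real)"
    proof (cases "P X")
      case True
      then obtain i where i: "i \<in> I" "Q i X" using assms(2) X by blast
      then have "(1::real) = of_bool (Q i X)" by simp
      also have "\<dots> \<le> (\<Sum>i\<in>I. of_bool (Q i X))"
        using i assms(1) by (intro member_le_sum) auto
      finally show ?thesis using True by simp
    qed (simp add: sum_nonneg)
  qed
  then show ?thesis by (simp add: bexp_sum)
qed

lemma bprob_disj:
  assumes "\<And>X. X \<subseteq> E \<Longrightarrow> P X \<Longrightarrow> Q X \<or> R X"
  shows "bprob E p P \<le> bprob E p Q + bprob E p R"
proof -
  have "bprob E p P \<le> bexp E p (\<lambda>X. of_bool (Q X) + of_bool (R X))"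
    using assms by (intro bexp_mono) auto
  then show ?thesis by (simp add: bexp_add)
qed

text \<open>Induction on the ground set: splitting on one coordinate leaves, besides the two
  inductive terms, \<open>p * (1 - p)\<close> times the product of the increments of the two
  averages, and these have opposite signs.\<close>

lemma harris:
  assumes "finite E"
    and "\<And>X Y. X \<subseteq> Y \<Longrightarrow> Y \<subseteq> E \<Longrightarrow> f X \<le> f Y"
    and "\<And>X Y. X \<subseteq> Y \<Longrightarrow> Y \<subseteq> E \<Longrightarrow> g Y \<le> g X"
  shows "bexp E p (\<lambda>X. f X * g X) \<le> bexp E p f * bexp E p g"
  using assms
proof (induction E arbitrary: f g rule: finite_induct)
  case (insert x E)
  let ?e = "bexp E p"
  define f1 where "f1 X = f (insert x X)" for X
  define g1 where "g1 X = g (insert x X)" for X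
  have m0: "\<And>X Y. X \<subseteq> Y \<Longrightarrow> Y \<subseteq> E \<Longrightarrow> f X \<le> f Y" "\<And>X Y. X \<subseteq> Y \<Longrightarrow> Y \<subseteq> E \<Longrightarrow> g Y \<le> g X"
    by (rule insert.prems; blast)+
  have m1: "\<And>X Y. X \<subseteq> Y \<Longrightarrow> Y \<subseteq> E \<Longrightarrow> f1 X \<le> f1 Y" "\<And>X Y. X \<subseteq> Y \<Longrightarrow> Y \<subseteq> E \<Longrightarrow> g1 Y \<le> g1 X"
    unfolding f1_def g1_def by (rule insert.prems; blast)+
  have "?e (\<lambda>X. f X * g X) \<le> ?e f * ?e g" "?e (\<lambda>X. f1 X * g1 X) \<le> ?e f1 * ?e g1"
    using insert.IH[OF m0] insert.IH[OF m1] by auto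
  moreover have "?e f \<le> ?e f1" "?e g1 \<le> ?e g"
    unfolding f1_def g1_def by (intro bexp_mono insert.prems; blast)+
  then have "(?e f1 - ?e f) * (?e g1 - ?e g) \<le> 0"
    by (simp add: mult_nonneg_nonpos)
  then have "p * (1 - p) * ((?e f1 - ?e f) * (?e g1 - ?e g)) \<le> 0"
    using p01 by (simp add: mult_nonneg_nonpos)
  ultimately have "(1 - p) * ?e (\<lambda>X. f X * g X) + p * ?e (\<lambda>X. f1 X * g1 X) \<le>
      (1 - p) * (?e f * ?e g) + p * (?e f1 * ?e g1)
      - p * (1 - p) * ((?e f1 - ?e f) * (?e g1 - ?e g))"
    using p01 by (smt (verit) mult_left_mono)
  also have "\<dots> = ((1 - p) * ?e f + p * ?e f1) * ((1 - p) * ?e g + p * ?e g1)"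
    by (simp add: algebra_simps)
  finally show ?case
    unfolding f1_def g1_def by (simp only: bexp_insert[OF insert.hyps(1,2)])
qed simp

lemma bprob_harris:
  assumes "finite E"
    and "\<And>X Y. X \<subseteq> Y \<Longrightarrow> Y \<subseteq> E \<Longrightarrow> P X \<Longrightarrow> P Y"
    and "\<And>X Y. X \<subseteq> Y \<Longrightarrow> Y \<subseteq> E \<Longrightarrow> Q Y \<Longrightarrow> Q X"
  shows "bprob E p (\<lambda>X. P X \<and> Q X) \<le> bprob E p P * bprob E p Q"
  using harris[of E "\<lambda>X. of_bool (P X)" "\<lambda>X. of_bool (Q X)"] assms
  by (auto simp: of_bool_conj)

lemma bprob_avoid:
  assumes "finite E" "S \<subseteq> E"
  shows "bprob E p (\<lambda>X. X \<inter> S = {}) = (1 - p) ^ card S"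
proof -
  have fS: "finite S" using assms finite_subset by auto
  have 0: "bprob S p (\<lambda>Y. Y = {}) = (1 - p) ^ card S"
  proof -
    have "bprob S p (\<lambda>Y. Y = {}) = (\<Sum>X\<in>{{}}. p ^ card X * (1 - p) ^ card (S - X) * of_bool (X = {}))"
      unfolding bexp_def using fS by (intro sum.mono_neutral_right) auto
    then show ?thesis by simp
  qed
  have "bprob E p (\<lambda>X. X \<inter> S = {}) = bprob ((E - S) \<union> S) p (\<lambda>X. X \<inter> S = {})"
    using assms by (simp add: Un_absorb2)
  also have "\<dots> = bexp (E - S) p (\<lambda>X. bprob S p (\<lambda>Y. (X \<union> Y) \<inter> S = {}))"
    using assms fS by (intro bexp_union) auto
  also have "\<dots> = bexp (E - S) p (\<lambda>X. bprob S p (\<lambda>Y. Y = {}))"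
  proof (intro bexp_cong)
    fix X Y assume "X \<subseteq> E - S" "Y \<subseteq> S"
    then have "((X \<union> Y) \<inter> S = {}) = (Y = {})" by auto
    then show "of_bool ((X \<union> Y) \<inter> S = {}) = (of_bool (Y = {}) :: real)" by simp
  qed
  finally show ?thesis using assms by (simp add: 0 bexp_const)
qed

text \<open>Deferred exposure: the faces in \<open>S\<close> are revealed last. In the applications
  \<open>S\<close> is the star of some facets, and \<open>h\<close> is the indicator of a bad state
  outside \<open>S\<close> plus an error probability inside it.\<close>

lemma bexp_le_if_section_le:
  assumes "finite E" "S \<subseteq> E"
    and "\<And>X0. X0 \<subseteq> E - S \<Longrightarrow> bexp S p (\<lambda>Y. f (X0 \<union> Y)) \<le> h X0"
  shows "bexp E p f \<le> bexp (E - S) p h"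
proof -
  have fS: "finite S" using assms finite_subset by auto
  have "bexp E p f = bexp ((E - S) \<union> S) p f"
    using assms by (simp add: Un_absorb2)
  also have "\<dots> = bexp (E - S) p (\<lambda>X. bexp S p (\<lambda>Y. f (X \<union> Y)))"
    using assms fS by (intro bexp_union) auto
  also have "\<dots> \<le> bexp (E - S) p h"
    using assms by (intro bexp_mono) auto
  finally show ?thesis .
qed

lemma bexp_restrict:
  assumes "finite E" "S \<subseteq> E"
  shows "bexp E p (\<lambda>X. f (X - S)) = bexp (E - S) p f"
proof -
  have fS: "finite S" using assms finite_subset by auto
  have "bexp E p (\<lambda>X. f (X - S)) = bexp ((E - S) \<union> S) p (\<lambda>X. f (X - S))"
    using assms by (simp add: Un_absorb2)
  also have "\<dots> = bexp (E - S) p (\<lambda>X. bexp S p (\<lambda>Y. f ((X \<union> Y) - S)))"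
    using assms fS by (intro bexp_union) auto
  also have "\<dots> = bexp (E - S) p (\<lambda>X. bexp S p (\<lambda>Y. f X))"
  proof (intro bexp_cong)
    fix X Y assume "X \<subseteq> E - S" "Y \<subseteq> S"
    then have "(X \<union> Y) - S = X" by auto
    then show "f ((X \<union> Y) - S) = f X" by simp
  qed
  finally show ?thesis using fS by (simp add: bexp_const)
qed

text \<open>Functions of disjoint sets of coordinates are independent, so exponential moments
  multiply. The last hypothesis says that \<open>g v\<close> reads only the coordinates in
  \<open>C v\<close>.\<close>

lemma bexp_prod_disjoint:
  assumes "finite V" "\<And>v. v \<in> V \<Longrightarrow> finite (C v)" "disjoint_family_on C V"
    and "\<And>v X. v \<in> V \<Longrightarrow> 0 \<le> g v X"
    and "\<And>v. v \<in> V \<Longrightarrow> bexp (C v) p (g v) \<le> r"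
    and "\<And>v X. v \<in> V \<Longrightarrow> g v (X \<inter> C v) = g v X"
  shows "bexp (\<Union>v\<in>V. C v) p (\<lambda>X. \<Prod>v\<in>V. g v X) \<le> r ^ card V"
  using assms
proof (induction V rule: finite_induct)
  case (insert v V)
  let ?U = "\<Union>v\<in>V. C v"
  have dis: "C v \<inter> ?U = {}"
    using insert.prems(2) insert.hyps by (auto simp: disjoint_family_on_def)
  have dV: "disjoint_family_on C V"
    using insert.prems(2) by (auto simp: disjoint_family_on_def)
  have IH: "bexp ?U p (\<lambda>X. \<Prod>v\<in>V. g v X) \<le> r ^ card V"
    using insert.prems dV by (intro insert.IH) auto
  have "bexp (C v \<union> ?U) p (\<lambda>X. \<Prod>v\<in>insert v V. g v X)
      = bexp (C v) p (\<lambda>X. bexp ?U p (\<lambda>Y. \<Prod>v\<in>insert v V. g v (X \<union> Y)))"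
    using insert.hyps(1) insert.prems(1) dis by (intro bexp_union) auto
  also have "\<dots> = bexp (C v) p (\<lambda>X. bexp ?U p (\<lambda>Y. \<Prod>v\<in>V. g v Y) * g v X)"
  proof (intro bexp_cong)
    fix X assume X: "X \<subseteq> C v"
    have "bexp ?U p (\<lambda>Y. \<Prod>v\<in>insert v V. g v (X \<union> Y))
        = bexp ?U p (\<lambda>Y. g v X * (\<Prod>v\<in>V. g v Y))"
    proof (intro bexp_cong)
      fix Y assume Y: "Y \<subseteq> ?U"
      have "(X \<union> Y) \<inter> C v = X \<inter> C v" using Y dis by auto
      then have 1: "g v (X \<union> Y) = g v X" using insert.prems(5) by (metis insertI1)
      have "g u (X \<union> Y) = g u Y" if "u \<in> V" for u
      proof -
        have "(X \<union> Y) \<inter> C u = Y \<inter> C u" using X dis that by auto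
        then show ?thesis using insert.prems(5) that by (metis insertI2)
      qed
      then show "(\<Prod>v\<in>insert v V. g v (X \<union> Y)) = g v X * (\<Prod>v\<in>V. g v Y)"
        using insert.hyps 1 by simp
    qed
    then show "bexp ?U p (\<lambda>Y. \<Prod>v\<in>insert v V. g v (X \<union> Y)) = bexp ?U p (\<lambda>Y. \<Prod>v\<in>V. g v Y) * g v X"
      by (simp add: bexp_cmult)
  qed
  also have "\<dots> = bexp ?U p (\<lambda>Y. \<Prod>v\<in>V. g v Y) * bexp (C v) p (g v)"
    by (simp add: bexp_cmult)
  also have "\<dots> \<le> r ^ card V * r"
  proof (rule mult_mono[OF IH insert.prems(4)])
    have g0: "0 \<le> bexp (C v) p (g v)"
      using insert.prems(3) by (intro bexp_nonneg) auto
    then have "0 \<le> r" using insert.prems(4)[of v] by simp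
    then show "0 \<le> r ^ card V" by simp
    show "0 \<le> bexp (C v) p (g v)" by (fact g0)
  qed simp
  finally show ?case using insert.hyps by (simp add: mult.commute)
qed simp

text \<open>The exponential moment is taken at \<open>exp (- \<gamma>)\<close>; \<open>1 - exp (- h) \<ge> h - h\<^sup>2 / 2\<close> makes this choice
  good enough.\<close>

lemma lower_tail:
  fixes q a \<gamma> :: real
  assumes "finite V" "\<And>v. v \<in> V \<Longrightarrow> finite (C v)" "disjoint_family_on C V"
    and loc: "\<And>v X. v \<in> V \<Longrightarrow> A v (X \<inter> C v) = A v X"
    and q: "\<And>v. v \<in> V \<Longrightarrow> q \<le> bprob (C v) p (A v)"
    and "0 \<le> q" "q \<le> 1" "0 < \<gamma>" "a + \<gamma> \<le> q"
  shows "bprob (\<Union>v\<in>V. C v) p (\<lambda>X. real (card {v \<in> V. A v X}) < a * card V)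
           \<le> exp (- (\<gamma>\<^sup>2 / 2) * card V)"
proof -
  define h where "h = exp (- \<gamma>)"
  let ?U = "\<Union>v\<in>V. C v"
  have h: "0 < h" "h < 1" using \<open>0 < \<gamma>\<close> by (auto simp: h_def)
  define g where "g v X = (if A v X then h else 1)" for v X
  have g_eq: "g v = (\<lambda>X. 1 + (h - 1) * of_bool (A v X))" for v
    by (auto simp: g_def)
  have bv: "bexp (C v) p (g v) \<le> 1 + (h - 1) * q" if "v \<in> V" for v
  proof -
    have "bexp (C v) p (g v) = 1 + (h - 1) * bprob (C v) p (A v)"
      unfolding g_eq using assms(2) that by (simp add: bexp_add bexp_cmult bexp_const)
    then show ?thesis using q[OF that] h by (simp add: mult_left_mono_neg)
  qed
  have E: "bexp ?U p (\<lambda>X. \<Prod>v\<in>V. g v X) \<le> (1 + (h - 1) * q) ^ card V"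
  proof (rule bexp_prod_disjoint[OF assms(1-3)])
    show "bexp (C v) p (g v) \<le> 1 + (h - 1) * q" if "v \<in> V" for v
      using bv[OF that] .
  qed (use h loc in \<open>simp_all add: g_def\<close>)
  have "bprob ?U p (\<lambda>X. real (card {v \<in> V. A v X}) < a * card V)
      \<le> bexp ?U p (\<lambda>X. exp (\<gamma> * a * card V) * (\<Prod>v\<in>V. g v X))"
  proof (intro bexp_mono)
    fix X
    have "(\<Prod>v\<in>V. g v X) = h ^ card {v \<in> V. A v X}"
      unfolding g_def using assms(1) by (simp add: prod.If_cases Int_def)
    also have "\<dots> = exp (- \<gamma> * card {v \<in> V. A v X})"
      by (simp add: h_def exp_of_nat_mult[symmetric] mult.commute)
    finally have *: "exp (\<gamma> * a * card V) * (\<Prod>v\<in>V. g v X)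
        = exp (\<gamma> * (a * card V - card {v \<in> V. A v X}))"
      by (simp add: exp_add[symmetric] algebra_simps)
    show "of_bool (real (card {v \<in> V. A v X}) < a * card V)
        \<le> exp (\<gamma> * a * card V) * (\<Prod>v\<in>V. g v X)"
      unfolding * using \<open>0 < \<gamma>\<close> by auto
  qed
  also have "\<dots> \<le> exp (\<gamma> * a * card V) * (1 + (h - 1) * q) ^ card V"
    using E by (simp add: bexp_cmult)
  also have "\<dots> \<le> exp (\<gamma> * a * card V) * exp ((h - 1) * q) ^ card V"
  proof (intro mult_left_mono power_mono exp_ge_add_one_self)
    have "q * (1 - h) \<le> 1 * 1" using assms(6,7) h by (intro mult_mono) auto
    then show "0 \<le> 1 + (h - 1) * q" by (simp add: algebra_simps)
  qed auto
  also have "\<dots> = exp ((\<gamma> * a + (h - 1) * q) * card V)"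
    by (simp add: exp_of_nat_mult[symmetric] exp_add[symmetric] algebra_simps)
  also have "\<dots> \<le> exp (- (\<gamma>\<^sup>2 / 2) * card V)"
  proof -
    have "h \<le> 1 - \<gamma> + \<gamma>\<^sup>2 / 2"
    proof -
      have "(\<lambda>x::real. 1 - x + x\<^sup>2 / 2 - exp (- x)) 0 \<le> (\<lambda>x. 1 - x + x\<^sup>2 / 2 - exp (- x)) \<gamma>"
      proof (rule DERIV_nonneg_imp_nondecreasing[where f = "\<lambda>x::real. 1 - x + x\<^sup>2 / 2 - exp (- x)"])
        fix x :: real assume "0 \<le> x" "x \<le> \<gamma>"
        have "((\<lambda>x::real. 1 - x + x\<^sup>2 / 2 - exp (- x)) has_real_derivative (- 1 + x + exp (- x))) (at x)"
          by (auto intro!: derivative_eq_intros)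
        moreover have "- 1 + x + exp (- x) \<ge> 0"
          using exp_ge_add_one_self[of "- x"] by simp
        ultimately show "\<exists>y. ((\<lambda>x::real. 1 - x + x\<^sup>2 / 2 - exp (- x)) has_real_derivative y) (at x) \<and> 0 \<le> y"
          by blast
      qed (use \<open>0 < \<gamma>\<close> in auto)
      then show ?thesis by (simp add: h_def)
    qed
    then have "(h - 1) * q \<le> (- \<gamma> + \<gamma>\<^sup>2 / 2) * q"
      using assms(6) by (intro mult_right_mono) auto
    moreover have "\<gamma> * a \<le> \<gamma> * (q - \<gamma>)" using assms(8,9) by (intro mult_left_mono) auto
    moreover have "\<gamma>\<^sup>2 / 2 * q \<le> \<gamma>\<^sup>2 / 2 * 1" using assms(7) by (intro mult_left_mono) auto
    ultimately have "\<gamma> * a + (h - 1) * q \<le> - (\<gamma>\<^sup>2 / 2)"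
      by (simp add: algebra_simps power2_eq_square)
    then show ?thesis by (intro iffD2[OF exp_le_cancel_iff] mult_right_mono) auto
  qed
  finally show ?thesis .
qed

end

section \<open>The random complex as a random set of \<open>d\<close>-faces\<close>

lemma expectation_Pi_pmf_bexp:
  fixes p :: real
  assumes "finite E" "0 \<le> p" "p \<le> 1"
  shows "measure_pmf.expectation (Pi_pmf E False (\<lambda>_. bernoulli_pmf p)) (\<lambda>A. f {x \<in> E. A x})
      = bexp E p f"
  using assms(1)
proof (induction E arbitrary: f rule: finite_induct)
  case (insert x E)
  let ?P = "\<lambda>E. Pi_pmf E False (\<lambda>_. bernoulli_pmf p)"
  have fin: "finite (set_pmf (?P E))"
    by (rule finite_subset[OF set_Pi_pmf_subset'[OF insert.hyps(1)]])
       (use insert.hyps in \<open>auto intro!: finite_PiE_dflt\<close>)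
  have "measure_pmf.expectation (?P (insert x E)) (\<lambda>A. f {y \<in> insert x E. A y})
     = measure_pmf.expectation (bernoulli_pmf p \<bind> (\<lambda>b. map_pmf (\<lambda>A. A(x := b)) (?P E)))
         (\<lambda>A. f {y \<in> insert x E. A y})"
    using insert.hyps by (simp add: Pi_pmf_insert' map_pmf_def)
  also have "\<dots> = measure_pmf.expectation (bernoulli_pmf p) (\<lambda>b. measure_pmf.expectation (?P E)
         (\<lambda>A. f {y \<in> insert x E. (A(x := b)) y}))"
    using fin by (subst pmf_expectation_bind[of UNIV])
      (auto simp: integral_measure_pmf[of UNIV])
  also have "\<dots> = p * measure_pmf.expectation (?P E) (\<lambda>A. f (insert x {y \<in> E. A y}))
      + (1 - p) * measure_pmf.expectation (?P E) (\<lambda>A. f {y \<in> E. A y})"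
  proof -
    have 1: "{y \<in> insert x E. (A(x := True)) y} = insert x {y \<in> E. A y}" for A
      using insert.hyps by auto
    have 2: "{y \<in> insert x E. (A(x := False)) y} = {y \<in> E. A y}" for A
      using insert.hyps by auto
    show ?thesis
      by (subst integral_bernoulli_pmf[OF assms(2,3)]) (simp only: 1 2 mult.commute)
  qed
  finally show ?case
    using insert.hyps insert.IH[of f] insert.IH[of "\<lambda>X. f (insert x X)"]
    by (simp add: bexp_insert algebra_simps)
qed simp

lemma prob_random_complex:
  assumes "0 \<le> p" "p \<le> 1"
  shows "measure_pmf.prob (random_complex d n p) {X. Q X}
      = bprob (k_subsets n (d + 1)) p (\<lambda>A. Q (full_skeleton d n \<union> A))"
proof -
  let ?E = "k_subsets n (d + 1)"
  have fin: "finite ?E"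
    by (rule finite_subset[of _ "Pow {1..n}"]) (auto simp: k_subsets_def)
  let ?P = "Pi_pmf ?E False (\<lambda>_. bernoulli_pmf p)"
  have "measure_pmf.prob (random_complex d n p) {X. Q X}
      = measure_pmf.expectation (random_complex d n p) (\<lambda>X. of_bool (Q X))"
  proof -
    have "(\<lambda>X. of_bool (Q X) :: real) = indicator {X. Q X}" by (auto simp: indicator_def)
    then show ?thesis by simp
  qed
  also have "\<dots> = measure_pmf.expectation ?P (\<lambda>A. of_bool (Q (full_skeleton d n \<union> {\<sigma> \<in> ?E. A \<sigma>})))"
    by (simp add: random_complex_def)
  also have "\<dots> = bprob ?E p (\<lambda>A. Q (full_skeleton d n \<union> A))"
    using fin assms by (rule expectation_Pi_pmf_bexp)
  finally show ?thesis .
qed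

section \<open>Messages and elementary collapses\<close>

text \<open>The argument \<open>(\<theta>, u)\<close> encodes the pair of \<open>\<theta>\<close> and \<open>insert u \<theta>\<close>; only the faces of \<open>Y\<close> different
  from \<open>insert u \<theta>\<close> count as support. In \<open>good\<close> the last argument is instead the vertex of the supporting
  face.\<close>

primrec alive :: "nat \<Rightarrow> 'a set set \<Rightarrow> 'a set \<Rightarrow> 'a \<Rightarrow> bool" where
  "alive 0 Y \<theta> u \<longleftrightarrow> True"
| "alive (Suc k) Y \<theta> u \<longleftrightarrow> (\<exists>v. v \<notin> \<theta> \<and> v \<noteq> u \<and> insert v \<theta> \<in> Y \<and>
     (\<forall>w\<in>\<theta>. alive k Y (insert v \<theta> - {w}) w))"

definition good :: "nat \<Rightarrow> 'a set set \<Rightarrow> 'a set \<Rightarrow> 'a \<Rightarrow> bool" where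
  "good k Y \<theta> v \<longleftrightarrow> (\<forall>w\<in>\<theta>. alive k Y (insert v \<theta> - {w}) w)"

lemma alive_Suc:
  "alive (Suc k) Y \<theta> u \<longleftrightarrow> (\<exists>v. v \<notin> \<theta> \<and> v \<noteq> u \<and> insert v \<theta> \<in> Y \<and> good k Y \<theta> v)"
  by (simp add: good_def)

lemma alive_mono:
  assumes "alive k Y \<theta> u" "Y \<subseteq> Z"
  shows "alive k Z \<theta> u"
  using assms(1)
proof (induction k arbitrary: \<theta> u)
  case (Suc k)
  obtain v where "v \<notin> \<theta>" "v \<noteq> u" "insert v \<theta> \<in> Y" "\<And>w. w \<in> \<theta> \<Longrightarrow> alive k Y (insert v \<theta> - {w}) w"
    using Suc.prems by (meson alive.simps(2))
  then show ?case using Suc.IH assms(2) by (subst alive.simps(2)) (intro exI[of _ v], blast)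
qed simp

lemma good_mono: "good k Y \<theta> v \<Longrightarrow> Y \<subseteq> Z \<Longrightarrow> good k Z \<theta> v"
  unfolding good_def by (metis alive_mono)

lemma alive_Suc_imp: "alive (Suc k) Y \<theta> u \<Longrightarrow> alive k Y \<theta> u"
proof (induction k arbitrary: \<theta> u)
  case (Suc k)
  obtain v where "v \<notin> \<theta>" "v \<noteq> u" "insert v \<theta> \<in> Y" "\<And>w. w \<in> \<theta> \<Longrightarrow> alive (Suc k) Y (insert v \<theta> - {w}) w"
    using Suc.prems by (meson alive.simps(2))
  then show ?case using Suc.IH by (subst alive.simps(2)) (intro exI[of _ v], blast)
qed simp

lemma alive_antimono:
  assumes "j \<le> k" "alive k Y \<theta> u"
  shows "alive j Y \<theta> u"
  using assms(1)
proof (induction j rule: inc_induct)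
  case (step j)
  show ?case by (rule alive_Suc_imp) (fact step.IH)
qed (fact assms(2))

lemma good_antimono: "j \<le> k \<Longrightarrow> good k Y \<theta> v \<Longrightarrow> good j Y \<theta> v"
  unfolding good_def using alive_antimono by meson

text \<open>A pair \<open>(\<theta>, \<sigma>)\<close> certifies that \<open>\<sigma>\<close> can be
  collapsed only through \<open>\<theta>\<close>. Pairs are used rather than faces because a face
  may well be lost through that one facet, and then no other pair is harmed.\<close>

definition obstruction :: "nat \<Rightarrow> 'a set set \<Rightarrow> ('a set \<times> 'a set) set \<Rightarrow> bool" where
  "obstruction d X A \<longleftrightarrow> A \<noteq> {} \<and>
     (\<forall>\<theta> \<sigma>. (\<theta>, \<sigma>) \<in> A \<longrightarrow> \<theta> \<subseteq> \<sigma> \<and> \<sigma> \<in> X \<and> card \<sigma> = d + 1 \<and> card \<theta> = d \<and>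
       (\<forall>\<theta>'\<subseteq>\<sigma>. card \<theta>' = d \<and> \<theta>' \<noteq> \<theta> \<longrightarrow> (\<exists>\<sigma>'. \<sigma>' \<noteq> \<sigma> \<and> (\<theta>', \<sigma>') \<in> A)))"

text \<open>The collapsed \<open>(d - 1)\<close>-face \<open>\<tau>\<close> lies in one \<open>d\<close>-face \<open>\<sigma>\<close> only, so a collapse can destroy no
  pair but \<open>(\<tau>, \<sigma>)\<close>, and no remaining pair relies on that one.\<close>

lemma obstruction_collapse:
  assumes "d \<ge> 1" "elementary_collapse d X X'" "obstruction d X A"
  shows "\<exists>A'. obstruction d X' A'"
proof -
  have ne: "A \<noteq> {}"
    and A: "\<And>\<theta> \<sigma>. (\<theta>, \<sigma>) \<in> A \<Longrightarrow> \<theta> \<subseteq> \<sigma> \<and> \<sigma> \<in> X \<and> card \<sigma> = d + 1 \<and> card \<theta> = d"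
    and cl: "\<And>\<theta> \<sigma> \<theta>'. (\<theta>, \<sigma>) \<in> A \<Longrightarrow> \<theta>' \<subseteq> \<sigma> \<Longrightarrow> card \<theta>' = d \<Longrightarrow> \<theta>' \<noteq> \<theta> \<Longrightarrow> \<exists>\<sigma>'. \<sigma>' \<noteq> \<sigma> \<and> (\<theta>', \<sigma>') \<in> A"
    using assms(3) unfolding obstruction_def by blast+
  obtain \<tau> \<sigma>0 where fr: "free_in d X \<tau> \<sigma>0" and X': "X' = X - {\<tau>, \<sigma>0}"
    using assms(2) by (auto simp: elementary_collapse_def)
  have c\<tau>: "card \<tau> = d" and \<sigma>0: "\<sigma>0 \<in> X" "card \<sigma>0 = d + 1" "\<tau> \<subseteq> \<sigma>0"
    and only: "\<And>\<rho>. \<rho> \<in> X \<Longrightarrow> card \<rho> = d + 1 \<Longrightarrow> \<tau> \<subseteq> \<rho> \<Longrightarrow> \<rho> = \<sigma>0"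
    using fr by (auto simp: free_in_def)
  \<comment> \<open>Otherwise \<open>\<tau>\<close> is a further facet of \<open>\<sigma>0\<close>,
    and closure of \<open>A\<close> puts a second face on the free facet
    \<open>\<tau>\<close>.\<close>
  have pair: "\<theta> = \<tau>" if *: "(\<theta>, \<sigma>0) \<in> A" for \<theta>
  proof (rule ccontr)
    assume "\<theta> \<noteq> \<tau>"
    then obtain \<sigma>' where "\<sigma>' \<noteq> \<sigma>0" "(\<tau>, \<sigma>') \<in> A"
      using cl[OF * \<sigma>0(3) c\<tau>] by metis
    then show False using A[of \<tau> \<sigma>'] only[of \<sigma>'] by blast
  qed
  define A' where "A' = A - {(\<tau>, \<sigma>0)}"
  have 1: "\<theta> \<subseteq> \<sigma> \<and> \<sigma> \<in> X' \<and> card \<sigma> = d + 1 \<and> card \<theta> = d" if "(\<theta>, \<sigma>) \<in> A'" for \<theta> \<sigma>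
  proof -
    have "\<sigma> \<noteq> \<sigma>0" using that pair by (auto simp: A'_def)
    moreover have "\<sigma> \<noteq> \<tau>" using A[of \<theta> \<sigma>] that c\<tau> by (auto simp: A'_def)
    ultimately show ?thesis using A[of \<theta> \<sigma>] that by (auto simp: A'_def X')
  qed
  have 2: "\<exists>\<sigma>'. \<sigma>' \<noteq> \<sigma> \<and> (\<theta>', \<sigma>') \<in> A'"
    if *: "(\<theta>, \<sigma>) \<in> A'" "\<theta>' \<subseteq> \<sigma>" "card \<theta>' = d" "\<theta>' \<noteq> \<theta>" for \<theta> \<sigma> \<theta>'
  proof -
    obtain \<sigma>' where s: "\<sigma>' \<noteq> \<sigma>" "(\<theta>', \<sigma>') \<in> A" using cl[of \<theta> \<sigma> \<theta>'] * unfolding A'_def by blast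
    have "(\<theta>', \<sigma>') \<noteq> (\<tau>, \<sigma>0)" using only[of \<sigma>] A[of \<theta> \<sigma>] * s(1) by (auto simp: A'_def)
    then show ?thesis using s by (auto simp: A'_def)
  qed
  \<comment> \<open>If the lost pair was in \<open>A\<close>, another facet of
    \<open>\<sigma>0\<close> has a supporting pair, which is still there; \<open>d \<ge> 1\<close>
    provides such a facet.\<close>
  have "A' \<noteq> {}"
  proof (cases "(\<tau>, \<sigma>0) \<in> A")
    case True
    have "\<tau> \<noteq> {}" using c\<tau> assms(1) by auto
    then obtain x where x: "x \<in> \<tau>" by auto
    have "finite \<sigma>0" using \<sigma>0(2) by (metis card.infinite add_is_0 one_neq_zero)
    then have "card (\<sigma>0 - {x}) = d" using x \<sigma>0 by auto
    moreover have "\<sigma>0 - {x} \<noteq> \<tau>" using x by auto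
    ultimately obtain \<sigma>' where "(\<sigma>0 - {x}, \<sigma>') \<in> A"
      using cl[OF True, of "\<sigma>0 - {x}"] by blast
    then show ?thesis using \<open>\<sigma>0 - {x} \<noteq> \<tau>\<close> by (auto simp: A'_def)
  qed (use ne in \<open>auto simp: A'_def\<close>)
  then have "obstruction d X' A'"
    using 1 2 unfolding obstruction_def by (intro conjI allI impI) blast+
  then show ?thesis by blast
qed

lemma obstruction_imp_not_collapsible:
  assumes "d \<ge> 1" "obstruction d X A"
  shows "\<not> collapsible d X"
proof
  assume "collapsible d X"
  then obtain Y where Y: "(elementary_collapse d)\<^sup>*\<^sup>* X Y" "\<forall>\<sigma>\<in>Y. card \<sigma> \<noteq> d + 1"
    by (auto simp: collapsible_def)
  have "\<exists>A. obstruction d Y A"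
    using Y(1) assms(2)
  proof (induction arbitrary: A rule: converse_rtranclp_induct)
    case (step X X')
    then show ?case using obstruction_collapse[OF assms(1) step.hyps(1)] by blast
  qed blast
  then show False using Y(2) unfolding obstruction_def by fast
qed

text \<open>The \<open>good J\<close> pairs form an obstruction: a partner is alive at level
  \<open>J\<close>, stationarity raises it to \<open>Suc J\<close>, and unfolding that level yields
  another face that is again \<open>good\<close> at \<open>J\<close>. Without stationarity each such
  passage would lose one level.\<close>

lemma not_collapsible_if_stable:
  fixes X :: "'a set set" and d :: nat
  defines "Y \<equiv> {\<sigma> \<in> X. card \<sigma> = d + 1}"
  assumes "d \<ge> 1"
    and stable: "\<And>\<theta> u. u \<notin> \<theta> \<Longrightarrow> insert u \<theta> \<in> Y \<Longrightarrow> alive J Y \<theta> u \<Longrightarrow> alive (Suc J) Y \<theta> u"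
    and ex: "v \<notin> \<theta>" "insert v \<theta> \<in> Y" "good J Y \<theta> v"
  shows "\<not> collapsible d X"
proof -
  define A where "A = {(\<theta>, insert v \<theta>) | \<theta> v. v \<notin> \<theta> \<and> insert v \<theta> \<in> Y \<and> good J Y \<theta> v}"
  have "\<theta> \<subseteq> \<sigma> \<and> \<sigma> \<in> X \<and> card \<sigma> = d + 1 \<and> card \<theta> = d \<and>
     (\<forall>\<theta>'\<subseteq>\<sigma>. card \<theta>' = d \<and> \<theta>' \<noteq> \<theta> \<longrightarrow> (\<exists>\<sigma>'. \<sigma>' \<noteq> \<sigma> \<and> (\<theta>', \<sigma>') \<in> A))"
    if "(\<theta>, \<sigma>) \<in> A" for \<theta> \<sigma>
  proof (intro conjI allI impI)
    from that obtain v where v: "\<sigma> = insert v \<theta>" "v \<notin> \<theta>" "insert v \<theta> \<in> Y" "good J Y \<theta> v"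
      by (auto simp: A_def)
    then have c: "card \<sigma> = d + 1" "\<sigma> \<in> X" by (auto simp: Y_def)
    then have "finite \<sigma>" by (metis card.infinite add_is_0 one_neq_zero)
    then show "\<theta> \<subseteq> \<sigma>" "\<sigma> \<in> X" "card \<sigma> = d + 1" "card \<theta> = d" using v c by auto
    fix \<theta>' assume "\<theta>' \<subseteq> \<sigma>" "card \<theta>' = d \<and> \<theta>' \<noteq> \<theta>"
    then have \<theta>': "\<theta>' \<subseteq> \<sigma>" "card \<theta>' = d" "\<theta>' \<noteq> \<theta>" by auto
    have "card (\<sigma> - \<theta>') = 1" using \<theta>'(1,2) c \<open>finite \<sigma>\<close>
      by (metis add_diff_cancel_left' card_Diff_subset finite_subset)
    then obtain w where w: "\<sigma> - \<theta>' = {w}" by (auto simp: card_1_singleton_iff)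
    then have \<theta>'_eq: "\<theta>' = insert v \<theta> - {w}" and w\<sigma>: "w \<in> \<sigma>" using \<theta>'(1) v(1) by auto
    then have "w \<in> \<theta>" using v(1,2) \<theta>'(3) by auto
    then have "alive J Y \<theta>' w" using v(4) by (simp add: good_def \<theta>'_eq del: insert_Diff_single)
    moreover have "insert w \<theta>' = \<sigma>" using w\<sigma> \<theta>'_eq v(1) by auto
    ultimately have "alive (Suc J) Y \<theta>' w" using stable[of w \<theta>'] v \<theta>'_eq by auto
    then obtain v' where v': "v' \<notin> \<theta>'" "v' \<noteq> w" "insert v' \<theta>' \<in> Y" "good J Y \<theta>' v'"
      by (auto simp: alive_Suc simp del: alive.simps)
    then have "(\<theta>', insert v' \<theta>') \<in> A" by (auto simp: A_def)
    moreover have "insert v' \<theta>' \<noteq> \<sigma>" using v'(1,2) \<open>insert w \<theta>' = \<sigma>\<close> by auto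
    ultimately show "\<exists>\<sigma>'. \<sigma>' \<noteq> \<sigma> \<and> (\<theta>', \<sigma>') \<in> A" by metis
  qed
  moreover have "A \<noteq> {}" using ex by (auto simp: A_def)
  ultimately have "obstruction d X A" unfolding obstruction_def by blast
  then show ?thesis using obstruction_imp_not_collapsible assms(2) by blast
qed

section \<open>A late death leaves a long chain\<close>

text \<open>Chains are listed with the newest face first. A face is fresh if it brings a vertex not seen
  before; the chain then continues through a facet containing that vertex, so the event attached to
  this step concerns unexplored faces. After any other face it may continue from anywhere, which
  costs a factor polynomial in the length.\<close>

fun fresh :: "'a set list \<Rightarrow> bool" where
  "fresh [] \<longleftrightarrow> False"
| "fresh (f # fs) \<longleftrightarrow> fs \<noteq> [] \<and> \<not> f \<subseteq> \<Union> (set fs)"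

definition ext :: "nat \<Rightarrow> 'a set list \<Rightarrow> 'a set set" where
  "ext d fs = {f. card f = d + 1 \<and> f \<notin> set fs \<and>
     (if fresh fs then card (hd fs \<inter> f) = d \<and> \<not> hd fs \<inter> f \<subseteq> \<Union> (set (tl fs))
      else \<exists>g\<in>set fs. card (g \<inter> f) = d)}"

text \<open>Leaving a fresh face through \<open>f \<inter> f'\<close> records that its other new
  facets are alive and that the exit has no further good supporter. The true levels vary along the
  walk between \<open>K\<close> and \<open>J\<close>; by monotonicity they imply the statements at
  the uniform levels \<open>K\<close> and \<open>J\<close>, so the recorded events do not depend on
  the position.\<close>

fun chain :: "nat \<Rightarrow> nat \<Rightarrow> nat \<Rightarrow> 'a set set \<Rightarrow> 'a set list \<Rightarrow> bool" where
  "chain d K J Y [] \<longleftrightarrow> False"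
| "chain d K J Y [f] \<longleftrightarrow> f \<in> Y"
| "chain d K J Y (f' # f # fs) \<longleftrightarrow> chain d K J Y (f # fs) \<and> f' \<in> Y \<and> f' \<in> ext d (f # fs) \<and>
     (fresh (f # fs) \<longrightarrow>
        (\<forall>w\<in>f. f - {w} \<noteq> f \<inter> f' \<and> \<not> f - {w} \<subseteq> \<Union> (set fs) \<longrightarrow> alive K Y (f - {w}) w) \<and>
        (\<forall>v. v \<notin> f \<union> f' \<and> insert v (f \<inter> f') \<in> Y \<longrightarrow> \<not> good J Y (f \<inter> f') v))"

lemma chain_shorten:
  assumes "chain d K J Y fs" "1 \<le> m" "m \<le> length fs"
  shows "\<exists>gs. chain d K J Y gs \<and> length gs = m"
  using assms
proof (induction fs)
  case (Cons f fs)
  show ?case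
  proof (cases "m = length (f # fs)")
    case False
    then have "m \<le> length fs" using Cons.prems by simp
    then obtain g gs where g: "fs = g # gs" using Cons.prems(2) by (cases fs) auto
    then have "chain d K J Y fs" using Cons.prems by simp
    then show ?thesis using Cons.IH Cons.prems \<open>m \<le> length fs\<close> by blast
  qed (use Cons.prems in blast)
qed simp

abbreviation drops :: "nat \<Rightarrow> 'a set set \<Rightarrow> 'a set \<Rightarrow> 'a \<Rightarrow> bool" where
  "drops l Y \<theta> u \<equiv> alive l Y \<theta> u \<and> \<not> alive (Suc l) Y \<theta> u"

lemma drops_unique: "drops l Y \<theta> u \<Longrightarrow> drops l' Y \<theta> u \<Longrightarrow> l = l'"
  by (metis alive_antimono linorder_cases Suc_le_eq)

text \<open>The pairs visited by the walk have pairwise distinct drop levels, so a long walk meets many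
  faces even if it revisits some of them.\<close>

lemma walk_state:
  fixes Y :: "'a set set"
  assumes Y: "\<And>\<sigma>. \<sigma> \<in> Y \<Longrightarrow> card \<sigma> = d + 1"
    and start: "u0 \<notin> \<theta>0" "insert u0 \<theta>0 \<in> Y" "drops J Y \<theta>0 u0"
    and "i \<le> J - K"
  shows "\<exists>fs \<theta> u Vis. chain d K J Y fs \<and> drops (J - i) Y \<theta> u \<and> u \<notin> \<theta> \<and> insert u \<theta> \<in> set fs \<and>
    (fresh fs \<longrightarrow> insert u \<theta> = hd fs \<and> \<not> \<theta> \<subseteq> \<Union> (set (tl fs)) \<and>
      (\<forall>w\<in>hd fs. hd fs - {w} \<noteq> \<theta> \<and> \<not> hd fs - {w} \<subseteq> \<Union> (set (tl fs)) \<longrightarrow> alive K Y (hd fs - {w}) w)) \<and>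
    Vis \<subseteq> {(\<theta>, u). u \<notin> \<theta> \<and> insert u \<theta> \<in> set fs} \<and> finite Vis \<and> card Vis = i + 1 \<and>
    (\<forall>(\<theta>, u)\<in>Vis. \<exists>l\<ge>J - i. drops l Y \<theta> u)"
  using assms(5)
proof (induction i)
  case 0
  \<comment> \<open>A one-face list is not \<open>fresh\<close>, so nothing has to be known yet
    about the other facets of the first face.\<close>
  have "chain d K J Y [insert u0 \<theta>0]" using start by simp
  then show ?case using start
    by (intro exI[of _ "[insert u0 \<theta>0]"] exI[of _ \<theta>0] exI[of _ u0] exI[of _ "{(\<theta>0, u0)}"]) auto
next
  case (Suc i)
  then obtain fs \<theta> u Vis where ch: "chain d K J Y fs" and dr0: "alive (J - i) Y \<theta> u" "\<not> alive (Suc (J - i)) Y \<theta> u"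
    and u: "u \<notin> \<theta>" "insert u \<theta> \<in> set fs"
    and st0: "fresh fs \<longrightarrow> insert u \<theta> = hd fs \<and> \<not> \<theta> \<subseteq> \<Union> (set (tl fs)) \<and>
      (\<forall>w\<in>hd fs. hd fs - {w} \<noteq> \<theta> \<and> \<not> hd fs - {w} \<subseteq> \<Union> (set (tl fs)) \<longrightarrow> alive K Y (hd fs - {w}) w)"
    and vis: "Vis \<subseteq> {(\<theta>, u). u \<notin> \<theta> \<and> insert u \<theta> \<in> set fs}" "finite Vis" "card Vis = i + 1"
      "\<forall>(\<theta>, u)\<in>Vis. \<exists>l\<ge>J - i. drops l Y \<theta> u"
    using Suc.IH[OF Suc_leD[OF Suc.prems]] by (elim exE conjE) (rule that, assumption+)
  have dr: "drops (J - i) Y \<theta> u" using dr0 by blast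
  have st: "insert u \<theta> = hd fs \<and> \<not> \<theta> \<subseteq> \<Union> (set (tl fs)) \<and>
      (\<forall>w\<in>hd fs. hd fs - {w} \<noteq> \<theta> \<and> \<not> hd fs - {w} \<subseteq> \<Union> (set (tl fs)) \<longrightarrow> alive K Y (hd fs - {w}) w)"
    if "fresh fs" using st0 that by blast
  define l where "l = J - Suc i"
  have l: "J - i = Suc l" "K \<le> l" "l \<le> J" using Suc.prems by (auto simp: l_def)
  have fsY: "set fs \<subseteq> Y" using ch by (induction d K J Y fs rule: chain.induct) auto
  have c\<theta>: "card \<theta> = d" "finite \<theta>"
  proof -
    have "card (insert u \<theta>) = d + 1" using Y u fsY by blast
    moreover from this show "finite \<theta>" by (metis card.infinite finite_insert add_is_0 one_neq_zero)
    ultimately show "card \<theta> = d" using u by simp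
  qed
  obtain v where v: "v \<notin> \<theta>" "v \<noteq> u" "insert v \<theta> \<in> Y" "good l Y \<theta> v"
    using dr l(1) by (auto simp: alive_Suc simp del: alive.simps)
  \<comment> \<open>The pair \<open>(\<theta>, u)\<close> is dead one round later, so every
    supporter, in particular \<open>v\<close>, has a partner that is dead at \<open>Suc l\<close>.
    Since \<open>v\<close> is \<open>good l\<close>, this partner drops exactly at
    \<open>l\<close>.\<close>
  have bad: "\<not> good (Suc l) Y \<theta> v'" if "v' \<notin> \<theta>" "v' \<noteq> u" "insert v' \<theta> \<in> Y" for v'
    using dr l(1) that by (auto simp: alive_Suc[of "Suc l"] simp del: alive.simps)
  obtain w where w: "w \<in> \<theta>" "\<not> alive (Suc l) Y (insert v \<theta> - {w}) w"
    using bad[OF v(1-3)] by (auto simp: good_def simp del: alive.simps)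
  define \<theta>' f' where "\<theta>' = insert v \<theta> - {w}" and "f' = insert v \<theta>"
  have dr': "drops l Y \<theta>' w" using w v(4) by (simp add: \<theta>'_def good_def del: alive.simps)
  have f': "insert w \<theta>' = f'" "w \<notin> \<theta>'" using w by (auto simp: \<theta>'_def f'_def)
  define Vis' where "Vis' = insert (\<theta>', w) Vis"
  have new: "(\<theta>', w) \<notin> Vis"
  proof
    assume "(\<theta>', w) \<in> Vis"
    then obtain l' where "l' \<ge> J - i" "drops l' Y \<theta>' w" using vis(4) by blast
    then show False using drops_unique[OF dr'] l by fastforce
  qed
  have vis': "finite Vis'" "card Vis' = Suc i + 1" "\<forall>(\<theta>, u)\<in>Vis'. \<exists>l\<ge>J - Suc i. drops l Y \<theta> u"
  proof -
    show "finite Vis'" "card Vis' = Suc i + 1" using vis new by (auto simp: Vis'_def)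
    show "\<forall>(\<theta>, u)\<in>Vis'. \<exists>l\<ge>J - Suc i. drops l Y \<theta> u"
    proof (clarify)
      fix a b assume "(a, b) \<in> Vis'"
      then consider "a = \<theta>'" "b = w" | "(a, b) \<in> Vis" by (auto simp: Vis'_def)
      then show "\<exists>l\<ge>J - Suc i. drops l Y a b"
      proof cases
        case 1
        then show ?thesis using dr' l_def by (intro exI[of _ l] conjI) auto
      next
        case 2
        then obtain l' where "J - i \<le> l'" "drops l' Y a b" using vis(4) by fast
        then show ?thesis by (intro exI[of _ l'] conjI) auto
      qed
    qed
  qed
  show ?case
  proof (cases "f' \<in> set fs")
    case True
    \<comment> \<open>A fresh face is left through a facet that no older face contains, so the step
      from it leads to a new face. A repeated face therefore occurs only in a state without
      obligations.\<close>
    have "\<not> fresh fs"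
    proof
      assume fr: "fresh fs"
      then obtain g gs where fs: "fs = g # gs" by (cases fs) auto
      have "f' \<notin> set gs" using st[OF fr] fs by (auto simp: f'_def)
      then have "f' = insert u \<theta>" using True st[OF fr] fs by auto
      then show False using v u by (auto simp: f'_def)
    qed
    moreover have "Vis' \<subseteq> {(\<theta>, u). u \<notin> \<theta> \<and> insert u \<theta> \<in> set fs}"
      using vis(1) True f' by (auto simp: Vis'_def)
    ultimately show ?thesis
      using ch dr' f' True vis' unfolding l_def
      by (intro exI[of _ fs] exI[of _ \<theta>'] exI[of _ w] exI[of _ Vis']) auto
  next
    case False
    obtain g gs where fs: "fs = g # gs" using ch by (cases fs) auto
    have int: "insert u \<theta> \<inter> f' = \<theta>" using u v by (auto simp: f'_def)
    have cf': "card f' = d + 1" using Y v by (simp add: f'_def)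
    have e: "f' \<in> ext d fs"
    proof (cases "fresh fs")
      case True
      then show ?thesis using st[OF True] int c\<theta> cf' False by (simp add: ext_def)
    next
      case F: False
      have "\<exists>g\<in>set fs. card (g \<inter> f') = d"
        using u(2) int c\<theta>(1) by (intro bexI[of _ "insert u \<theta>"]) simp_all
      then show ?thesis using F cf' False by (simp add: ext_def)
    qed
    have dec: "\<not> good J Y \<theta> v'" if "v' \<notin> insert u \<theta> \<union> f'" "insert v' \<theta> \<in> Y" for v'
    proof
      assume "good J Y \<theta> v'"
      then have "good (Suc l) Y \<theta> v'" using l Suc.prems by (intro good_antimono[of "Suc l" J]) auto
      then show False using bad[of v'] that by auto
    qed
    have ch': "chain d K J Y (f' # fs)"
      unfolding fs chain.simps(3)
    proof (intro conjI impI)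
      assume fr: "fresh (g # gs)"
      then have g: "g = insert u \<theta>" using st fs by simp
      then have gi: "g \<inter> f' = \<theta>" using int by simp
      show "\<forall>w\<in>g. g - {w} \<noteq> g \<inter> f' \<and> \<not> g - {w} \<subseteq> \<Union> (set gs) \<longrightarrow> alive K Y (g - {w}) w"
        using st fr fs gi by simp
      show "\<forall>v. v \<notin> g \<union> f' \<and> insert v (g \<inter> f') \<in> Y \<longrightarrow> \<not> good J Y (g \<inter> f') v"
        using dec gi g by blast
    next
      show "chain d K J Y (g # gs)" "f' \<in> ext d (g # gs)" using ch e fs by blast+
      show "f' \<in> Y" using v(3) by (simp add: f'_def)
    qed
    have vf: "v \<notin> \<Union> (set fs)" if "fresh (f' # fs)"
      using that u(2) by (auto simp: f'_def)
    have st': "insert w \<theta>' = f' \<and> \<not> \<theta>' \<subseteq> \<Union> (set fs) \<and>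
       (\<forall>w\<in>f'. f' - {w} \<noteq> \<theta>' \<and> \<not> f' - {w} \<subseteq> \<Union> (set fs) \<longrightarrow> alive K Y (f' - {w}) w)"
      if "fresh (f' # fs)"
    proof (intro conjI ballI impI)
      show "insert w \<theta>' = f'" by (fact f')
      have "v \<in> \<theta>'" using v w by (auto simp: \<theta>'_def)
      then show "\<not> \<theta>' \<subseteq> \<Union> (set fs)" using vf[OF that] by auto
      fix x assume x: "x \<in> f'" "f' - {x} \<noteq> \<theta>' \<and> \<not> f' - {x} \<subseteq> \<Union> (set fs)"
      \<comment> \<open>The facet opposite \<open>v\<close> is \<open>\<theta>\<close>, which lies
        in an older face. The sides in question are thus opposite vertices of
        \<open>\<theta>\<close> and covered by \<open>good l\<close>.\<close>
      have "x \<noteq> v" using x u(2) v by (auto simp: f'_def)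
      then have "x \<in> \<theta>" using x by (auto simp: f'_def)
      then have "alive l Y (f' - {x}) x" using v(4) by (simp add: good_def f'_def del: insert_Diff_single)
      then show "alive K Y (f' - {x}) x" by (rule alive_antimono[OF l(2)])
    qed
    have "Vis' \<subseteq> {(\<theta>, u). u \<notin> \<theta> \<and> insert u \<theta> \<in> set (f' # fs)}"
      using vis(1) f' by (auto simp: Vis'_def)
    then show ?thesis
      using ch' dr' f' vis' st' unfolding l_def
      by (intro exI[of _ "f' # fs"] exI[of _ \<theta>'] exI[of _ w] exI[of _ Vis'])
         (simp del: chain.simps fresh.simps alive.simps)
  qed
qed

text \<open>The \<open>J - K + 1\<close> visited pairs are distinct incidences of a chain face and
  one of its \<open>d + 1\<close> vertices, so more than \<open>m\<close> faces occur; the chain is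
  then cut to length \<open>m + 1\<close>.\<close>

lemma drop_imp_chain:
  fixes Y :: "'a set set"
  assumes Y: "\<And>\<sigma>. \<sigma> \<in> Y \<Longrightarrow> card \<sigma> = d + 1"
    and "u \<notin> \<theta>" "insert u \<theta> \<in> Y" "drops J Y \<theta> u"
    and J: "J \<ge> K + (d + 1) * m"
  shows "\<exists>fs. chain d K J Y fs \<and> length fs = m + 1"
proof -
  obtain fs Vis where ch: "chain d K J Y fs"
    and vis: "Vis \<subseteq> {(\<theta>, u). u \<notin> \<theta> \<and> insert u \<theta> \<in> set fs}" "finite Vis" "card Vis = (J - K) + 1"
    using walk_state[OF assms(1-4), of "J - K" K] by blast
  have fsY: "set fs \<subseteq> Y" using ch by (induction d K J Y fs rule: chain.induct) auto
  have fin: "finite \<sigma>" if "\<sigma> \<in> set fs" for \<sigma>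
    using Y[of \<sigma>] fsY that by (metis card.infinite subsetD add_is_0 one_neq_zero)
  have "inj_on (\<lambda>(\<theta>, u). (insert u \<theta>, u)) Vis"
  proof (intro inj_onI)
    fix x y assume *: "x \<in> Vis" "y \<in> Vis" "(\<lambda>(\<theta>, u). (insert u \<theta>, u)) x = (\<lambda>(\<theta>, u). (insert u \<theta>, u)) y"
    obtain a b a' b' where xy: "x = (a, b)" "y = (a', b')" by fastforce
    then have "b' = b" "insert b a = insert b a'" "b \<notin> a" "b \<notin> a'" using vis(1) * by auto
    then show "x = y" using xy insert_ident by metis
  qed
  then have "card Vis = card ((\<lambda>(\<theta>, u). (insert u \<theta>, u)) ` Vis)" by (simp add: card_image)
  also have "\<dots> \<le> card (SIGMA f:set fs. f)"
    using vis(1) fin by (intro card_mono) auto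
  also have "\<dots> = (\<Sum>f\<in>set fs. d + 1)"
  proof -
    have "(\<Sum>f\<in>set fs. card f) = (\<Sum>f\<in>set fs. d + 1)" using Y fsY by (intro sum.cong) auto
    then show ?thesis using fin by (subst card_SigmaI) auto
  qed
  also have "\<dots> = (d + 1) * card (set fs)" by simp
  also have "\<dots> \<le> (d + 1) * length fs" by (intro mult_left_mono card_length) auto
  finally have "(d + 1) * m < (d + 1) * length fs" using vis(3) J by linarith
  then have "m < length fs" by (simp only: mult_less_cancel1)
  then have "m + 1 \<le> length fs" by simp
  then show ?thesis using chain_shorten[OF ch, of "m + 1"] by simp
qed

context bernoulli
begin

lemma bprob_compl:
  assumes "finite E"
  shows "bprob E p (\<lambda>X. \<not> P X) = 1 - bprob E p P"
proof -
  have "bprob E p (\<lambda>X. \<not> P X) = bexp E p (\<lambda>X. 1 + (- 1) * of_bool (P X))"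
    by (intro bexp_cong) auto
  also have "\<dots> = 1 - bprob E p P"
    using assms by (subst bexp_add, subst bexp_cmult) (simp add: bexp_const)
  finally show ?thesis .
qed

lemma bprob_increasing_inter:
  assumes "finite E"
    and P: "\<And>X Y. X \<subseteq> Y \<Longrightarrow> Y \<subseteq> E \<Longrightarrow> P X \<Longrightarrow> P Y"
    and Q: "\<And>X Y. X \<subseteq> Y \<Longrightarrow> Y \<subseteq> E \<Longrightarrow> Q X \<Longrightarrow> Q Y"
  shows "bprob E p P * bprob E p Q \<le> bprob E p (\<lambda>X. P X \<and> Q X)"
proof -
  have "bprob E p (\<lambda>X. P X \<and> \<not> Q X) \<le> bprob E p P * bprob E p (\<lambda>X. \<not> Q X)"
    using assms(1) by (rule bprob_harris) (use P Q in blast)+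
  also have "\<dots> = bprob E p P - bprob E p P * bprob E p Q"
    using assms(1) by (simp add: bprob_compl algebra_simps)
  finally have 1: "bprob E p (\<lambda>X. P X \<and> \<not> Q X) \<le> bprob E p P - bprob E p P * bprob E p Q" .
  have "bprob E p P \<le> bprob E p (\<lambda>X. P X \<and> Q X) + bprob E p (\<lambda>X. P X \<and> \<not> Q X)"
    by (rule bprob_disj) blast
  then show ?thesis using 1 by linarith
qed

lemma bprob_increasing_Ball:
  assumes "finite E" "finite I"
    and "\<And>i X Y. i \<in> I \<Longrightarrow> X \<subseteq> Y \<Longrightarrow> Y \<subseteq> E \<Longrightarrow> P i X \<Longrightarrow> P i Y"
    and "\<And>i. i \<in> I \<Longrightarrow> r \<le> bprob E p (P i)" and "0 \<le> r"
  shows "r ^ card I \<le> bprob E p (\<lambda>X. \<forall>i\<in>I. P i X)"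
  using assms(2-4)
proof (induction I rule: finite_induct)
  case empty
  then show ?case using assms(1) by (simp add: bexp_const)
next
  case (insert i I)
  have IH: "r ^ card I \<le> bprob E p (\<lambda>X. \<forall>i\<in>I. P i X)"
    by (rule insert.IH) (use insert.prems in \<open>blast+\<close>)
  have "r ^ card (insert i I) = r * r ^ card I" using insert.hyps by simp
  also have "\<dots> \<le> bprob E p (P i) * bprob E p (\<lambda>X. \<forall>i\<in>I. P i X)"
    using IH insert.prems(2) assms(5) by (intro mult_mono) (auto intro: bexp_nonneg)
  also have "\<dots> \<le> bprob E p (\<lambda>X. P i X \<and> (\<forall>i\<in>I. P i X))"
    using assms(1) by (rule bprob_increasing_inter) (use insert.prems(1) in blast)+
  finally show ?case by simp
qed

end

section \<open>Lower bounds for messages\<close>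

definition star :: "'a set set \<Rightarrow> 'a set set" where
  "star \<Theta> = {\<sigma>. \<exists>\<theta>\<in>\<Theta>. \<theta> \<subseteq> \<sigma>}"

lemma star_mono: "\<Theta> \<subseteq> \<Theta>' \<Longrightarrow> star \<Theta> \<subseteq> star \<Theta>'"
  by (auto simp: star_def)

text \<open>The relevant size of \<open>\<Theta>\<close> is its degree at ridges, that is at sets of
  \<open>d - 1\<close> vertices: only through a ridge of \<open>\<tau>\<close> can
  \<open>\<Theta>\<close> make vertices unusable for \<open>\<tau>\<close>.\<close>

definition spread :: "nat \<Rightarrow> nat set set \<Rightarrow> nat \<Rightarrow> bool" where
  "spread d \<Theta> m \<longleftrightarrow> (\<forall>\<rho>. card \<rho> + 1 = d \<and> finite \<rho> \<longrightarrow> card {v. v \<notin> \<rho> \<and> insert v \<rho> \<in> \<Theta>} \<le> m)"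

text \<open>The face \<open>insert v \<tau>\<close> then avoids the deleted stars except possibly
  through \<open>\<tau>\<close> itself. The exception is deliberate: \<open>\<tau>\<close> may
  belong to \<open>\<Theta>\<close>, since \<open>good\<close> asks only about the other
  facets.\<close>

definition usable :: "'a set set \<Rightarrow> 'a set \<Rightarrow> 'a \<Rightarrow> bool" where
  "usable \<Theta> \<tau> v \<longleftrightarrow> (\<forall>u\<in>\<tau>. insert v (\<tau> - {u}) \<notin> \<Theta>)"

lemma finite_k_subsets: "finite (k_subsets n k)"
  by (rule finite_subset[of _ "Pow {1..n}"]) (auto simp: k_subsets_def)

lemma k_subsetsD:
  assumes "\<tau> \<in> k_subsets n k"
  shows "card \<tau> = k" "\<tau> \<subseteq> {1..n}" "finite \<tau>"
  using assms finite_subset[of \<tau> "{1..n}"] by (auto simp: k_subsets_def)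

lemma exchange_in_k_subsets:
  assumes "\<tau> \<in> k_subsets n k" "u \<in> \<tau>" "v \<in> {1..n}" "v \<notin> \<tau>"
  shows "insert v (\<tau> - {u}) \<in> k_subsets n k"
proof -
  have "card (insert v (\<tau> - {u})) = Suc (card (\<tau> - {u}))"
    using assms k_subsetsD[OF assms(1)] by (intro card_insert_disjoint) auto
  also have "\<dots> = card \<tau>" using assms k_subsetsD[OF assms(1)] by (intro card_Suc_Diff1) auto
  finally show ?thesis using assms by (auto simp: k_subsets_def)
qed

text \<open>An unusable \<open>v\<close> extends one of the \<open>d\<close> ridges
  \<open>\<tau> - {u}\<close> to a member of \<open>\<Theta>\<close>, and each ridge has at most
  \<open>m\<close> such extensions.\<close>

lemma card_unusable:
  assumes "\<tau> \<in> k_subsets n d" "\<Theta> \<subseteq> k_subsets n d" "spread d \<Theta> m" "d \<ge> 1"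
  shows "card {v \<in> {1..n} - \<tau>. \<not> usable \<Theta> \<tau> v} \<le> d * m"
proof -
  note \<tau> = k_subsetsD[OF assms(1)]
  have fin: "finite {v. v \<notin> \<tau> - {u} \<and> insert v (\<tau> - {u}) \<in> \<Theta>}" for u
    by (rule finite_subset[of _ "{1..n}"]) (use assms(2) in \<open>auto simp: k_subsets_def\<close>)
  have "card {v \<in> {1..n} - \<tau>. \<not> usable \<Theta> \<tau> v}
      \<le> card (\<Union>u\<in>\<tau>. {v. v \<notin> \<tau> - {u} \<and> insert v (\<tau> - {u}) \<in> \<Theta>})"
    using \<tau> fin by (intro card_mono finite_UN_I) (auto simp: usable_def)
  also have "\<dots> \<le> (\<Sum>u\<in>\<tau>. card {v. v \<notin> \<tau> - {u} \<and> insert v (\<tau> - {u}) \<in> \<Theta>})"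
    using \<tau> by (intro card_UN_le)
  also have "\<dots> \<le> (\<Sum>u\<in>\<tau>. m)"
  proof (intro sum_mono)
    fix u assume "u \<in> \<tau>"
    then have "card (\<tau> - {u}) + 1 = d" using \<tau> by (metis Suc_eq_plus1 card_Suc_Diff1)
    then show "card {v. v \<notin> \<tau> - {u} \<and> insert v (\<tau> - {u}) \<in> \<Theta>} \<le> m"
      using assms(3) \<tau>(3) unfolding spread_def by blast
  qed
  also have "\<dots> = d * m" using \<tau> by simp
  finally show ?thesis .
qed

text \<open>The budget of one round. A vertex completing some ridge to an exchanged facet lies in
  \<open>V\<close> or in \<open>\<tau>\<close>, whatever the ridge, so the increase is
  \<open>card V + d\<close> although many facets are added.\<close>

lemma spread_exchange:
  assumes \<tau>: "\<tau> \<in> k_subsets n d" and sp: "spread d \<Theta> m" and \<Theta>: "\<Theta> \<subseteq> k_subsets n d"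
    and V: "V \<subseteq> {1..n} - \<tau>"
  shows "spread d (\<Theta> \<union> {insert v (\<tau> - {u}) | u v. u \<in> \<tau> \<and> v \<in> V}) (m + (card V + d))"
  unfolding spread_def
proof (intro allI impI)
  fix \<rho> :: "nat set" assume \<rho>: "card \<rho> + 1 = d \<and> finite \<rho>"
  note t = k_subsetsD[OF \<tau>]
  define T where "T = {insert v (\<tau> - {u}) | u v. u \<in> \<tau> \<and> v \<in> V}"
  have fV: "finite V" using V finite_subset by blast
  have c1: "card {x. x \<notin> \<rho> \<and> insert x \<rho> \<in> \<Theta>} \<le> m" using sp \<rho> unfolding spread_def by blast
  have "{x. x \<notin> \<rho> \<and> insert x \<rho> \<in> T} \<subseteq> V \<union> \<tau>"
  proof
    fix x assume "x \<in> {x. x \<notin> \<rho> \<and> insert x \<rho> \<in> T}"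
    then obtain u v where "insert x \<rho> = insert v (\<tau> - {u})" "v \<in> V" unfolding T_def by blast
    then have "x \<in> insert v (\<tau> - {u})" by (metis insertI1)
    then show "x \<in> V \<union> \<tau>" using \<open>v \<in> V\<close> by blast
  qed
  moreover have "card (V \<union> \<tau>) \<le> card V + d" using card_Un_le[of V \<tau>] t by simp
  ultimately have c2: "card {x. x \<notin> \<rho> \<and> insert x \<rho> \<in> T} \<le> card V + d"
    using card_mono[of "V \<union> \<tau>"] fV t(3) by (meson finite_UnI le_trans)
  have "{x. x \<notin> \<rho> \<and> insert x \<rho> \<in> \<Theta> \<union> T}
      = {x. x \<notin> \<rho> \<and> insert x \<rho> \<in> \<Theta>} \<union> {x. x \<notin> \<rho> \<and> insert x \<rho> \<in> T}" by blast
  also have "card \<dots> \<le> card {x. x \<notin> \<rho> \<and> insert x \<rho> \<in> \<Theta>} + card {x. x \<notin> \<rho> \<and> insert x \<rho> \<in> T}"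
    by (rule card_Un_le)
  also have "\<dots> \<le> m + (card V + d)" using c1 c2 by linarith
  finally show "card {x. x \<notin> \<rho> \<and> insert x \<rho> \<in> \<Theta> \<union> {insert v (\<tau> - {u}) | u v. u \<in> \<tau> \<and> v \<in> V}} \<le> m + (card V + d)"
    unfolding T_def .
qed

lemma face_notin_star:
  assumes "\<Theta> \<subseteq> k_subsets n d" "\<theta> \<in> k_subsets n d" "v \<in> {1..n}" "v \<notin> \<theta>" "\<theta> \<notin> \<Theta>" "usable \<Theta> \<theta> v"
  shows "insert v \<theta> \<notin> star \<Theta>"
proof
  note t = k_subsetsD[OF assms(2)]
  assume "insert v \<theta> \<in> star \<Theta>"
  then obtain \<eta> where \<eta>: "\<eta> \<in> \<Theta>" "\<eta> \<subseteq> insert v \<theta>" by (auto simp: star_def)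
  have c: "card \<eta> = d" "finite \<eta>" using \<eta> assms(1) k_subsetsD by blast+
  have "card (insert v \<theta> - \<eta>) = 1" using c \<eta> t assms(4) by (simp add: card_Diff_subset)
  then obtain e where e: "insert v \<theta> - \<eta> = {e}" by (auto simp: card_1_singleton_iff)
  then have \<eta>_eq: "\<eta> = insert v \<theta> - {e}" using \<eta>(2) by auto
  show False
  proof (cases "e = v")
    case True
    then show False using \<eta>_eq \<eta>(1) assms(4,5) by auto
  next
    case False
    then have "e \<in> \<theta>" "\<eta> = insert v (\<theta> - {e})" using e \<eta>_eq assms(4) by auto
    then show False using assms(6) \<eta>(1) by (auto simp: usable_def)
  qed
qed

text \<open>The sequence \<open>y\<close> bounds the probability of being alive from below, \<open>b\<close> is the block size, and
  \<open>H\<close> bounds the \<open>spread\<close> of the family of facets whose stars are deleted. The slack \<open>\<gamma>\<close> in the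
  recursion of \<open>y\<close> is what the concentration inequality consumes.\<close>

locale lower_run = bernoulli p for p :: real +
  fixes d n b H :: nat and y :: "nat \<Rightarrow> real" and c1 \<gamma> :: real
  assumes d: "d \<ge> 1" and b: "b \<ge> 1" and y01: "\<And>j. 0 \<le> y j" "\<And>j. y j \<le> 1"
    and c1: "0 < c1" "c1 \<le> p * (real n - real (2 * b + d + d * H))"
    and \<gamma>: "0 < \<gamma>" "\<And>j. y (Suc j) ^ d + \<gamma> \<le> (1 - exp (- c1 * y j ^ d)) ^ d"
begin

abbreviation E where "E \<equiv> k_subsets n (d + 1)"
abbreviation F where "F \<equiv> k_subsets n d"

lemma finE: "finite E" by (rule finite_k_subsets)

text \<open>Failure probability for one block after \<open>j\<close> rounds: the block refers to
  \<open>d * b\<close> exchanged facets, each with at most \<open>n\<close> candidate vertices that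
  cost one earlier error each; the last term is the concentration bound.\<close>

primrec err :: "nat \<Rightarrow> real" where
  "err 0 = 0"
| "err (Suc j) = real (d * b * n) * err j + exp (- (\<gamma>\<^sup>2 / 2) * b)"

lemma err_nonneg: "0 \<le> err j"
  by (induction j) auto

text \<open>Cut \<open>U\<close> into blocks of size \<open>b\<close>; fewer than \<open>b\<close>
  vertices remain, which is the subtracted \<open>real b\<close>. One error per block is bounded
  crudely by one per vertex.\<close>

lemma many_if_blocks:
  assumes blk: "\<And>V. V \<subseteq> {1..n} - \<tau> \<Longrightarrow> card V = b \<Longrightarrow> \<forall>v\<in>V. usable \<Theta> \<tau> v \<Longrightarrow>
      bprob E p (\<lambda>X. real (card {v \<in> V. good j (X - star \<Theta>) \<tau> v}) < y j ^ d * real b) \<le> err j"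
    and "U \<subseteq> {1..n} - \<tau>" "\<forall>v\<in>U. usable \<Theta> \<tau> v"
  shows "bprob E p (\<lambda>X. real (card {v \<in> U. good j (X - star \<Theta>) \<tau> v}) < y j ^ d * (real (card U) - real b))
     \<le> real (card U) * err j"
  using assms(2,3)
proof (induction "card U" arbitrary: U rule: less_induct)
  case less
  have fU: "finite U" using less.prems finite_subset by blast
  let ?N = "\<lambda>U X. real (card {v \<in> U. good j (X - star \<Theta>) \<tau> v})"
  show ?case
  proof (cases "card U < b")
    case True
    then have "y j ^ d * (real (card U) - real b) \<le> 0"
      using y01 by (intro mult_nonneg_nonpos) auto
    then have "\<not> ?N U X < y j ^ d * (real (card U) - real b)" for X
      by (smt (verit) of_nat_0_le_iff)
    then show ?thesis using finE err_nonneg by (simp add: bexp_const)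
  next
    case False
    then obtain V where V: "V \<subseteq> U" "card V = b" using obtain_subset_with_card_n by (metis not_less)
    define U' where "U' = U - V"
    have fV: "finite V" using V fU finite_subset by blast
    have cU: "card U = card U' + b" using V fV card_mono[OF fU V(1)] by (simp add: U'_def card_Diff_subset)
    have "bprob E p (\<lambda>X. ?N U X < y j ^ d * (real (card U) - real b))
       \<le> bprob E p (\<lambda>X. ?N V X < y j ^ d * real b) + bprob E p (\<lambda>X. ?N U' X < y j ^ d * (real (card U') - real b))"
    proof (rule bprob_disj)
      fix X assume X: "?N U X < y j ^ d * (real (card U) - real b)"
      have "{v \<in> U. good j (X - star \<Theta>) \<tau> v}
          = {v \<in> V. good j (X - star \<Theta>) \<tau> v} \<union> {v \<in> U'. good j (X - star \<Theta>) \<tau> v}"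
        using V by (auto simp: U'_def)
      then have "?N U X = ?N V X + ?N U' X"
        using fV fU by (subst of_nat_add[symmetric], subst card_Un_disjoint[symmetric]) (auto simp: U'_def)
      moreover have "y j ^ d * (real (card U) - real b)
          = y j ^ d * real b + y j ^ d * (real (card U') - real b)"
        by (simp add: cU algebra_simps)
      ultimately show "?N V X < y j ^ d * real b \<or> ?N U' X < y j ^ d * (real (card U') - real b)"
        using X by linarith
    qed
    also have "\<dots> \<le> err j + real (card U') * err j"
    proof (intro add_mono)
      show "bprob E p (\<lambda>X. ?N V X < y j ^ d * real b) \<le> err j"
        using V less.prems by (intro blk) auto
      show "bprob E p (\<lambda>X. ?N U' X < y j ^ d * (real (card U') - real b)) \<le> real (card U') * err j"
        using less.prems cU b by (intro less.hyps) (auto simp: U'_def)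
    qed
    also have "\<dots> = (real (card U') + 1) * err j" by (simp add: algebra_simps)
    also have "\<dots> \<le> real (card U) * err j" using cU b err_nonneg by (intro mult_right_mono) auto
    finally show ?thesis .
  qed
qed

text \<open>One round: conditionally on the faces outside the stars of all exchanged facets, the vertices of
  the block succeed independently.\<close>

lemma section_bound:
  assumes \<tau>: "\<tau> \<in> F" and \<Theta>: "\<Theta> \<subseteq> F"
    and V: "V \<subseteq> {1..n} - \<tau>" "card V = b" "\<forall>v\<in>V. usable \<Theta> \<tau> v"
    and \<Theta>': "\<Theta>' = \<Theta> \<union> {insert v (\<tau> - {u}) | u v. u \<in> \<tau> \<and> v \<in> V}"
    and S: "S = E \<inter> star \<Theta>'" and X0: "X0 \<subseteq> E - S"
    and U: "\<And>u v. u \<in> \<tau> \<Longrightarrow> v \<in> V \<Longrightarrow>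
      U u v \<subseteq> {x \<in> {1..n}. x \<notin> V \<union> \<tau> \<and> usable \<Theta>' (insert v (\<tau> - {u})) x}"
    and many: "\<And>u v. u \<in> \<tau> \<Longrightarrow> v \<in> V \<Longrightarrow>
      y j ^ d * (real n - real (2 * b + d + d * H)) \<le> real (card {x \<in> U u v. good j X0 (insert v (\<tau> - {u})) x})"
  shows "bprob S p (\<lambda>Y. real (card {v \<in> V. good (Suc j) (X0 \<union> Y - star \<Theta>) \<tau> v}) < y (Suc j) ^ d * real b)
    \<le> exp (- (\<gamma>\<^sup>2 / 2) * b)"
proof -
  note t = k_subsetsD[OF \<tau>]
  have fV: "finite V" using V finite_subset by blast
  have finS: "finite S" using finE S by auto
  define G where "G u v = {x \<in> U u v. good j X0 (insert v (\<tau> - {u})) x}" for u v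
  define D where "D u v = (\<lambda>x. insert x (insert v (\<tau> - {u}))) ` G u v" for u v
  define C where "C v = (\<Union>u\<in>\<tau>. D u v)" for v
  define A where "A v Y \<longleftrightarrow> (\<forall>u\<in>\<tau>. Y \<inter> D u v \<noteq> {})" for v Y
  have G: "x \<in> {1..n}" "x \<notin> V" "x \<notin> \<tau>" "usable \<Theta>' (insert v (\<tau> - {u})) x" "good j X0 (insert v (\<tau> - {u})) x"
    if "u \<in> \<tau>" "v \<in> V" "x \<in> G u v" for u v x
    using U[OF that(1,2)] that(3) by (auto simp: G_def)
  have finG: "finite (G u v)" if "u \<in> \<tau>" "v \<in> V" for u v
    by (rule finite_subset[of _ "{1..n}"]) (use G(1)[OF that] in blast, simp)
  have vV: "v \<in> {1..n}" "v \<notin> \<tau>" if "v \<in> V" for v using V that by auto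
  have fac: "insert v (\<tau> - {u}) \<in> F" "insert v (\<tau> - {u}) \<in> \<Theta>'" if "u \<in> \<tau>" "v \<in> V" for u v
    using exchange_in_k_subsets[OF \<tau> that(1)] vV[OF that(2)] that by (auto simp: \<Theta>')
  have DE: "insert x (insert v (\<tau> - {u})) \<in> S" "insert x (insert v (\<tau> - {u})) \<notin> star \<Theta>"
    if "u \<in> \<tau>" "v \<in> V" "x \<in> G u v" for u v x
  proof -
    let ?\<theta> = "insert v (\<tau> - {u})"
    note th = k_subsetsD[OF fac(1)[OF that(1,2)]]
    have xn: "x \<notin> ?\<theta>" using G[OF that] that by auto
    then have "insert x ?\<theta> \<in> E" using th G(1)[OF that] by (auto simp: k_subsets_def)
    then show "insert x ?\<theta> \<in> S" using fac(2)[OF that(1,2)] unfolding S star_def by auto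
    have "usable \<Theta> ?\<theta> x" using G(4)[OF that] by (auto simp: usable_def \<Theta>')
    moreover have "?\<theta> \<notin> \<Theta>" using V(3) that by (auto simp: usable_def)
    ultimately show "insert x ?\<theta> \<notin> star \<Theta>"
      using face_notin_star[OF \<Theta> fac(1)[OF that(1,2)] G(1)[OF that] xn] by blast
  qed
  have CS: "(\<Union>v\<in>V. C v) \<subseteq> S" unfolding C_def D_def using DE(1) by blast
  have finC: "finite (C v)" if "v \<in> V" for v
    using CS finS that by (meson UN_upper finite_subset)
  \<comment> \<open>The faces in \<open>C v\<close> meet \<open>V\<close> only in \<open>v\<close>,
    because the supporting vertices avoid \<open>V\<close>. This is the source of the
    independence.\<close>
  have dis: "disjoint_family_on C V"
  proof -
    have "\<sigma> \<inter> V = {v}" if "\<sigma> \<in> C v" "v \<in> V" for \<sigma> v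
    proof -
      obtain u x where ux: "u \<in> \<tau>" "x \<in> G u v" "\<sigma> = insert x (insert v (\<tau> - {u}))"
        using \<open>\<sigma> \<in> C v\<close> unfolding C_def D_def by blast
      then show ?thesis using G(2)[OF ux(1) that(2) ux(2)] V(1) that(2) by auto
    qed
    then show ?thesis unfolding disjoint_family_on_def by blast
  qed
  have A_good: "good (Suc j) (X0 \<union> Y - star \<Theta>) \<tau> v" if "A v Y" "v \<in> V" "Y \<subseteq> S" for v Y
    unfolding good_def
  proof
    fix w assume w: "w \<in> \<tau>"
    then have "Y \<inter> D w v \<noteq> {}" using that(1) unfolding A_def by blast
    then obtain x where x: "x \<in> G w v" "insert x (insert v (\<tau> - {w})) \<in> Y"
      unfolding D_def by blast
    have eq: "insert v \<tau> - {w} = insert v (\<tau> - {w})" using w vV[OF that(2)] by auto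
    have "X0 \<subseteq> X0 \<union> Y - star \<Theta>"
      using X0 star_mono[of \<Theta> \<Theta>'] unfolding S \<Theta>' by blast
    then have "good j (X0 \<union> Y - star \<Theta>) (insert v (\<tau> - {w})) x"
      using G(5)[OF w that(2) x(1)] good_mono by metis
    moreover have "insert x (insert v (\<tau> - {w})) \<in> X0 \<union> Y - star \<Theta>"
      using x DE(2)[OF w that(2) x(1)] by blast
    moreover have "x \<noteq> w" "x \<notin> insert v (\<tau> - {w})"
      using G[OF w that(2) x(1)] w that(2) by auto
    ultimately show "alive (Suc j) (X0 \<union> Y - star \<Theta>) (insert v \<tau> - {w}) w"
      unfolding eq alive_Suc by blast
  qed
  \<comment> \<open>Each of the \<open>d\<close> requirements fails only if all faces of
    \<open>D u v\<close> are absent, and \<open>p\<close> times their number is at least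
    \<open>c1 * y j ^ d\<close>. The requirements are increasing, so positive correlation yields the
    product.\<close>
  have PA: "(1 - exp (- c1 * y j ^ d)) ^ d \<le> bprob (C v) p (A v)" if "v \<in> V" for v
  proof -
    have "(1 - exp (- c1 * y j ^ d)) ^ card \<tau> \<le> bprob (C v) p (\<lambda>Y. \<forall>u\<in>\<tau>. Y \<inter> D u v \<noteq> {})"
    proof (rule bprob_increasing_Ball)
      fix u assume u: "u \<in> \<tau>"
      have "inj_on (\<lambda>x. insert x (insert v (\<tau> - {u}))) (G u v)"
      proof (rule inj_onI)
        fix x x' assume xx: "x \<in> G u v" "x' \<in> G u v" "insert x (insert v (\<tau> - {u})) = insert x' (insert v (\<tau> - {u}))"
        have "x \<notin> insert v (\<tau> - {u})" using G[OF u that xx(1)] that by auto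
        then show "x = x'" using xx(3) by blast
      qed
      then have cD: "card (D u v) = card (G u v)" unfolding D_def by (rule card_image)
      have "c1 * y j ^ d \<le> p * (real n - real (2 * b + d + d * H)) * y j ^ d"
        using c1 y01 by (intro mult_right_mono) auto
      also have "\<dots> \<le> p * real (card (G u v))"
        using many[OF u that] p01 unfolding G_def by (subst mult.assoc, intro mult_left_mono) (auto simp: mult.commute)
      finally have "exp (- p * real (card (G u v))) \<le> exp (- c1 * y j ^ d)" by simp
      moreover have "(1 - p) ^ card (G u v) \<le> exp (- p) ^ card (G u v)"
        using p01 exp_ge_add_one_self[of "- p"] by (intro power_mono) auto
      moreover have "exp (- p) ^ card (G u v) = exp (- p * real (card (G u v)))"
        by (simp add: exp_of_nat_mult[symmetric] mult.commute)
      ultimately have "(1 - p) ^ card (D u v) \<le> exp (- c1 * y j ^ d)"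
        unfolding cD by linarith
      moreover have "D u v \<subseteq> C v" using u by (auto simp: C_def)
      ultimately show "1 - exp (- c1 * y j ^ d) \<le> bprob (C v) p (\<lambda>Y. Y \<inter> D u v \<noteq> {})"
        using bprob_avoid[OF finC[OF that], of "D u v"] bprob_compl[OF finC[OF that], of "\<lambda>Y. Y \<inter> D u v = {}"]
        by simp
    qed (use finC[OF that] t c1 y01 in \<open>auto intro: mult_nonneg_nonneg\<close>)
    then show ?thesis using t by (simp add: A_def)
  qed
  \<comment> \<open>Faces of \<open>S\<close> outside all \<open>C v\<close> are ignored and
    integrated out, which leaves the product structure required by
    \<open>lower_tail\<close>.\<close>
  have "bprob S p (\<lambda>Y. real (card {v \<in> V. good (Suc j) (X0 \<union> Y - star \<Theta>) \<tau> v}) < y (Suc j) ^ d * real b)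
    \<le> bprob S p (\<lambda>Y. real (card {v \<in> V. A v (Y - (S - (\<Union>v\<in>V. C v)))}) < y (Suc j) ^ d * real b)"
  proof (rule bprob_mono)
    fix Y assume Y: "Y \<subseteq> S"
      and lt: "real (card {v \<in> V. good (Suc j) (X0 \<union> Y - star \<Theta>) \<tau> v}) < y (Suc j) ^ d * real b"
    have "{v \<in> V. A v (Y - (S - (\<Union>v\<in>V. C v)))} \<subseteq> {v \<in> V. good (Suc j) (X0 \<union> Y - star \<Theta>) \<tau> v}"
    proof safe
      fix v assume "v \<in> V" "A v (Y - (S - (\<Union>v\<in>V. C v)))"
      then have "A v Y" unfolding A_def by blast
      then show "good (Suc j) (X0 \<union> Y - star \<Theta>) \<tau> v" using A_good \<open>v \<in> V\<close> Y by blast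
    qed
    then have "card {v \<in> V. A v (Y - (S - (\<Union>v\<in>V. C v)))} \<le> card {v \<in> V. good (Suc j) (X0 \<union> Y - star \<Theta>) \<tau> v}"
      using fV by (intro card_mono) auto
    then show "real (card {v \<in> V. A v (Y - (S - (\<Union>v\<in>V. C v)))}) < y (Suc j) ^ d * real b"
      using lt by linarith
  qed
  also have "\<dots> = bprob (S - (S - (\<Union>v\<in>V. C v))) p (\<lambda>Y. real (card {v \<in> V. A v Y}) < y (Suc j) ^ d * real b)"
    using finS by (rule bexp_restrict) auto
  also have "S - (S - (\<Union>v\<in>V. C v)) = (\<Union>v\<in>V. C v)" using CS by auto
  also have "bprob (\<Union>v\<in>V. C v) p (\<lambda>Y. real (card {v \<in> V. A v Y}) < y (Suc j) ^ d * real b)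
      \<le> exp (- (\<gamma>\<^sup>2 / 2) * card V)"
    unfolding V(2)[symmetric]
  proof (rule lower_tail[OF fV finC dis _ PA])
    show "A v (Y \<inter> C v) = A v Y" if "v \<in> V" for v Y
    proof -
      have "Y \<inter> C v \<inter> D u v = Y \<inter> D u v" if "u \<in> \<tau>" for u using that by (auto simp: C_def)
      then show ?thesis by (simp add: A_def)
    qed
    have "0 \<le> c1 * y j ^ d" using c1 y01 by simp
    then show "0 \<le> (1 - exp (- c1 * y j ^ d)) ^ d" "(1 - exp (- c1 * y j ^ d)) ^ d \<le> 1"
      by (auto intro!: power_le_one)
  qed (use \<gamma> in auto)
  finally show ?thesis using V by simp
qed

text \<open>Induction on \<open>j\<close> for all \<open>\<tau>\<close>, \<open>\<Theta>\<close> and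
  \<open>V\<close>: once the exchanged facets join \<open>\<Theta>\<close>, the messages of the
  earlier rounds are independent of the faces that decide the present one. \<open>H\<close> bounds
  the spread after all rounds, so at most \<open>d * H\<close> vertices are ever unusable for one
  facet.\<close>

lemma blocks:
  assumes "\<tau> \<in> F" "\<Theta> \<subseteq> F" "spread d \<Theta> m" "m + j * (b + d) \<le> H"
    and "V \<subseteq> {1..n} - \<tau>" "card V = b" "\<forall>v\<in>V. usable \<Theta> \<tau> v"
  shows "bprob E p (\<lambda>X. real (card {v \<in> V. good j (X - star \<Theta>) \<tau> v}) < y j ^ d * real b) \<le> err j"
  using assms
proof (induction j arbitrary: \<tau> \<Theta> m V)
  case 0
  have "y 0 ^ d * real b \<le> real b" using y01 by (simp add: mult_left_le_one_le power_le_one)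
  then have "\<not> (real (card {v \<in> V. good 0 (X - star \<Theta>) \<tau> v}) < y 0 ^ d * real b)" for X
    using 0 by (simp add: good_def)
  then show ?case using finE by (simp add: bexp_const)
next
  case (Suc j)
  note \<tau> = Suc.prems(1) and V = Suc.prems(5-7)
  note t = k_subsetsD[OF \<tau>]
  have fV: "finite V" using V finite_subset by blast
  define \<Theta>' where "\<Theta>' = \<Theta> \<union> {insert v (\<tau> - {u}) | u v. u \<in> \<tau> \<and> v \<in> V}"
  define S where "S = E \<inter> star \<Theta>'"
  define U where "U u v = {x \<in> {1..n}. x \<notin> V \<union> \<tau> \<and> usable \<Theta>' (insert v (\<tau> - {u})) x}" for u v
  define N where "N u v X = real (card {x \<in> U u v. good j X (insert v (\<tau> - {u})) x})" for u v X
  \<comment> \<open>The lost vertices are the \<open>b + d\<close> in \<open>V\<close> and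
    \<open>\<tau>\<close>, at most \<open>d * H\<close> unusable ones and the \<open>b\<close> of an
    incomplete block.\<close>
  define g where "g = y j ^ d * (real n - real (2 * b + d + d * H))"
  have \<Theta>'F: "\<Theta>' \<subseteq> F"
    using Suc.prems(2) exchange_in_k_subsets[OF \<tau>] V by (auto simp: \<Theta>'_def)
  have sp': "spread d \<Theta>' (m + (b + d))"
    using spread_exchange[OF \<tau> Suc.prems(3,2) V(1)] V(2) by (simp add: \<Theta>'_def)
  have mj: "m + (b + d) + j * (b + d) \<le> H" using Suc.prems(4) by simp
  have few: "bprob E p (\<lambda>X. N u v (X - star \<Theta>') < g) \<le> real n * err j" if uv: "u \<in> \<tau>" "v \<in> V" for u v
  proof -
    let ?\<theta> = "insert v (\<tau> - {u})"
    have \<theta>: "?\<theta> \<in> F" using exchange_in_k_subsets[OF \<tau> uv(1)] V(1) uv(2) by auto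
    have Usub: "U u v \<subseteq> {1..n} - ?\<theta>" using uv by (auto simp: U_def)
    have "{1..n} \<subseteq> U u v \<union> (V \<union> \<tau>) \<union> {x \<in> {1..n} - ?\<theta>. \<not> usable \<Theta>' ?\<theta> x}"
      using uv by (auto simp: U_def)
    then have "n \<le> card (U u v \<union> (V \<union> \<tau>) \<union> {x \<in> {1..n} - ?\<theta>. \<not> usable \<Theta>' ?\<theta> x})"
      using card_mono[of "U u v \<union> (V \<union> \<tau>) \<union> {x \<in> {1..n} - ?\<theta>. \<not> usable \<Theta>' ?\<theta> x}" "{1..n}"] fV t(3)
      by (simp add: U_def)
    also have "\<dots> \<le> card (U u v) + (card V + card \<tau>) + card {x \<in> {1..n} - ?\<theta>. \<not> usable \<Theta>' ?\<theta> x}"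
      by (meson add_le_mono card_Un_le le_trans order_refl)
    also have "\<dots> \<le> card (U u v) + (b + d) + d * (m + (b + d))"
      using card_unusable[OF \<theta> \<Theta>'F sp' d] V t by simp
    also have "\<dots> \<le> card (U u v) + (b + d) + d * H"
      using mj by (intro add_left_mono mult_left_mono) auto
    finally have cU: "n \<le> card (U u v) + (b + d) + d * H" .
    have "bprob E p (\<lambda>X. N u v (X - star \<Theta>') < g)
        \<le> bprob E p (\<lambda>X. N u v (X - star \<Theta>') < y j ^ d * (real (card (U u v)) - real b))"
    proof (rule bprob_mono)
      have "real n \<le> real (card (U u v)) + (b + d) + d * H"
        using cU by (metis of_nat_add of_nat_le_iff)
      then have "g \<le> y j ^ d * (real (card (U u v)) - real b)"
        unfolding g_def using y01 by (intro mult_left_mono) auto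
      then show "N u v (X - star \<Theta>') < y j ^ d * (real (card (U u v)) - real b)"
        if "N u v (X - star \<Theta>') < g" for X using that by linarith
    qed
    also have "\<dots> \<le> real (card (U u v)) * err j"
      unfolding N_def
      using Suc.IH[OF \<theta> \<Theta>'F sp' mj] Usub by (intro many_if_blocks) (auto simp: U_def)
    also have "\<dots> \<le> real n * err j"
    proof (intro mult_right_mono err_nonneg)
      have "card (U u v) \<le> card {1..n}" by (intro card_mono) (auto simp: U_def)
      then show "real (card (U u v)) \<le> real n" by simp
    qed
    finally show ?thesis .
  qed
  let ?bad = "\<lambda>X. \<exists>(u, v)\<in>\<tau> \<times> V. N u v X < g"
  have "bprob E p (\<lambda>X. real (card {v \<in> V. good (Suc j) (X - star \<Theta>) \<tau> v}) < y (Suc j) ^ d * real b)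
    \<le> bexp (E - S) p (\<lambda>X0. of_bool (?bad X0) + exp (- (\<gamma>\<^sup>2 / 2) * b))"
  proof (rule bexp_le_if_section_le[OF finE])
    show "S \<subseteq> E" by (auto simp: S_def)
    fix X0 assume X0: "X0 \<subseteq> E - S"
    let ?P = "\<lambda>Y. real (card {v \<in> V. good (Suc j) (X0 \<union> Y - star \<Theta>) \<tau> v}) < y (Suc j) ^ d * real b"
    show "bprob S p ?P \<le> of_bool (?bad X0) + exp (- (\<gamma>\<^sup>2 / 2) * b)"
    proof (cases "?bad X0")
      case True
      have "bprob S p ?P \<le> 1" using finE by (intro bprob_le_1) (auto simp: S_def)
      also have "\<dots> \<le> of_bool (?bad X0) + exp (- (\<gamma>\<^sup>2 / 2) * b)" using True by simp
      finally show ?thesis .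
    next
      case False
      have "bprob S p ?P \<le> exp (- (\<gamma>\<^sup>2 / 2) * b)"
      proof (rule section_bound[OF \<tau> Suc.prems(2) V \<Theta>'_def S_def X0, where U = U])
        show "y j ^ d * (real n - real (2 * b + d + d * H)) \<le> real (card {x \<in> U u v. good j X0 (insert v (\<tau> - {u})) x})"
          if "u \<in> \<tau>" "v \<in> V" for u v
          using False that by (force simp: N_def g_def not_less)
      qed (auto simp: U_def)
      then show ?thesis using False by simp
    qed
  qed
  also have "\<dots> = bprob (E - S) p ?bad + exp (- (\<gamma>\<^sup>2 / 2) * b)"
    using finE by (subst bexp_add) (simp add: bexp_const)
  also have "bprob (E - S) p ?bad = bprob E p (\<lambda>X. ?bad (X - S))"
    using finE by (intro bexp_restrict[symmetric]) (auto simp: S_def)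
  also have "\<dots> \<le> (\<Sum>(u, v)\<in>\<tau> \<times> V. bprob E p (\<lambda>X. N u v (X - star \<Theta>') < g))"
  proof -
    have "bprob E p (\<lambda>X. ?bad (X - S)) \<le> (\<Sum>uv\<in>\<tau> \<times> V. bprob E p (\<lambda>X. N (fst uv) (snd uv) (X - star \<Theta>') < g))"
    proof (rule bprob_union_bound)
      fix X assume X: "X \<subseteq> E" "?bad (X - S)"
      have "X - S = X - star \<Theta>'" using X(1) by (auto simp: S_def)
      then show "\<exists>uv\<in>\<tau> \<times> V. N (fst uv) (snd uv) (X - star \<Theta>') < g" using X(2) by auto
    qed (use fV t in auto)
    then show ?thesis by (simp add: case_prod_beta)
  qed
  also have "\<dots> \<le> (\<Sum>(u, v)\<in>\<tau> \<times> V. real n * err j)"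
    using few by (intro sum_mono) auto
  also have "\<dots> = real (d * b * n) * err j"
    using t V(2) by (simp add: case_prod_beta card_cartesian_product algebra_simps)
  finally show ?case by simp
qed

lemma many:
  assumes "\<tau> \<in> F" "\<Theta> \<subseteq> F" "spread d \<Theta> m" "m + j * (b + d) \<le> H"
    and "U \<subseteq> {1..n} - \<tau>" "\<forall>v\<in>U. usable \<Theta> \<tau> v"
  shows "bprob E p (\<lambda>X. real (card {v \<in> U. good j (X - star \<Theta>) \<tau> v}) < y j ^ d * (real (card U) - real b))
     \<le> real n * err j"
proof -
  have "bprob E p (\<lambda>X. real (card {v \<in> U. good j (X - star \<Theta>) \<tau> v}) < y j ^ d * (real (card U) - real b))
     \<le> real (card U) * err j"
    using blocks[OF assms(1-4)] assms(5,6) by (intro many_if_blocks) auto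
  also have "\<dots> \<le> real n * err j"
  proof (intro mult_right_mono err_nonneg)
    have "card U \<le> card {1..n}" using assms(5) by (intro card_mono) auto
    then show "real (card U) \<le> real n" by simp
  qed
  finally show ?thesis .
qed

end

section \<open>Upper bounds for messages\<close>

text \<open>Candidates are tried in increasing order, so the failures before \<open>v\<close> are
  counted by its rank; a sum over first successes becomes a sum over ranks.\<close>

lemma sum_rank:
  fixes A :: "nat set" and f :: "nat \<Rightarrow> real"
  assumes "finite A"
  shows "(\<Sum>v\<in>A. f (card {x \<in> A. x < v})) = (\<Sum>i<card A. f i)"
  using assms
proof (induction A rule: finite_linorder_max_induct)
  case (insert m A)
  have mA: "m \<notin> A" using insert.hyps(2) by blast
  have 1: "{x \<in> insert m A. x < m} = A" using insert.hyps(2) by auto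
  have "(\<Sum>v\<in>A. f (card {x \<in> insert m A. x < v})) = (\<Sum>v\<in>A. f (card {x \<in> A. x < v}))"
  proof (intro sum.cong refl)
    fix v assume "v \<in> A"
    then have "{x \<in> insert m A. x < v} = {x \<in> A. x < v}" using insert.hyps(2) by fastforce
    then show "f (card {x \<in> insert m A. x < v}) = f (card {x \<in> A. x < v})" by simp
  qed
  moreover have "(\<Sum>v\<in>insert m A. f (card {x \<in> insert m A. x < v}))
      = f (card {x \<in> insert m A. x < m}) + (\<Sum>v\<in>A. f (card {x \<in> insert m A. x < v}))"
    using insert.hyps(1) mA by (rule sum.insert)
  ultimately show ?case
    using insert.hyps(1) mA unfolding 1 insert.IH by (simp add: lessThan_Suc)
qed simp

text \<open>The right side is \<open>exp a\<close> times the integral of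
  \<open>exp (- a * x)\<close> over \<open>{0..m}\<close>. The factor pays for the discretization
  and tends to \<open>1\<close> when \<open>a\<close> is of order \<open>1 / n\<close>.\<close>

lemma geometric_le:
  fixes a :: real
  assumes "0 < a"
  shows "(\<Sum>i<m. exp (- a * real i)) \<le> exp a * (1 - exp (- a * real m)) / a"
proof -
  have "(\<Sum>i<m. exp (- a * real i)) = (\<Sum>i<m. exp (- a) ^ i)"
    by (simp add: exp_of_nat_mult[symmetric] mult.commute)
  also have "\<dots> = (1 - exp (- a) ^ m) / (1 - exp (- a))"
    using assms by (subst sum_gp_strict) auto
  also have "exp (- a) ^ m = exp (- a * real m)"
    by (simp add: exp_of_nat_mult[symmetric] mult.commute)
  also have "(1 - exp (- a * real m)) / (1 - exp (- a)) \<le> (1 - exp (- a * real m)) / (a / exp a)"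
  proof (intro divide_left_mono)
    have "a + 1 \<le> exp a" using exp_ge_add_one_self[of a] by linarith
    then have "a / exp a \<le> (exp a - 1) / exp a" by (intro divide_right_mono) auto
    also have "\<dots> = 1 - exp (- a)" by (simp add: exp_minus field_simps)
    finally show "a / exp a \<le> 1 - exp (- a)" .
  qed (use assms in auto)
  finally show ?thesis by (simp add: mult.commute)
qed

definition fresh_in :: "'a set set \<Rightarrow> 'a set \<Rightarrow> 'a \<Rightarrow> bool" where
  "fresh_in B \<theta> u \<longleftrightarrow> (\<forall>f\<in>B. \<theta> \<subseteq> f \<longrightarrow> f = insert u \<theta>)"

text \<open>A target \<open>(\<theta>, u, k)\<close> asks that \<open>(\<theta>, u)\<close> is alive after \<open>k\<close> rounds, which has weight \<open>z k\<close>. The faces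
  in \<open>B\<close> are known to be present; a target that one of them might support gets the trivial weight
  \<open>1\<close>. The floor \<open>\<zeta>\<close> of \<open>z\<close> bounds the loss when a face is added to \<open>B\<close>.\<close>

locale upper_run = lower_run p d n b H y c1 \<gamma>
  for p :: real and d n b H :: nat and y :: "nat \<Rightarrow> real" and c1 \<gamma> :: real +
  fixes K h :: nat and z :: "nat \<Rightarrow> real" and \<zeta> :: real
  assumes \<zeta>: "0 < \<zeta>" "\<zeta> \<le> 1" "\<And>k. \<zeta> \<le> z k" and z0: "z 0 = 1" and ypos: "\<And>k. 0 < y k"
    and ppos: "0 < p"
    and KH: "1 + K * (b + d) \<le> H"
    and zstep: "\<And>k. k < K \<Longrightarrow>
      z k ^ d * (exp (p * (real b + 1)) * (1 - exp (- (p * n) * y k ^ d)) / y k ^ d + p * real n ^ 2 * err k)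
      + h * p / \<zeta> ^ (d + 1) \<le> z (Suc k)"
begin

definition weight :: "nat set set \<Rightarrow> (nat set \<times> nat \<times> nat) list \<Rightarrow> real" where
  "weight B L = (\<Prod>(\<theta>, u, k)\<leftarrow>L. if fresh_in B \<theta> u then z k else 1)"

text \<open>A target of level \<open>k + 1\<close> is replaced by \<open>d\<close> targets of level
  \<open>k\<close> and one new vertex. With these sizes the measure drops, and explored vertices
  plus size never grow.\<close>

definition size_of :: "(nat set \<times> nat \<times> nat) list \<Rightarrow> nat" where
  "size_of L = (\<Sum>(\<theta>, u, k)\<leftarrow>L. (d + 1) ^ k)"

definition all_alive :: "nat set set \<Rightarrow> (nat set \<times> nat \<times> nat) list \<Rightarrow> nat set set \<Rightarrow> bool" where
  "all_alive B L X \<longleftrightarrow> (\<forall>(\<theta>, u, k)\<in>set L. alive k (X \<union> B) \<theta> u)"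

definition targets :: "nat set \<Rightarrow> (nat set \<times> nat \<times> nat) list \<Rightarrow> bool" where
  "targets W L \<longleftrightarrow> distinct (map fst L) \<and> (\<forall>(\<theta>, u, k)\<in>set L. \<theta> \<in> F \<and> u \<notin> \<theta> \<and> k \<le> K \<and> insert u \<theta> \<subseteq> W)"

lemma zpos: "0 < z k"
  using \<zeta> by (meson less_le_trans)

lemma weight_nonneg: "0 \<le> weight B L"
  unfolding weight_def using zpos by (induction L) (auto simp: less_imp_le)

lemma all_alive_mono: "all_alive B L X \<Longrightarrow> X \<subseteq> Y \<Longrightarrow> all_alive B L Y"
proof -
  assume *: "all_alive B L X" "X \<subseteq> Y"
  then have sub: "X \<union> B \<subseteq> Y \<union> B" by blast
  show ?thesis
    unfolding all_alive_def
  proof clarify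
    fix \<theta> u k assume "(\<theta>, u, k) \<in> set L"
    then have "alive k (X \<union> B) \<theta> u" using *(1) by (auto simp: all_alive_def)
    then show "alive k (Y \<union> B) \<theta> u" using sub by (rule alive_mono)
  qed
qed

lemma weight_insert_card:
  assumes "distinct (map fst L)"
  shows "weight (insert f B) L \<le> weight B L / \<zeta> ^ card {\<theta> \<in> set (map fst L). \<theta> \<subseteq> f}"
  using assms
proof (induction L)
  case (Cons x L)
  obtain \<theta> u k where x: "x = (\<theta>, u, k)" by (cases x)
  let ?c = "card {\<eta> \<in> set (map fst L). \<eta> \<subseteq> f}"
  have IH: "weight (insert f B) L \<le> weight B L / \<zeta> ^ ?c" using Cons by simp
  show ?case
  proof (cases "\<theta> \<subseteq> f")
    case False
    then have "{\<eta> \<in> set (map fst (x # L)). \<eta> \<subseteq> f} = {\<eta> \<in> set (map fst L). \<eta> \<subseteq> f}" using x by auto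
    moreover have "fresh_in (insert f B) \<theta> u = fresh_in B \<theta> u" using False by (auto simp: fresh_in_def)
    moreover have "(if fresh_in B \<theta> u then z k else 1) * weight (insert f B) L
        \<le> (if fresh_in B \<theta> u then z k else 1) * (weight B L / \<zeta> ^ ?c)"
      using IH zpos[of k] by (intro mult_left_mono) (auto simp: less_imp_le)
    moreover have "weight B' (x # L) = (if fresh_in B' \<theta> u then z k else 1) * weight B' L" for B'
      by (simp add: weight_def x)
    ultimately show ?thesis by simp
  next
    case True
    then have "{\<eta> \<in> set (map fst (x # L)). \<eta> \<subseteq> f} = insert \<theta> {\<eta> \<in> set (map fst L). \<eta> \<subseteq> f}" using x by auto
    moreover have "\<theta> \<notin> {\<eta> \<in> set (map fst L). \<eta> \<subseteq> f}" using Cons.prems x by auto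
    ultimately have c: "card {\<eta> \<in> set (map fst (x # L)). \<eta> \<subseteq> f} = Suc ?c" by simp
    have fr: "fresh_in (insert f B) \<theta> u \<Longrightarrow> fresh_in B \<theta> u" by (auto simp: fresh_in_def)
    have "(if fresh_in (insert f B) \<theta> u then z k else 1) \<le> (if fresh_in B \<theta> u then z k else 1) / \<zeta>"
    proof -
      have "1 \<le> z k / \<zeta>" "1 \<le> 1 / \<zeta>" "z k \<le> z k / \<zeta>"
        using \<zeta> zpos[of k] by (auto simp: field_simps mult_le_cancel_left1)
      then show ?thesis using fr by auto
    qed
    then have "(if fresh_in (insert f B) \<theta> u then z k else 1) * weight (insert f B) L
        \<le> ((if fresh_in B \<theta> u then z k else 1) / \<zeta>) * (weight B L / \<zeta> ^ ?c)"
      using IH \<zeta>(1) zpos[of k] weight_nonneg by (intro mult_mono) (auto simp: less_imp_le)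
    then show ?thesis unfolding c by (simp add: weight_def x)
  qed
qed (simp add: weight_def)

lemma weight_insert_le:
  assumes "distinct (map fst L)" "\<forall>x\<in>set L. fst x \<in> F" "card f = d + 1"
  shows "weight (insert f B) L \<le> weight B L / \<zeta> ^ (d + 1)"
proof -
  have "card {\<theta> \<in> set (map fst L). \<theta> \<subseteq> f} \<le> card ((\<lambda>e. f - {e}) ` f)"
  proof (rule card_mono)
    have ff: "finite f" using assms(3) by (metis card.infinite add_is_0 one_neq_zero)
    then show "finite ((\<lambda>e. f - {e}) ` f)" by simp
    show "{\<theta> \<in> set (map fst L). \<theta> \<subseteq> f} \<subseteq> (\<lambda>e. f - {e}) ` f"
    proof
      fix \<theta> assume t: "\<theta> \<in> {\<theta> \<in> set (map fst L). \<theta> \<subseteq> f}"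
      then have "card \<theta> = d" using assms(2) k_subsetsD by fastforce
      moreover have "finite \<theta>" using t ff finite_subset by blast
      ultimately have "card (f - \<theta>) = 1" using t assms(3) by (simp add: card_Diff_subset)
      then obtain e where "f - \<theta> = {e}" by (auto simp: card_1_singleton_iff)
      then show "\<theta> \<in> (\<lambda>e. f - {e}) ` f" using t by (intro image_eqI[of _ _ e]) auto
    qed
  qed
  also have "\<dots> \<le> d + 1" using card_image_le[of f "\<lambda>e. f - {e}"] assms(3)
    by (metis card.infinite le_trans card_image_le card_ge_0_finite zero_less_Suc Suc_eq_plus1)
  finally have "\<zeta> ^ (d + 1) \<le> \<zeta> ^ card {\<theta> \<in> set (map fst L). \<theta> \<subseteq> f}"
    using \<zeta> by (intro power_decreasing) auto
  then have "weight B L / \<zeta> ^ card {\<theta> \<in> set (map fst L). \<theta> \<subseteq> f} \<le> weight B L / \<zeta> ^ (d + 1)"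
    using \<zeta>(1) weight_nonneg by (intro divide_left_mono) auto
  then show ?thesis using weight_insert_card[OF assms(1), of f B] by linarith
qed

text \<open>The faces outside the star of \<open>\<theta>\<close> decide on many good vertices, and
  all the corresponding faces through \<open>\<theta>\<close> must then be absent. Goodness is
  measured outside the star alone; the star and \<open>B\<close> can only add to it.\<close>

lemma no_earlier_success:
  assumes \<theta>: "\<theta> \<in> F" and k: "k \<le> K" and U: "U \<subseteq> {1..n} - \<theta>"
  shows "bprob E p (\<lambda>X. \<forall>v\<in>U. \<not> (insert v \<theta> \<in> X \<and> good k (X \<union> B) \<theta> v))
    \<le> exp (- p * (y k ^ d * (real (card U) - real b))) + real n * err k"
proof -
  note t = k_subsetsD[OF \<theta>]
  define S where "S = E \<inter> star {\<theta>}"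
  define g where "g = y k ^ d * (real (card U) - real b)"
  have finU: "finite U" using U finite_subset by blast
  have finS: "finite S" using finE by (simp add: S_def)
  have sp: "spread d {\<theta>} 1"
    unfolding spread_def
  proof (intro allI impI)
    fix \<rho> :: "nat set" assume "card \<rho> + 1 = d \<and> finite \<rho>"
    have "{v. v \<notin> \<rho> \<and> insert v \<rho> \<in> {\<theta>}} \<subseteq> \<theta> - \<rho>" by auto
    moreover have "card {v. v \<notin> \<rho> \<and> insert v \<rho> \<in> {\<theta>}} \<le> 1"
    proof (cases "{v. v \<notin> \<rho> \<and> insert v \<rho> \<in> {\<theta>}} = {}")
      case False
      then obtain v where v: "v \<notin> \<rho>" "insert v \<rho> = \<theta>" by blast
      then have "{v. v \<notin> \<rho> \<and> insert v \<rho> \<in> {\<theta>}} \<subseteq> {v}" by auto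
      then show ?thesis using card_mono[of "{v}"] by fastforce
    qed (simp only: card.empty zero_le)
    ultimately show "card {v. v \<notin> \<rho> \<and> insert v \<rho> \<in> {\<theta>}} \<le> 1" by blast
  qed
  have us: "\<forall>v\<in>U. usable {\<theta>} \<theta> v" using U by (auto simp: usable_def)
  let ?P = "\<lambda>X. \<forall>v\<in>U. \<not> (insert v \<theta> \<in> X \<and> good k (X \<union> B) \<theta> v)"
  let ?bad = "\<lambda>X. real (card {v \<in> U. good k X \<theta> v}) < g"
  have "bprob E p ?P \<le> bexp (E - S) p (\<lambda>X0. of_bool (?bad X0) + exp (- p * g))"
  proof (rule bexp_le_if_section_le[OF finE])
    show "S \<subseteq> E" by (auto simp: S_def)
    fix X0 assume X0: "X0 \<subseteq> E - S"
    show "bprob S p (\<lambda>Y. ?P (X0 \<union> Y)) \<le> of_bool (?bad X0) + exp (- p * g)"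
    proof (cases "?bad X0")
      case True
      have "bprob S p (\<lambda>Y. ?P (X0 \<union> Y)) \<le> 1" using finS by (rule bprob_le_1)
      also have "\<dots> \<le> of_bool (?bad X0) + exp (- p * g)" using True by simp
      finally show ?thesis .
    next
      case False
      define D where "D = (\<lambda>v. insert v \<theta>) ` {v \<in> U. good k X0 \<theta> v}"
      have "inj_on (\<lambda>v. insert v \<theta>) {v \<in> U. good k X0 \<theta> v}"
      proof (rule inj_onI)
        fix v v' assume "v \<in> {v \<in> U. good k X0 \<theta> v}" "v' \<in> {v \<in> U. good k X0 \<theta> v}" "insert v \<theta> = insert v' \<theta>"
        then show "v = v'" using U by blast
      qed
      then have cD: "card D = card {v \<in> U. good k X0 \<theta> v}" unfolding D_def by (rule card_image)
      have DS: "D \<subseteq> S"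
      proof
        fix f assume "f \<in> D"
        then obtain v where v: "v \<in> U" "f = insert v \<theta>" unfolding D_def by blast
        then have "v \<in> {1..n}" "v \<notin> \<theta>" using U by auto
        then show "f \<in> S" using v t by (auto simp: S_def star_def k_subsets_def)
      qed
      have "bprob S p (\<lambda>Y. ?P (X0 \<union> Y)) \<le> bprob S p (\<lambda>Y. Y \<inter> D = {})"
      proof (rule bprob_mono)
        fix Y assume Y: "?P (X0 \<union> Y)"
        show "Y \<inter> D = {}"
        proof (rule ccontr)
          assume "Y \<inter> D \<noteq> {}"
          then obtain v where v: "v \<in> U" "good k X0 \<theta> v" "insert v \<theta> \<in> Y" unfolding D_def by blast
          have "good k (X0 \<union> Y \<union> B) \<theta> v" by (rule good_mono[OF v(2)]) blast
          then show False using Y v by blast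
        qed
      qed
      also have "\<dots> = (1 - p) ^ card D" using finS DS by (rule bprob_avoid)
      also have "\<dots> \<le> exp (- p) ^ card D"
        using p01 exp_ge_add_one_self[of "- p"] by (intro power_mono) auto
      also have "\<dots> = exp (- p * real (card D))"
        by (simp add: exp_of_nat_mult[symmetric] mult.commute)
      also have "\<dots> \<le> exp (- p * g)"
        using False p01 by (auto simp: cD not_less intro: mult_left_mono)
      finally show ?thesis using False by simp
    qed
  qed
  also have "\<dots> = bprob (E - S) p ?bad + exp (- p * g)"
    using finE by (subst bexp_add) (simp add: bexp_const)
  also have "bprob (E - S) p ?bad = bprob E p (\<lambda>X. ?bad (X - S))"
    using finE by (intro bexp_restrict[symmetric]) (auto simp: S_def)
  also have "\<dots> = bprob E p (\<lambda>X. ?bad (X - star {\<theta>}))"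
  proof (rule bexp_cong)
    fix X assume "X \<subseteq> E"
    then have "X - S = X - star {\<theta>}" by (auto simp: S_def)
    then show "of_bool (?bad (X - S)) = (of_bool (?bad (X - star {\<theta>})) :: real)" by simp
  qed
  also have "\<dots> \<le> real n * err k"
    unfolding g_def
  proof (rule many[OF \<theta> _ sp _ U us])
    have "k * (b + d) \<le> K * (b + d)" using k by (rule mult_le_mono1)
    then show "1 + k * (b + d) \<le> H" using KH by linarith
  qed (use \<theta> in auto)
  finally show ?thesis by (simp add: g_def)
qed

text \<open>The first target is expanded over its first successful child. Harris' inequality separates the
  success from the earlier failures, and only the latter need the lower bounds \<open>y\<close>.\<close>

lemma all_alive_bound:
  assumes "targets W L" "\<forall>f\<in>B. f \<subseteq> W" "W \<subseteq> {1..n}" "card W + size_of L \<le> h"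
  shows "bprob E p (all_alive B L) \<le> weight B L"
  using assms
proof (induction "size_of L" arbitrary: L B W rule: less_induct)
  case less
  show ?case
  proof (cases L)
    case Nil
    then show ?thesis using finE by (simp add: all_alive_def weight_def bexp_const)
  next
    case (Cons x L')
    obtain \<theta> u k' where x: "x = (\<theta>, u, k')" by (cases x)
    have tg: "targets W L'" "\<theta> \<in> F" "u \<notin> \<theta>" "k' \<le> K" "insert u \<theta> \<subseteq> W" "\<theta> \<notin> fst ` set L'"
      using less.prems(1) unfolding targets_def Cons x by auto
    note t = k_subsetsD[OF tg(2)]
    have finW: "finite W" using less.prems(3) finite_subset by blast
    have sz: "size_of L = (d + 1) ^ k' + size_of L'" by (simp add: size_of_def Cons x)
    have wt: "weight B L = (if fresh_in B \<theta> u then z k' else 1) * weight B L'"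
      by (simp add: weight_def Cons x)
    have rest: "bprob E p (all_alive B L') \<le> weight B L'"
      using sz tg(1) less.prems by (intro less.hyps[of L' W]) auto
    \<comment> \<open>Enough when the first factor is \<open>1\<close>: at level \<open>0\<close>,
      where \<open>z 0 = 1\<close>, and when some known face may support the target.\<close>
    have drop: "bprob E p (all_alive B L) \<le> weight B L'"
    proof -
      have "bprob E p (all_alive B L) \<le> bprob E p (all_alive B L')"
        by (rule bprob_mono) (simp add: all_alive_def Cons)
      then show ?thesis using rest by linarith
    qed
    show ?thesis
    proof (cases "fresh_in B \<theta> u \<and> k' \<noteq> 0")
      case False
      then show ?thesis using drop z0 unfolding wt by auto
    next
      case True
      then obtain k where k: "k' = Suc k" and fr: "fresh_in B \<theta> u" using not0_implies_Suc by blast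
      define f where "f v = insert v \<theta>" for v
      \<comment> \<open>A vertex outside \<open>W\<close> brings facets about which nothing is known
        yet, so its success can be weighed. The at most \<open>h\<close> vertices of
        \<open>W\<close> are paid for by \<open>p\<close> and a loss of freshness.\<close>
      define New where "New = {1..n} - W"
      define Old where "Old = (W - {u}) - \<theta>"
      define Inc where "Inc v X \<longleftrightarrow> f v \<in> X \<and> good k (X \<union> B) \<theta> v \<and> all_alive B L' X" for v X
      define Dec where "Dec v X \<longleftrightarrow> (\<forall>w\<in>{w \<in> New. w < v}. \<not> (f w \<in> X \<and> good k (X \<union> B) \<theta> w))" for v X
      have finN: "finite New" by (simp add: New_def)
      have N\<theta>: "v \<notin> \<theta>" "v \<in> {1..n}" "v \<notin> W" if "v \<in> New" for v using that tg(5) by (auto simp: New_def)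
      have fE: "f v \<in> E" if "v \<in> {1..n}" "v \<notin> \<theta>" for v
        using that t by (auto simp: f_def k_subsets_def)
      have kK: "k < K" using tg(4) k by simp
      have cases': "(\<exists>v\<in>Old. f v \<in> X \<and> all_alive B L' X) \<or> (\<exists>v\<in>New. Inc v X \<and> Dec v X)"
        if X: "X \<subseteq> E" "all_alive B L X" for X
      proof -
        have aL': "all_alive B L' X" and "alive (Suc k) (X \<union> B) \<theta> u"
          using X(2) by (auto simp: all_alive_def Cons x k simp del: alive.simps)
        then obtain v where v: "v \<notin> \<theta>" "v \<noteq> u" "f v \<in> X \<union> B" "good k (X \<union> B) \<theta> v"
          unfolding alive_Suc f_def by blast
        have "f v \<notin> B"
        proof
          assume "f v \<in> B"
          then have "f v = insert u \<theta>" using fr by (auto simp: fresh_in_def f_def)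
          then show False using v(1,2) by (auto simp: f_def)
        qed
        then have fX: "f v \<in> X" using v by blast
        show ?thesis
        proof (cases "v \<in> W")
          case True
          then have "v \<in> Old" using v by (auto simp: Old_def)
          then show ?thesis using fX aL' by blast
        next
          case False
          have "f v \<in> E" using X fX by blast
          then have "v \<in> {1..n}" unfolding k_subsets_def f_def by blast
          define Suc' where "Suc' = {w \<in> New. f w \<in> X \<and> good k (X \<union> B) \<theta> w}"
          have vS: "v \<in> Suc'" using False \<open>v \<in> {1..n}\<close> fX v by (auto simp: Suc'_def New_def)
          have finS: "finite Suc'" using finN by (simp add: Suc'_def)
          have mS: "Min Suc' \<in> Suc'" using vS finS by (intro Min_in) auto
          have "Dec (Min Suc') X"
            unfolding Dec_def
          proof
            fix w assume w: "w \<in> {w \<in> New. w < Min Suc'}"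
            then have "w \<notin> Suc'" using finS by (metis Min_le mem_Collect_eq not_less)
            then show "\<not> (f w \<in> X \<and> good k (X \<union> B) \<theta> w)" using w by (auto simp: Suc'_def)
          qed
          then show ?thesis using mS aL' by (auto simp: Suc'_def Inc_def)
        qed
      qed
      \<comment> \<open>Planting \<open>f v\<close> can end the freshness only of targets that are
        facets of \<open>f v\<close>, and there are at most \<open>d + 1\<close> of these.\<close>
      have old: "bprob E p (\<lambda>X. f v \<in> X \<and> all_alive B L' X) \<le> p * (weight B L' / \<zeta> ^ (d + 1))"
        if v: "v \<in> Old" for v
      proof -
        have vE: "f v \<in> E" using v less.prems(3) by (intro fE) (auto simp: Old_def)
        have "bprob E p (\<lambda>X. f v \<in> X \<and> all_alive B L' X)
            = p * bprob E p (\<lambda>X. all_alive B L' (insert (f v) X))"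
          using bexp_mem[OF finE vE, of p "\<lambda>X. of_bool (all_alive B L' X)"] by (simp add: of_bool_conj)
        also have "(\<lambda>X. all_alive B L' (insert (f v) X)) = all_alive (insert (f v) B) L'"
          by (rule ext) (simp add: all_alive_def)
        also have "bprob E p (all_alive (insert (f v) B) L') \<le> weight (insert (f v) B) L'"
        proof (rule less.hyps[of L' W])
          show "\<forall>g\<in>insert (f v) B. g \<subseteq> W"
            using less.prems(2) v tg(5) by (auto simp: f_def Old_def)
        qed (use sz tg(1) less.prems in auto)
        also have "weight (insert (f v) B) L' \<le> weight B L' / \<zeta> ^ (d + 1)"
          using tg(1) vE k_subsetsD(1) by (intro weight_insert_le) (auto simp: targets_def)
        finally show ?thesis using p01 by (simp add: mult_left_mono)
      qed
      \<comment> \<open>After planting \<open>f v\<close>, success means that \<open>d\<close>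
        further targets of level \<open>k\<close> are alive, one for each partner. They join
        \<open>L'\<close>, and the induction hypothesis applies to this list of smaller
        size.\<close>
      have inc: "bprob E p (Inc v) \<le> p * (z k ^ d * weight B L')" if v: "v \<in> New" for v
      proof -
        define N where "N = map (\<lambda>w. (f v - {w}, w, k)) (sorted_list_of_set \<theta>)"
        define B' where "B' = insert (f v) B"
        have setN: "set N = (\<lambda>w. (f v - {w}, w, k)) ` \<theta>" using t by (simp add: N_def)
        have vE: "f v \<in> E" using N\<theta>[OF v] by (intro fE) auto
        have "bprob E p (Inc v) = bprob E p (\<lambda>X. f v \<in> X \<and> (good k (X \<union> B) \<theta> v \<and> all_alive B L' X))"
          by (simp add: Inc_def)
        also have "\<dots> = p * bprob E p (\<lambda>X. good k (insert (f v) X \<union> B) \<theta> v \<and> all_alive B L' (insert (f v) X))"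
          using bexp_mem[OF finE vE, of p "\<lambda>X. of_bool (good k (X \<union> B) \<theta> v \<and> all_alive B L' X)"]
          by (simp add: of_bool_conj)
        also have "(\<lambda>X. good k (insert (f v) X \<union> B) \<theta> v \<and> all_alive B L' (insert (f v) X)) = all_alive B' (N @ L')"
        proof
          fix X
          have "insert (f v) X \<union> B = X \<union> B'" by (auto simp: B'_def)
          then show "(good k (insert (f v) X \<union> B) \<theta> v \<and> all_alive B L' (insert (f v) X)) = all_alive B' (N @ L') X"
            unfolding all_alive_def set_append setN good_def f_def by (simp add: ball_Un)
        qed
        also have "bprob E p (all_alive B' (N @ L')) \<le> weight B' (N @ L')"
        proof (rule less.hyps[of "N @ L'" "insert v W"])
          have szN: "size_of N = d * (d + 1) ^ k"
            using t by (simp add: size_of_def N_def o_def sum_list_triv)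
          have szNL: "size_of (N @ L') = d * (d + 1) ^ k + size_of L'"
            using szN by (simp add: size_of_def)
          have szL: "size_of L = d * (d + 1) ^ k + (d + 1) ^ k + size_of L'" by (simp add: sz k)
          have pw: "(d + 1) ^ k \<ge> 1" by simp
          show "size_of (N @ L') < size_of L" using szNL szL pw by linarith
          show "card (insert v W) + size_of (N @ L') \<le> h"
          proof -
            have "card (insert v W) = Suc (card W)" using finW N\<theta>[OF v] by simp
            then show ?thesis using szNL szL pw less.prems(4) by linarith
          qed
          show "insert v W \<subseteq> {1..n}" using less.prems(3) N\<theta>[OF v] by auto
          show "\<forall>g\<in>B'. g \<subseteq> insert v W" using less.prems(2) tg(5) by (auto simp: B'_def f_def)
          have inj: "inj_on (\<lambda>w. f v - {w}) \<theta>" by (rule inj_onI) (auto simp: f_def)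
          have fw: "f v - {w} \<in> F" "insert w (f v - {w}) = f v" if "w \<in> \<theta>" for w
          proof -
            have "f v - {w} = insert v (\<theta> - {w})" using that N\<theta>[OF v] by (auto simp: f_def)
            then show "f v - {w} \<in> F" using exchange_in_k_subsets[OF tg(2) that] N\<theta>[OF v] by simp
            show "insert w (f v - {w}) = f v" using that by (auto simp: f_def)
          qed
          have vw: "v \<in> f v - {w}" if "w \<in> \<theta>" for w using that N\<theta>[OF v] by (auto simp: f_def)
          have noL: "v \<notin> \<eta>" if "\<eta> \<in> fst ` set L'" for \<eta>
            using that tg(1) N\<theta>[OF v] unfolding targets_def by fastforce
          have "distinct (map fst N)" using inj t by (simp add: N_def o_def distinct_map)
          moreover have "set (map fst N) \<inter> set (map fst L') = {}"
          proof (rule equals0I)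
            fix \<eta> assume "\<eta> \<in> set (map fst N) \<inter> set (map fst L')"
            then have "\<eta> \<in> (\<lambda>w. f v - {w}) ` \<theta>" "\<eta> \<in> fst ` set L'" by (auto simp: setN)
            then show False using vw noL by blast
          qed
          ultimately have dist: "distinct (map fst (N @ L'))" using tg(1) by (simp add: targets_def)
          show "targets (insert v W) (N @ L')"
            unfolding targets_def
          proof (intro conjI dist ballI)
            fix x assume "x \<in> set (N @ L')"
            then consider w where "w \<in> \<theta>" "x = (f v - {w}, w, k)" | "x \<in> set L'" by (auto simp: setN)
            then show "case x of (\<theta>, u, k) \<Rightarrow> \<theta> \<in> F \<and> u \<notin> \<theta> \<and> k \<le> K \<and> insert u \<theta> \<subseteq> insert v W"
            proof cases
              case (1 w)
              then show ?thesis using fw[OF 1(1)] kK tg(5) by (auto simp: f_def)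
            next
              case 2
              then show ?thesis using tg(1) unfolding targets_def by fast
            qed
          qed
        qed
        also have "weight B' (N @ L') = weight B' N * weight B' L'" by (simp add: weight_def)
        also have "weight B' N = z k ^ d"
        proof -
          \<comment> \<open>Every known face except \<open>f v\<close> lies in \<open>W\<close> and
            misses \<open>v\<close>, so none can support a partner facet, which contains
            \<open>v\<close>.\<close>
          have "fresh_in B' (f v - {w}) w" if "w \<in> \<theta>" for w
            unfolding fresh_in_def
          proof (intro ballI impI)
            fix g assume g: "g \<in> B'" "f v - {w} \<subseteq> g"
            have "v \<in> g" using g(2) that N\<theta>[OF v] by (auto simp: f_def)
            then have "g = f v" using g(1) less.prems(2) N\<theta>[OF v] by (auto simp: B'_def)
            then show "g = insert w (f v - {w})" using that by (auto simp: f_def)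
          qed
          then have "weight B' N = prod_list (map (\<lambda>w. z k) (sorted_list_of_set \<theta>))"
            unfolding weight_def N_def map_map o_def
            by (intro arg_cong[where f = prod_list] map_cong) (use t in auto)
          then show ?thesis using t by (simp add: map_replicate_const prod_list_replicate)
        qed
        also have "weight B' L' = weight B L'"
        proof -
          \<comment> \<open>Inside \<open>W\<close> the only facet of \<open>f v\<close> is
            \<open>\<theta>\<close>, and the remaining targets avoid it.\<close>
          have "fresh_in B' \<eta> w = fresh_in B \<eta> w" if "(\<eta>, w, l) \<in> set L'" for \<eta> w l
          proof -
            have e: "\<eta> \<in> F" "\<eta> \<subseteq> W" using tg(1) that unfolding targets_def by auto
            have "\<not> \<eta> \<subseteq> f v"
            proof
              assume "\<eta> \<subseteq> f v"
              then have "\<eta> \<subseteq> \<theta>" using e N\<theta>[OF v] by (auto simp: f_def)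
              then have "\<eta> = \<theta>" using k_subsetsD(1)[OF e(1)] t by (metis card_subset_eq)
              then show False using tg(6) that by force
            qed
            then show ?thesis by (auto simp: fresh_in_def B'_def)
          qed
          then show ?thesis unfolding weight_def by (intro arg_cong[where f = prod_list] map_cong) auto
        qed
        finally show ?thesis using p01 by (simp add: mult_left_mono)
      qed
      have dec: "bprob E p (Dec v) \<le> exp (- p * (y k ^ d * (real (card {w \<in> New. w < v}) - real b))) + real n * err k"
        for v
        unfolding Dec_def f_def using N\<theta> kK by (intro no_earlier_success tg(2)) auto
      have new: "bprob E p (\<lambda>X. Inc v X \<and> Dec v X) \<le> p * (z k ^ d * weight B L') *
          (exp (- p * (y k ^ d * (real (card {w \<in> New. w < v}) - real b))) + real n * err k)"
        if "v \<in> New" for v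
      proof -
        have "bprob E p (\<lambda>X. Inc v X \<and> Dec v X) \<le> bprob E p (Inc v) * bprob E p (Dec v)"
        proof (rule bprob_harris[OF finE])
          show "Inc v Y" if "X \<subseteq> Y" "Inc v X" for X Y
          proof -
            have "X \<union> B \<subseteq> Y \<union> B" using that by blast
            then show ?thesis using that good_mono[of k "X \<union> B" \<theta> v "Y \<union> B"] all_alive_mono
              unfolding Inc_def by blast
          qed
          show "Dec v X" if "X \<subseteq> Y" "Dec v Y" for X Y
          proof -
            have "X \<union> B \<subseteq> Y \<union> B" using that by blast
            then show ?thesis using that good_mono[of k "X \<union> B" \<theta> _ "Y \<union> B"]
              unfolding Dec_def by blast
          qed
        qed
        also have "\<dots> \<le> p * (z k ^ d * weight B L') *
          (exp (- p * (y k ^ d * (real (card {w \<in> New. w < v}) - real b))) + real n * err k)"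
          using inc[OF that] dec[of v] p01 zpos[of k] weight_nonneg
          by (intro mult_mono bexp_nonneg) (auto simp: less_imp_le)
        finally show ?thesis .
      qed
      define a where "a = p * y k ^ d"
      have a: "0 < a" "a \<le> p" using ppos ypos[of k] y01(2)[of k]
        by (auto simp: a_def mult_left_le power_le_one less_imp_le)
      \<comment> \<open>The candidate of rank \<open>i\<close> is reached with probability at most
        about \<open>exp (- a * i)\<close>. The sum is close to
        \<open>(1 - exp (- (p * n) * y k ^ d)) / a\<close>, and the factor \<open>p\<close> for the
        presence of the successful face cancels the one in \<open>a\<close>.\<close>
      have sums: "(\<Sum>v\<in>New. exp (- p * (y k ^ d * (real (card {w \<in> New. w < v}) - real b))) + real n * err k)
          \<le> exp (p * (real b + 1)) * (1 - exp (- (p * n) * y k ^ d)) / a + real n ^ 2 * err k"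
      proof -
        have "(\<Sum>v\<in>New. exp (- p * (y k ^ d * (real (card {w \<in> New. w < v}) - real b))))
            = (\<Sum>v\<in>New. exp (a * b) * exp (- a * real (card {w \<in> New. w < v})))"
          by (intro sum.cong refl) (simp add: a_def exp_add[symmetric] algebra_simps)
        also have "\<dots> = exp (a * b) * (\<Sum>i<card New. exp (- a * real i))"
          unfolding sum_distrib_left[symmetric] sum_rank[OF finN, of "\<lambda>i. exp (- a * real i)"] ..
        also have "\<dots> \<le> exp (a * b) * (\<Sum>i<n. exp (- a * real i))"
        proof (intro mult_left_mono sum_mono2)
          have "card New \<le> card {1..n}" by (intro card_mono) (auto simp: New_def)
          then show "{..<card New} \<subseteq> {..<n}" by auto
        qed auto
        also have "\<dots> \<le> exp (a * b) * (exp a * (1 - exp (- a * real n)) / a)"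
          using geometric_le[OF a(1), of n] by (intro mult_left_mono) auto
        also have "\<dots> = exp (a * (real b + 1)) * ((1 - exp (- a * real n)) / a)"
          by (simp add: exp_add[symmetric] algebra_simps)
        also have "\<dots> \<le> exp (p * (real b + 1)) * ((1 - exp (- a * real n)) / a)"
          using a by (intro mult_right_mono) (auto intro!: mult_right_mono divide_nonneg_pos)
        also have "- a * real n = - (p * n) * y k ^ d" by (simp add: a_def)
        finally have 1: "(\<Sum>v\<in>New. exp (- p * (y k ^ d * (real (card {w \<in> New. w < v}) - real b))))
            \<le> exp (p * (real b + 1)) * (1 - exp (- (p * n) * y k ^ d)) / a" by simp
        have "card New \<le> card {1..n}" by (intro card_mono) (auto simp: New_def)
        then have "real (card New) * (real n * err k) \<le> real n * (real n * err k)"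
          using err_nonneg by (intro mult_right_mono) auto
        then show ?thesis using 1 by (simp add: sum.distrib power2_eq_square mult.assoc)
      qed
      have "bprob E p (all_alive B L)
          \<le> bprob E p (\<lambda>X. \<exists>v\<in>Old. f v \<in> X \<and> all_alive B L' X) + bprob E p (\<lambda>X. \<exists>v\<in>New. Inc v X \<and> Dec v X)"
        using cases' by (rule bprob_disj)
      also have "\<dots> \<le> (\<Sum>v\<in>Old. bprob E p (\<lambda>X. f v \<in> X \<and> all_alive B L' X)) + (\<Sum>v\<in>New. bprob E p (\<lambda>X. Inc v X \<and> Dec v X))"
        using finW finN by (intro add_mono bprob_union_bound) (auto simp: Old_def)
      also have "\<dots> \<le> (\<Sum>v\<in>Old. p * (weight B L' / \<zeta> ^ (d + 1)))
          + (\<Sum>v\<in>New. p * (z k ^ d * weight B L') *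
          (exp (- p * (y k ^ d * (real (card {w \<in> New. w < v}) - real b))) + real n * err k))"
        using old new by (intro add_mono sum_mono)
      also have "\<dots> \<le> h * (p * (weight B L' / \<zeta> ^ (d + 1))) + p * (z k ^ d * weight B L') *
          (exp (p * (real b + 1)) * (1 - exp (- (p * n) * y k ^ d)) / a + real n ^ 2 * err k)"
      proof (intro add_mono)
        have "card Old \<le> card W" unfolding Old_def by (intro card_mono finW) auto
        then have "card Old \<le> h" using less.prems(4) by linarith
        then show "(\<Sum>v\<in>Old. p * (weight B L' / \<zeta> ^ (d + 1))) \<le> h * (p * (weight B L' / \<zeta> ^ (d + 1)))"
          unfolding sum_constant using p01 weight_nonneg[of B L'] \<zeta>(1) by (intro mult_right_mono) auto
        show "(\<Sum>v\<in>New. p * (z k ^ d * weight B L') *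
          (exp (- p * (y k ^ d * (real (card {w \<in> New. w < v}) - real b))) + real n * err k))
          \<le> p * (z k ^ d * weight B L') *
          (exp (p * (real b + 1)) * (1 - exp (- (p * n) * y k ^ d)) / a + real n ^ 2 * err k)"
          unfolding sum_distrib_left[symmetric]
          using sums p01 zpos[of k] weight_nonneg by (intro mult_left_mono) (auto simp: less_imp_le)
      qed
      also have "\<dots> = (z k ^ d * (exp (p * (real b + 1)) * (1 - exp (- (p * n) * y k ^ d)) / y k ^ d + p * real n ^ 2 * err k)
          + h * p / \<zeta> ^ (d + 1)) * weight B L'"
      proof -
        have "s * (p * (w / t)) + p * (Z * w) * (N / (p * q) + R) = (Z * (N / q + p * R) + s * p / t) * w"
          if "q \<noteq> 0" "t \<noteq> 0" for s w t Z N q R :: real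
          using ppos that by (simp add: field_simps)
        moreover have "y k ^ d \<noteq> 0" "\<zeta> ^ (d + 1) \<noteq> 0" using ypos[of k] \<zeta> by auto
        ultimately show ?thesis unfolding a_def mult.assoc[of p "real n ^ 2"] by blast
      qed
      also have "\<dots> \<le> z (Suc k) * weight B L'"
        using zstep[OF kK] weight_nonneg by (intro mult_right_mono)
      finally show ?thesis using fr by (simp add: wt k)
    qed
  qed
qed

end

section \<open>Counting chains\<close>

text \<open>The deterministic part of \<open>chain\<close>, over which the union bound runs; the
  random events are carried by \<open>exits\<close> and \<open>sides\<close>.\<close>

fun admissible :: "nat \<Rightarrow> nat \<Rightarrow> nat set list \<Rightarrow> bool" where
  "admissible d n [] \<longleftrightarrow> False"
| "admissible d n [f] \<longleftrightarrow> f \<in> k_subsets n (d + 1)"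
| "admissible d n (f' # f # fs) \<longleftrightarrow>
     admissible d n (f # fs) \<and> f' \<in> k_subsets n (d + 1) \<and> f' \<in> ext d (f # fs)"

fun exits :: "nat set list \<Rightarrow> nat set set" where
  "exits (f' # f # fs) = (if fresh (f # fs) then {f \<inter> f'} else {}) \<union> exits (f # fs)"
| "exits _ = {}"

text \<open>Facets are named by the opposite vertex. Those within the older vertices are left out
  because older faces may support them, and the exit because \<open>f'\<close> does.\<close>

definition side_vertices :: "nat set \<Rightarrow> nat set list \<Rightarrow> nat set \<Rightarrow> nat set" where
  "side_vertices f fs f' = {w \<in> f. f - {w} \<noteq> f \<inter> f' \<and> \<not> f - {w} \<subseteq> \<Union> (set fs)}"

fun sides :: "nat \<Rightarrow> nat set list \<Rightarrow> (nat set \<times> nat \<times> nat) list" where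
  "sides K (f' # f # fs) =
     (if fresh (f # fs) then map (\<lambda>w. (f - {w}, w, K)) (sorted_list_of_set (side_vertices f fs f')) else [])
     @ sides K (f # fs)"
| "sides K _ = []"

lemma admissible_faces: "admissible d n fs \<Longrightarrow> f \<in> set fs \<Longrightarrow> f \<in> k_subsets n (d + 1)"
  by (induction d n fs rule: admissible.induct) auto

lemma admissible_distinct: "admissible d n fs \<Longrightarrow> distinct fs"
  by (induction d n fs rule: admissible.induct) (auto simp: ext_def)

lemma chain_admissible:
  "chain d K J Y fs \<Longrightarrow> Y \<subseteq> k_subsets n (d + 1) \<Longrightarrow> admissible d n fs \<and> set fs \<subseteq> Y"
  by (induction d K J Y fs rule: chain.induct) auto

lemma Union_admissible:
  assumes "admissible d n fs"
  shows "\<Union> (set fs) \<subseteq> {1..n}" "finite (\<Union> (set fs))" "card (\<Union> (set fs)) \<le> (d + 1) * length fs"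
proof -
  show 1: "\<Union> (set fs) \<subseteq> {1..n}"
    using admissible_faces[OF assms] by (auto simp: k_subsets_def)
  then show "finite (\<Union> (set fs))" using finite_subset by blast
  have "card (\<Union> (set fs)) \<le> (\<Sum>f\<in>set fs. card f)"
    by (rule card_Union_le_sum_card)
  also have "\<dots> = (\<Sum>f\<in>set fs. d + 1)"
    using admissible_faces[OF assms] k_subsetsD(1) by (intro sum.cong) auto
  also have "\<dots> \<le> (d + 1) * length fs"
    using card_length[of fs] by (simp add: mult.commute del: mult_Suc mult_Suc_right)
  finally show "card (\<Union> (set fs)) \<le> (d + 1) * length fs" .
qed

lemma face_inter:
  assumes "f' \<in> k_subsets n (d + 1)" "card (g \<inter> f') = d"
  obtains v where "f' = insert v (g \<inter> f')" "v \<notin> g" "v \<in> {1..n}"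
proof -
  note f' = k_subsetsD[OF assms(1)]
  have "card (f' - g \<inter> f') = 1" using f' assms(2) by (subst card_Diff_subset) auto
  then obtain v where "f' - g \<inter> f' = {v}" by (auto simp: card_1_singleton_iff)
  then show thesis using f' by (intro that[of v]) auto
qed

lemma ext_attach:
  assumes "f' \<in> ext d fs" "fs \<noteq> []"
  obtains g where "g \<in> set fs" "card (g \<inter> f') = d"
    "fresh fs \<Longrightarrow> g = hd fs \<and> \<not> g \<inter> f' \<subseteq> \<Union> (set (tl fs))"
proof (cases "fresh fs")
  case True
  then show thesis using assms by (intro that[of "hd fs"]) (auto simp: ext_def)
next
  case False
  then show thesis using assms that by (auto simp: ext_def)
qed

text \<open>A face is attached along \<open>d\<close> vertices of an older face, so it has at most
  one new vertex; being fresh, it has exactly one.\<close>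

lemma fresh_face:
  assumes "admissible d n (f # fs)" "fresh (f # fs)"
  obtains v where "f = insert v (f \<inter> \<Union> (set fs))" "v \<notin> \<Union> (set fs)" "card (f \<inter> \<Union> (set fs)) = d"
proof -
  obtain g gs where fs: "fs = g # gs" using assms(2) by (cases fs) auto
  then have e: "f \<in> k_subsets n (d + 1)" "f \<in> ext d fs" using assms(1) by auto
  note f = k_subsetsD[OF e(1)]
  obtain h where h: "h \<in> set fs" "card (h \<inter> f) = d" using ext_attach[OF e(2)] fs by blast
  obtain v where v: "f = insert v (h \<inter> f)" "v \<notin> h" using face_inter[OF e(1) h(2)] by metis
  have "v \<notin> \<Union> (set fs)"
  proof
    assume "v \<in> \<Union> (set fs)"
    then have "insert v (h \<inter> f) \<subseteq> \<Union> (set fs)" using h(1) by blast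
    then have "f \<subseteq> \<Union> (set fs)" using v(1) by metis
    then show False using assms(2) by simp
  qed
  moreover have "f \<inter> \<Union> (set fs) = h \<inter> f"
  proof -
    have "insert v (h \<inter> f) \<inter> \<Union> (set fs) = h \<inter> f" using h(1) calculation by blast
    then show ?thesis using v(1) by metis
  qed
  ultimately show thesis using v(1) h(2) by (intro that[of v]) simp_all
qed

text \<open>Of the \<open>d + 1\<close> facets one is opposite the new vertex and hence old, and at
  most one is the exit. This is the origin of the exponent \<open>d - 1\<close>.\<close>

lemma side_vertices:
  assumes "admissible d n (f # fs)" "fresh (f # fs)"
  shows "finite (side_vertices f fs f')" "d - 1 \<le> card (side_vertices f fs f')"
proof -
  note f = k_subsetsD[OF admissible_faces[OF assms(1), of f, simplified]]
  show fin: "finite (side_vertices f fs f')" using f by (simp add: side_vertices_def)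
  obtain v where v: "f = insert v (f \<inter> \<Union> (set fs))" "v \<notin> \<Union> (set fs)" "card (f \<inter> \<Union> (set fs)) = d"
    using fresh_face[OF assms] by metis
  define T where "T = f \<inter> \<Union> (set fs)"
  have sub: "T - {w \<in> f. f - {w} = f \<inter> f'} \<subseteq> side_vertices f fs f'"
  proof
    fix w assume w: "w \<in> T - {w \<in> f. f - {w} = f \<inter> f'}"
    then have "v \<in> f - {w}" using v T_def by blast
    then show "w \<in> side_vertices f fs f'" using w v(2) by (auto simp: side_vertices_def T_def)
  qed
  have "card {w \<in> f. f - {w} = f \<inter> f'} \<le> 1"
  proof (cases "{w \<in> f. f - {w} = f \<inter> f'} = {}")
    case True
    then show ?thesis by (simp only: card.empty)
  next
    case False
    then obtain w where "w \<in> f" "f - {w} = f \<inter> f'" by blast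
    then have "{w \<in> f. f - {w} = f \<inter> f'} \<subseteq> {w}" by blast
    then show ?thesis using card_mono[of "{w}"] by fastforce
  qed
  then have "d - 1 \<le> card T - card {w \<in> f. f - {w} = f \<inter> f'}" using v(3) T_def by simp
  also have "\<dots> \<le> card (T - {w \<in> f. f - {w} = f \<inter> f'})"
    using f by (intro diff_card_le_card_Diff) auto
  also have "\<dots> \<le> card (side_vertices f fs f')" using sub fin by (rule card_mono[rotated])
  finally show "d - 1 \<le> card (side_vertices f fs f')" .
qed

text \<open>Sides recorded at \<open>f\<close> contain the new vertex of \<open>f\<close>, while
  earlier ones lie within older faces, so no facet is recorded twice.\<close>

lemma sides_props_aux:
  assumes "admissible d n fs"
  shows "(\<forall>(\<theta>, u, k)\<in>set (sides K fs). \<theta> \<in> k_subsets n d \<and> u \<notin> \<theta> \<and> k = K \<and>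
      insert u \<theta> \<subseteq> \<Union> (set (tl fs)) \<and> insert u \<theta> \<in> set fs) \<and>
    distinct (map fst (sides K fs)) \<and> length (sides K fs) \<le> (d + 1) * length fs"
  using assms
proof (induction K fs rule: sides.induct)
  case (1 K f' f fs)
  have adm: "admissible d n (f # fs)" and fE: "f \<in> k_subsets n (d + 1)"
    using "1.prems" admissible_faces[of d n "f # fs" f] by auto
  note f = k_subsetsD[OF fE]
  have IH: "\<forall>(\<theta>, u, k)\<in>set (sides K (f # fs)). \<theta> \<in> k_subsets n d \<and> u \<notin> \<theta> \<and> k = K \<and> insert u \<theta> \<subseteq> \<Union> (set fs) \<and> insert u \<theta> \<in> set (f # fs)"
    "distinct (map fst (sides K (f # fs)))" and IHl: "length (sides K (f # fs)) \<le> (d + 1) * length (f # fs)"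
    using "1.IH" adm by auto
  define S where "S = side_vertices f fs f'"
  have finS: "finite S" using f by (simp add: S_def side_vertices_def)
  have S: "w \<in> f" "\<not> f - {w} \<subseteq> \<Union> (set fs)" if "w \<in> S" for w
    using that by (auto simp: S_def side_vertices_def)
  have new: "f - {w} \<in> k_subsets n d" "insert w (f - {w}) = f" if "w \<in> S" for w
    using S(1)[OF that] f by (auto simp: k_subsets_def)
  have cS: "card S \<le> d + 1" using f card_mono[OF f(3), of S] S(1) by auto
  have inj: "inj_on (\<lambda>w. f - {w}) S" by (rule inj_onI) (use S(1) in blast)
  have 1: "\<forall>(\<theta>, u, k)\<in>set (sides K (f' # f # fs)). \<theta> \<in> k_subsets n d \<and> u \<notin> \<theta> \<and> k = K
      \<and> insert u \<theta> \<subseteq> \<Union> (set (tl (f' # f # fs))) \<and> insert u \<theta> \<in> set (f' # f # fs)"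
  proof (rule ballI)
    fix x assume "x \<in> set (sides K (f' # f # fs))"
    then consider w where "w \<in> S" "x = (f - {w}, w, K)" | "x \<in> set (sides K (f # fs))"
      using finS by (auto simp: S_def simp del: fresh.simps split: if_splits)
    then show "case x of (\<theta>, u, k) \<Rightarrow> \<theta> \<in> k_subsets n d \<and> u \<notin> \<theta> \<and> k = K
      \<and> insert u \<theta> \<subseteq> \<Union> (set (tl (f' # f # fs))) \<and> insert u \<theta> \<in> set (f' # f # fs)"
    proof cases
      case (1 w)
      then show ?thesis using new[OF 1(1)] by auto
    next
      case 2
      then show ?thesis using IH(1) by fastforce
    qed
  qed
  have 2: "distinct (map fst (sides K (f' # f # fs)))"
  proof (cases "fresh (f # fs)")
    case True
    have "set (map fst (map (\<lambda>w. (f - {w}, w, K)) (sorted_list_of_set S))) \<inter> set (map fst (sides K (f # fs))) = {}"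
    proof (rule equals0I)
      fix \<theta> assume t: "\<theta> \<in> set (map fst (map (\<lambda>w. (f - {w}, w, K)) (sorted_list_of_set S))) \<inter> set (map fst (sides K (f # fs)))"
      then obtain w where "w \<in> S" "\<theta> = f - {w}" using finS by auto
      moreover have "\<theta> \<subseteq> \<Union> (set fs)"
      proof -
        have "\<theta> \<in> fst ` set (sides K (f # fs))" using IntD2[OF t] unfolding set_map .
        then obtain x where x: "x \<in> set (sides K (f # fs))" "\<theta> = fst x" by (rule imageE)
        show ?thesis using bspec[OF IH(1) x(1)] unfolding x(2) by (simp add: case_prod_beta)
      qed
      ultimately show False using S(2) by blast
    qed
    then show ?thesis using True inj finS IH(2) by (simp add: S_def[symmetric] o_def distinct_map del: fresh.simps)
  qed (use IH in \<open>simp del: fresh.simps\<close>)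
  have "length (sides K (f' # f # fs)) \<le> (d + 1) * length (f' # f # fs)"
    using IHl cS finS by (simp add: S_def[symmetric] del: fresh.simps)
  then show ?case using 1 2 by blast
qed auto

lemmas sides_props = sides_props_aux[THEN conjunct1] sides_props_aux[THEN conjunct2, THEN conjunct1]
  sides_props_aux[THEN conjunct2, THEN conjunct2]

lemma exits_props:
  assumes "admissible d n fs"
  shows "(\<forall>\<theta>\<in>exits fs. \<theta> \<in> k_subsets n d \<and> \<theta> \<subseteq> \<Union> (set (tl fs))) \<and>
    finite (exits fs) \<and> card (exits fs) \<le> length fs"
  using assms
proof (induction fs rule: exits.induct)
  case (1 f' f fs)
  have adm: "admissible d n (f # fs)" and e: "f' \<in> ext d (f # fs)" and fE: "f \<in> k_subsets n (d + 1)"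
    using "1.prems" admissible_faces[of d n "f # fs" f] by auto
  note f = k_subsetsD[OF fE]
  have IH: "\<forall>\<theta>\<in>exits (f # fs). \<theta> \<in> k_subsets n d \<and> \<theta> \<subseteq> \<Union> (set fs)" "finite (exits (f # fs))"
    "card (exits (f # fs)) \<le> length (f # fs)"
    using "1.IH" adm by auto
  have ex: "f \<inter> f' \<in> k_subsets n d" if "fresh (f # fs)"
    using e that f by (auto simp: ext_def k_subsets_def)
  have "\<forall>\<theta>\<in>exits (f' # f # fs). \<theta> \<in> k_subsets n d \<and> \<theta> \<subseteq> \<Union> (set (tl (f' # f # fs)))"
    using IH(1) ex by (auto simp del: fresh.simps split: if_splits)
  moreover have "finite (exits (f' # f # fs))" using IH(2) by simp
  moreover have "card (exits (f' # f # fs)) \<le> length (f' # f # fs)"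
    using IH(2,3) by (auto simp: card_insert_if simp del: fresh.simps)
  ultimately show ?case by blast
qed auto

lemma exit_new:
  assumes "admissible d n (f' # f # fs)" "fresh (f # fs)"
  shows "f \<inter> f' \<notin> exits (f # fs)"
proof -
  have "admissible d n (f # fs)" "\<not> f \<inter> f' \<subseteq> \<Union> (set fs)"
    using assms by (auto simp: ext_def)
  then show ?thesis using exits_props[of d n "f # fs"] by auto
qed

text \<open>\<open>step_fresh\<close> and \<open>step_old\<close> are the weighted row sums of a
  two-state transfer operator: with weight \<open>1\<close> on fresh and \<open>\<Omega>\<close> on
  other lists, one step contracts by \<open>lam\<close>. \<open>tiny\<close> pushes the
  concentration error below the smallest possible product of exit factors.\<close>

locale chain_run = upper_run p d n b H y c1 \<gamma> K h z \<zeta>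
  for p :: real and d n b H :: nat and y :: "nat \<Rightarrow> real" and c1 \<gamma> :: real and K h :: nat
    and z :: "nat \<Rightarrow> real" and \<zeta> :: real +
  fixes J m :: nat and \<Omega> lam :: real
  assumes zK: "z K \<le> 1" and J: "K + (d + 1) * m \<le> J" and JH: "(m + 1) + (J + 1) * (b + d) \<le> H"
    and small: "(d + 1) * (m + 1) \<le> b" "(d + 1) * (m + 1) * (1 + (d + 1) ^ K) \<le> h"
    and tiny: "real (m + 1) * real n * err J \<le> exp (- c1 * (m + 1))"
    and \<Omega>: "1 \<le> \<Omega>" and lam: "0 \<le> lam"
    and step_fresh: "z K ^ (d - 1) * exp (- c1 * y J ^ d) * p * (d * real n + d * (d + 1) * (m + 1) * \<Omega>) \<le> lam"
    and step_old: "p / \<zeta> ^ (d + 2) * ((d + 1) * (m + 1) * (real n + (d + 1) * (m + 1) * \<Omega>)) \<le> lam * \<Omega>"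
begin

section \<open>The probability of a single chain\<close>

fun side_weight :: "nat set list \<Rightarrow> real" where
  "side_weight (f' # f # fs) = (if fresh (f # fs) then z K ^ (d - 1) else 1 / \<zeta> ^ (d + 2)) * side_weight (f # fs)"
| "side_weight _ = 1"

fun chain_weight :: "nat set list \<Rightarrow> real" where
  "chain_weight (f' # f # fs) =
     (if fresh (f # fs) then z K ^ (d - 1) * exp (- c1 * y J ^ d) else 1 / \<zeta> ^ (d + 2)) * chain_weight (f # fs)"
| "chain_weight _ = 1"

lemma side_weight_nonneg: "0 \<le> side_weight fs"
  using zpos[of K] \<zeta>(1) by (induction fs rule: side_weight.induct) (auto simp: less_imp_le)

lemma chain_weight_nonneg: "0 \<le> chain_weight fs"
  using zpos[of K] \<zeta>(1) by (induction fs rule: chain_weight.induct) (auto simp: less_imp_le)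

lemma chain_weight_eq:
  assumes "admissible d n fs"
  shows "chain_weight fs = side_weight fs * exp (- c1 * y J ^ d) ^ card (exits fs)"
  using assms
proof (induction fs rule: chain_weight.induct)
  case (1 f' f fs)
  have adm: "admissible d n (f # fs)" using "1.prems" by simp
  then show ?case
    using "1.IH" exits_props[OF adm] exit_new[OF "1.prems"] by (simp del: fresh.simps)
qed auto

text \<open>A non-fresh last face may have spoiled up to \<open>d + 1\<close> sides; the prefactor
  keeps this loss until the chain leaves the face. The next face, if fresh, can spoil one more side,
  whence the exponent \<open>d + 2\<close> in \<open>side_weight\<close>.\<close>

lemma side_weight_bound:
  assumes "admissible d n fs"
  shows "weight (set fs) (sides K fs) \<le> (if fresh fs then 1 else 1 / \<zeta> ^ (d + 1)) * side_weight fs"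
  using assms
proof (induction fs rule: side_weight.induct)
  case (1 f' f fs)
  let ?gs = "f # fs"
  have adm: "admissible d n ?gs" and f'E: "f' \<in> E" and e: "f' \<in> ext d ?gs"
    using "1.prems" by auto
  note IH = "1.IH"[OF adm]
  note f' = k_subsetsD[OF f'E]
  define N where "N = (if fresh ?gs then map (\<lambda>w. (f - {w}, w, K)) (sorted_list_of_set (side_vertices f fs f')) else [])"
  have app: "weight B (sides K (f' # ?gs)) = weight B N * weight B (sides K ?gs)" for B
    by (simp add: weight_def N_def)
  have N: "weight (set (f' # ?gs)) N \<le> (if fresh ?gs then z K ^ (d - 1) else 1)"
  proof (cases "fresh ?gs")
    case True
    let ?S = "side_vertices f fs f'"
    obtain v where v: "f = insert v (f \<inter> \<Union> (set fs))" "v \<notin> \<Union> (set fs)"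
      using fresh_face[OF adm True] by metis
    have fr: "fresh_in (set (f' # ?gs)) (f - {w}) w" if w: "w \<in> ?S" for w
      unfolding fresh_in_def
    proof (intro ballI impI)
      fix g assume g: "g \<in> set (f' # ?gs)" "f - {w} \<subseteq> g"
      have w': "w \<in> f" "f - {w} \<noteq> f \<inter> f'" "\<not> f - {w} \<subseteq> \<Union> (set fs)"
        using w by (auto simp: side_vertices_def)
      have "g \<notin> set fs" using w'(3) g(2) by blast
      moreover have "g \<noteq> f'"
      proof
        assume "g = f'"
        then have sub: "f - {w} \<subseteq> f \<inter> f'" using g(2) by blast
        have "card (f \<inter> f') = d" using e True by (simp add: ext_def)
        moreover have "card (f - {w}) = d"
          using w'(1) k_subsetsD[OF admissible_faces[OF adm, of f, simplified]] by simp
        moreover have "finite (f \<inter> f')" using f'(3) by blast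
        ultimately have "f - {w} = f \<inter> f'" using sub by (metis card_subset_eq)
        then show False using w'(2) by blast
      qed
      ultimately show "g = insert w (f - {w})" using g(1) w'(1) by auto
    qed
    have "weight (set (f' # ?gs)) N = prod_list (map (\<lambda>w. z K) (sorted_list_of_set ?S))"
      unfolding weight_def N_def if_P[OF True] map_map o_def
      using fr side_vertices(1)[OF adm True] by (intro arg_cong[where f = prod_list] map_cong) auto
    also have "\<dots> = z K ^ card ?S"
      by (simp add: map_replicate_const prod_list_replicate)
    also have "\<dots> \<le> z K ^ (d - 1)"
      using side_vertices(2)[OF adm True] zK zpos[of K] by (intro power_decreasing) auto
    finally show ?thesis using True by simp
  qed (simp add: N_def weight_def del: fresh.simps)
  define old where "old = {\<theta> \<in> set (map fst (sides K ?gs)). \<theta> \<subseteq> f'}"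
  have sd: "\<theta> \<in> F" "\<theta> \<subseteq> \<Union> (set fs)" if "\<theta> \<in> set (map fst (sides K ?gs))" for \<theta>
    using that sides_props(1)[OF adm, of K] by fastforce+
  have dist: "distinct (map fst (sides K ?gs))" "\<forall>x\<in>set (sides K ?gs). fst x \<in> F"
    using sides_props(2)[OF adm] sd(1) by auto
  have B: "weight (set (f' # ?gs)) (sides K ?gs) \<le> weight (set ?gs) (sides K ?gs) / \<zeta> ^ card old"
    using weight_insert_card[OF dist(1), of f' "set ?gs"] by (simp add: old_def)
  have wn: "0 \<le> weight (set ?gs) (sides K ?gs)" by (rule weight_nonneg)
  \<comment> \<open>A fresh face meets the older vertices in one facet only, the one it is attached
    along, so it can spoil no other side.\<close>
  have inter: "\<theta> = f' \<inter> \<Union> (set ?gs)" if "\<theta> \<in> old" "fresh (f' # ?gs)" for \<theta>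
  proof -
    have "card (f' \<inter> \<Union> (set ?gs)) = d" using fresh_face[OF "1.prems" that(2)] by metis
    moreover have t: "\<theta> \<subseteq> f'" "\<theta> \<in> set (map fst (sides K ?gs))" using that(1) by (simp_all add: old_def)
    moreover have "\<theta> \<subseteq> \<Union> (set ?gs)" using sd(2)[OF t(2)] by (simp add: le_supI2)
    then have "\<theta> \<subseteq> f' \<inter> \<Union> (set ?gs)" using t(1) by (rule le_infI[rotated])
    moreover have "card \<theta> = d" using sd(1)[OF t(2)] by (rule k_subsetsD(1))
    ultimately show ?thesis using f'(3) by (metis card_subset_eq finite_Int)
  qed
  show ?case
  proof (cases "fresh (f' # ?gs)")
    case fr: True
    show ?thesis
    proof (cases "fresh ?gs")
      case True
      \<comment> \<open>From a fresh face the chain leaves through a facet with its new vertex,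
        while all sides recorded so far lie within older faces.\<close>
      have "old = {}"
      proof (rule equals0I)
        fix \<theta> assume t: "\<theta> \<in> old"
        have "f \<inter> f' \<subseteq> f' \<inter> \<Union> (set ?gs)" by auto
        also have "\<dots> = \<theta>" using inter[OF t fr] by simp
        also have "\<dots> \<subseteq> \<Union> (set fs)" using t sd(2) unfolding old_def by blast
        finally show False using e True by (simp add: ext_def)
      qed
      then have "weight (set (f' # ?gs)) (sides K ?gs) \<le> side_weight ?gs"
        using B IH True by simp
      then have "weight (set (f' # ?gs)) N * weight (set (f' # ?gs)) (sides K ?gs) \<le> z K ^ (d - 1) * side_weight ?gs"
        using N True zpos[of K] by (intro mult_mono weight_nonneg) (auto simp: less_imp_le)
      then show ?thesis using fr True app by (simp del: fresh.simps)
    next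
      case False
      have "card old \<le> 1"
      proof -
        have "old \<subseteq> {f' \<inter> \<Union> (set ?gs)}" using inter[OF _ fr] by blast
        then show ?thesis using card_mono[of "{f' \<inter> \<Union> (set ?gs)}" old] by simp
      qed
      then have "\<zeta> ^ 1 \<le> \<zeta> ^ card old" using \<zeta> by (intro power_decreasing) auto
      then have "weight (set ?gs) (sides K ?gs) / \<zeta> ^ card old \<le> weight (set ?gs) (sides K ?gs) / \<zeta>"
        using wn \<zeta>(1) by (intro divide_left_mono) auto
      also have "\<dots> \<le> (1 / \<zeta> ^ (d + 1) * side_weight ?gs) / \<zeta>"
        using IH False \<zeta>(1) by (intro divide_right_mono) auto
      also have "\<dots> = 1 / \<zeta> ^ (d + 2) * side_weight ?gs" by simp
      finally have "weight (set (f' # ?gs)) (sides K ?gs) \<le> 1 / \<zeta> ^ (d + 2) * side_weight ?gs"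
        using B by linarith
      then have "weight (set (f' # ?gs)) N * weight (set (f' # ?gs)) (sides K ?gs)
          \<le> 1 * (1 / \<zeta> ^ (d + 2) * side_weight ?gs)"
        using N False by (intro mult_mono weight_nonneg) auto
      then show ?thesis unfolding app using fr False by (simp del: fresh.simps)
    qed
  next
    case nf: False
    have "weight (set (f' # ?gs)) (sides K ?gs) \<le> weight (set ?gs) (sides K ?gs) / \<zeta> ^ (d + 1)"
      using weight_insert_le[OF dist, of f' "set ?gs"] f'(1) by simp
    also have "\<dots> \<le> ((if fresh ?gs then 1 else 1 / \<zeta> ^ (d + 1)) * side_weight ?gs) / \<zeta> ^ (d + 1)"
      using IH \<zeta>(1) by (intro divide_right_mono) auto
    finally have "weight (set (f' # ?gs)) N * weight (set (f' # ?gs)) (sides K ?gs)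
       \<le> (if fresh ?gs then z K ^ (d - 1) else 1) * (((if fresh ?gs then 1 else 1 / \<zeta> ^ (d + 1)) * side_weight ?gs) / \<zeta> ^ (d + 1))"
      using N zpos[of K] by (intro mult_mono weight_nonneg) (auto simp: less_imp_le)
    also have "\<dots> \<le> (if fresh ?gs then z K ^ (d - 1) else 1 / \<zeta> ^ (d + 2)) * side_weight ?gs / \<zeta> ^ (d + 1)"
    proof (cases "fresh ?gs")
      case False
      have "\<zeta> ^ (d + 2) \<le> \<zeta> ^ (d + 1)" using \<zeta> by (intro power_decreasing) auto
      then have "1 / \<zeta> ^ (d + 1) \<le> 1 / \<zeta> ^ (d + 2)" using \<zeta>(1) by (intro divide_left_mono) auto
      then have "1 / \<zeta> ^ (d + 1) * side_weight ?gs / \<zeta> ^ (d + 1) \<le> 1 / \<zeta> ^ (d + 2) * side_weight ?gs / \<zeta> ^ (d + 1)"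
        using side_weight_nonneg \<zeta>(1) by (intro divide_right_mono mult_right_mono) auto
      then show ?thesis using False by (simp del: fresh.simps)
    qed (simp del: fresh.simps)
    finally show ?thesis using nf app by (simp del: fresh.simps power_Suc)
  qed
qed (use \<zeta> in \<open>auto simp: weight_def intro!: mult_le_one power_le_one\<close>)

text \<open>Restricted to vertices off the whole chain: the faces asked about are then no chain
  faces, so their presence stays random once the chain is planted.\<close>

definition blocked :: "nat set list \<Rightarrow> nat set set \<Rightarrow> bool" where
  "blocked fs X \<longleftrightarrow> (\<forall>\<theta>\<in>exits fs. \<forall>v. v \<notin> \<Union> (set fs) \<and> insert v \<theta> \<in> X \<longrightarrow> \<not> good J X \<theta> v)"

lemma chain_imp:
  assumes "chain d K J X fs" and fin: "\<forall>f\<in>set fs. finite f"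
  shows "all_alive {} (sides K fs) X \<and> blocked fs X"
  using assms
proof (induction fs rule: chain_weight.induct)
  case (1 f' f fs)
  have ch: "chain d K J X (f # fs)" using "1.prems" by simp
  have IH: "all_alive {} (sides K (f # fs)) X" "blocked (f # fs) X" using "1.IH"[OF ch] "1.prems" by auto
  have new: "alive K X (f - {w}) w" if "fresh (f # fs)" "w \<in> side_vertices f fs f'" for w
    using "1.prems" that by (simp add: side_vertices_def)
  have blk: "\<not> good J X (f \<inter> f') v" if "fresh (f # fs)" "v \<notin> f \<union> f'" "insert v (f \<inter> f') \<in> X" for v
    using "1.prems" that by simp
  have "all_alive {} (sides K (f' # f # fs)) X"
    unfolding all_alive_def
  proof (rule ballI)
    fix x assume x: "x \<in> set (sides K (f' # f # fs))"
    have "finite f" using "1.prems"(2) by simp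
    then have fin: "finite (side_vertices f fs f')" by (simp add: side_vertices_def)
    have "x \<in> set (sides K (f # fs)) \<or> (fresh (f # fs) \<and> (\<exists>w\<in>side_vertices f fs f'. x = (f - {w}, w, K)))"
    proof (cases "fresh (f # fs)")
      case True
      then show ?thesis using x fin by (auto simp del: fresh.simps)
    qed (use x in \<open>simp del: fresh.simps\<close>)
    then show "case x of (\<theta>, u, k) \<Rightarrow> alive k (X \<union> {}) \<theta> u"
      using IH(1) new unfolding all_alive_def by fastforce
  qed
  moreover have "blocked (f' # f # fs) X"
    unfolding blocked_def
  proof (intro ballI allI impI)
    fix \<theta> v assume t: "\<theta> \<in> exits (f' # f # fs)" and v: "v \<notin> \<Union> (set (f' # f # fs)) \<and> insert v \<theta> \<in> X"
    consider "fresh (f # fs)" "\<theta> = f \<inter> f'" | "\<theta> \<in> exits (f # fs)" using t by (auto split: if_splits)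
    then show "\<not> good J X \<theta> v"
    proof cases
      case 1
      then show ?thesis using blk[of v] v by simp
    next
      case 2
      then show ?thesis using IH(2) v unfolding blocked_def by simp
    qed
  qed
  ultimately show ?case by blast
qed (simp_all add: all_alive_def blocked_def)

text \<open>The stars of all exits are exposed last. Up to the concentration error, each exit has
  many vertices off the chain that are good by the faces outside. The resulting faces meet the chain
  vertices exactly in their exit, so different exits use different faces. \<open>tiny\<close> makes
  the error no larger than the main term, whence the factor \<open>2\<close>.\<close>

lemma blocked_bound:
  assumes adm: "admissible d n fs" and len: "length fs \<le> m + 1"
  shows "bprob E p (blocked fs) \<le> 2 * exp (- c1 * y J ^ d) ^ card (exits fs)"
proof -
  define \<Theta> where "\<Theta> = exits fs"
  define V where "V = \<Union> (set fs)"
  define S where "S = E \<inter> star \<Theta>"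
  define U where "U \<theta> = {v \<in> {1..n}. v \<notin> V \<and> usable \<Theta> \<theta> v}" for \<theta>
  define g where "g = y J ^ d * (real n - real (2 * b + d + d * H))"
  have fin\<Theta>: "finite \<Theta>" and \<Theta>F: "\<Theta> \<subseteq> F" and c\<Theta>: "card \<Theta> \<le> m + 1"
    using exits_props[OF adm] len unfolding \<Theta>_def by auto
  have "\<Union> (set (tl fs)) \<subseteq> V" unfolding V_def by (cases fs) auto
  then have \<Theta>V: "\<theta> \<subseteq> V" if "\<theta> \<in> \<Theta>" for \<theta>
    using exits_props[OF adm] that unfolding \<Theta>_def by blast
  have finV: "finite V" and cV: "card V \<le> b"
    using Union_admissible[OF adm] len small(1) unfolding V_def
    by (simp, meson le_trans mult_le_mono2)
  have sp: "spread d \<Theta> (m + 1)"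
    unfolding spread_def
  proof (intro allI impI)
    fix \<rho> :: "nat set" assume "card \<rho> + 1 = d \<and> finite \<rho>"
    have "card {v. v \<notin> \<rho> \<and> insert v \<rho> \<in> \<Theta>} \<le> card \<Theta>"
    proof (rule card_inj_on_le[where f = "\<lambda>v. insert v \<rho>"])
      show "inj_on (\<lambda>v. insert v \<rho>) {v. v \<notin> \<rho> \<and> insert v \<rho> \<in> \<Theta>}"
        by (rule inj_onI) blast
    qed (use fin\<Theta> in auto)
    then show "card {v. v \<notin> \<rho> \<and> insert v \<rho> \<in> \<Theta>} \<le> m + 1" using c\<Theta> by linarith
  qed
  have mH: "(m + 1) + J * (b + d) \<le> H" "m + 1 \<le> H" using JH by auto
  have few: "bprob E p (\<lambda>X. real (card {v \<in> U \<theta>. good J (X - star \<Theta>) \<theta> v}) < g) \<le> real n * err J"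
    if \<theta>: "\<theta> \<in> \<Theta>" for \<theta>
  proof -
    have \<theta>F: "\<theta> \<in> F" using \<theta> \<Theta>F by blast
    have Usub: "U \<theta> \<subseteq> {1..n} - \<theta>" using \<Theta>V[OF \<theta>] by (auto simp: U_def)
    have "{1..n} \<subseteq> U \<theta> \<union> V \<union> {x \<in> {1..n} - \<theta>. \<not> usable \<Theta> \<theta> x}"
      using \<Theta>V[OF \<theta>] by (auto simp: U_def)
    then have "n \<le> card (U \<theta> \<union> V \<union> {x \<in> {1..n} - \<theta>. \<not> usable \<Theta> \<theta> x})"
      using card_mono[of "U \<theta> \<union> V \<union> {x \<in> {1..n} - \<theta>. \<not> usable \<Theta> \<theta> x}" "{1..n}"] finV
      by (simp add: U_def)
    also have "\<dots> \<le> card (U \<theta>) + card V + card {x \<in> {1..n} - \<theta>. \<not> usable \<Theta> \<theta> x}"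
      by (meson add_le_mono card_Un_le le_trans order_refl)
    also have "\<dots> \<le> card (U \<theta>) + b + d * (m + 1)"
      using card_unusable[OF \<theta>F \<Theta>F sp d] cV by linarith
    also have "\<dots> \<le> card (U \<theta>) + b + d * H"
      using mH(2) by (intro add_left_mono mult_left_mono) auto
    finally have cU: "n \<le> card (U \<theta>) + b + d * H" .
    have "g \<le> y J ^ d * (real (card (U \<theta>)) - real b)"
    proof -
      have "real n \<le> real (card (U \<theta>)) + b + d * H"
        using cU by (metis of_nat_add of_nat_le_iff)
      then show ?thesis unfolding g_def using y01 by (intro mult_left_mono) auto
    qed
    then have "bprob E p (\<lambda>X. real (card {v \<in> U \<theta>. good J (X - star \<Theta>) \<theta> v}) < g)
        \<le> bprob E p (\<lambda>X. real (card {v \<in> U \<theta>. good J (X - star \<Theta>) \<theta> v}) < y J ^ d * (real (card (U \<theta>)) - real b))"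
      by (intro bprob_mono) linarith
    also have "\<dots> \<le> real n * err J"
      using Usub by (intro many[OF \<theta>F \<Theta>F sp mH(1)]) (auto simp: U_def)
    finally show ?thesis .
  qed
  let ?bad = "\<lambda>X. \<exists>\<theta>\<in>\<Theta>. real (card {v \<in> U \<theta>. good J X \<theta> v}) < g"
  let ?e = "exp (- c1 * y J ^ d) ^ card \<Theta>"
  have finS: "finite S" using finE by (simp add: S_def)
  have "bprob E p (blocked fs) \<le> bexp (E - S) p (\<lambda>X0. of_bool (?bad X0) + ?e)"
  proof (rule bexp_le_if_section_le[OF finE])
    show "S \<subseteq> E" by (auto simp: S_def)
    fix X0 assume X0: "X0 \<subseteq> E - S"
    show "bprob S p (\<lambda>Y. blocked fs (X0 \<union> Y)) \<le> of_bool (?bad X0) + ?e"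
    proof (cases "?bad X0")
      case True
      have "bprob S p (\<lambda>Y. blocked fs (X0 \<union> Y)) \<le> 1" using finS by (rule bprob_le_1)
      also have "\<dots> \<le> of_bool (?bad X0) + ?e" using True by simp
      finally show ?thesis .
    next
      case False
      define G where "G \<theta> = {v \<in> U \<theta>. good J X0 \<theta> v}" for \<theta>
      define D where "D \<theta> = (\<lambda>v. insert v \<theta>) ` G \<theta>" for \<theta>
      have G: "v \<in> {1..n}" "v \<notin> V" "good J X0 \<theta> v" if "v \<in> G \<theta>" for v \<theta>
        using that by (auto simp: G_def U_def)
      have finG: "finite (G \<theta>)" for \<theta> by (simp add: G_def U_def)
      have cD: "card (D \<theta>) = card (G \<theta>)" if "\<theta> \<in> \<Theta>" for \<theta>
        unfolding D_def
      proof (rule card_image, rule inj_onI)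
        fix v v' assume "v \<in> G \<theta>" "v' \<in> G \<theta>" "insert v \<theta> = insert v' \<theta>"
        then show "v = v'" using G(2) \<Theta>V[OF that] by blast
      qed
      have int: "f \<inter> V = \<theta>" if "f \<in> D \<theta>" "\<theta> \<in> \<Theta>" for f \<theta>
        using that G(2) \<Theta>V[OF that(2)] unfolding D_def by blast
      have "card (\<Union>\<theta>\<in>\<Theta>. D \<theta>) = (\<Sum>\<theta>\<in>\<Theta>. card (D \<theta>))"
      proof (rule card_UN_disjoint[OF fin\<Theta>])
        show "\<forall>i\<in>\<Theta>. finite (D i)" using finG by (simp add: D_def)
        show "\<forall>i\<in>\<Theta>. \<forall>j\<in>\<Theta>. i \<noteq> j \<longrightarrow> D i \<inter> D j = {}"
        proof (intro ballI impI)
          fix i j assume "i \<in> \<Theta>" "j \<in> \<Theta>" "i \<noteq> j"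
          then show "D i \<inter> D j = {}" using int[of _ i] int[of _ j] by blast
        qed
      qed
      also have "\<dots> = (\<Sum>\<theta>\<in>\<Theta>. card (G \<theta>))" using cD by (intro sum.cong) auto
      finally have "real (card (\<Union>\<theta>\<in>\<Theta>. D \<theta>)) = (\<Sum>\<theta>\<in>\<Theta>. real (card (G \<theta>)))" by simp
      also have "\<dots> \<ge> (\<Sum>\<theta>\<in>\<Theta>. g)"
        using False by (intro sum_mono) (auto simp: G_def not_less)
      finally have cUD: "card \<Theta> * g \<le> real (card (\<Union>\<theta>\<in>\<Theta>. D \<theta>))" by simp
      have DS: "(\<Union>\<theta>\<in>\<Theta>. D \<theta>) \<subseteq> S"
      proof
        fix f assume "f \<in> (\<Union>\<theta>\<in>\<Theta>. D \<theta>)"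
        then obtain \<theta> v where v: "\<theta> \<in> \<Theta>" "v \<in> G \<theta>" "f = insert v \<theta>" unfolding D_def by blast
        have "\<theta> \<in> F" "v \<notin> \<theta>" using v(1) \<Theta>F \<Theta>V[OF v(1)] G(2)[OF v(2)] by blast+
        moreover note k_subsetsD[OF calculation(1)]
        ultimately have "f \<in> E" using G(1)[OF v(2)] unfolding v(3) k_subsets_def by simp
        moreover have "f \<in> star \<Theta>" using v(1) unfolding v(3) star_def by blast
        ultimately show "f \<in> S" unfolding S_def by blast
      qed
      have "bprob S p (\<lambda>Y. blocked fs (X0 \<union> Y)) \<le> bprob S p (\<lambda>Y. Y \<inter> (\<Union>\<theta>\<in>\<Theta>. D \<theta>) = {})"
      proof (rule bprob_mono)
        fix Y assume Y: "blocked fs (X0 \<union> Y)"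
        show "Y \<inter> (\<Union>\<theta>\<in>\<Theta>. D \<theta>) = {}"
        proof (rule ccontr)
          assume "Y \<inter> (\<Union>\<theta>\<in>\<Theta>. D \<theta>) \<noteq> {}"
          then obtain \<theta> v where v: "\<theta> \<in> \<Theta>" "v \<in> G \<theta>" "insert v \<theta> \<in> Y" unfolding D_def by blast
          have "good J (X0 \<union> Y) \<theta> v" by (rule good_mono[OF G(3)[OF v(2)]]) blast
          then show False using Y v G(2)[OF v(2)] unfolding blocked_def \<Theta>_def V_def by blast
        qed
      qed
      also have "\<dots> = (1 - p) ^ card (\<Union>\<theta>\<in>\<Theta>. D \<theta>)" using finS DS by (rule bprob_avoid)
      also have "\<dots> \<le> exp (- p) ^ card (\<Union>\<theta>\<in>\<Theta>. D \<theta>)"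
        using p01 exp_ge_add_one_self[of "- p"] by (intro power_mono) auto
      also have "\<dots> = exp (- p * real (card (\<Union>\<theta>\<in>\<Theta>. D \<theta>)))"
        by (simp add: exp_of_nat_mult[symmetric] mult.commute)
      also have "\<dots> \<le> exp (- c1 * y J ^ d * card \<Theta>)"
      proof -
        have "c1 * y J ^ d * card \<Theta> \<le> p * (real n - real (2 * b + d + d * H)) * y J ^ d * card \<Theta>"
          using c1 y01 by (intro mult_right_mono) auto
        also have "\<dots> = p * (card \<Theta> * g)" by (simp add: g_def)
        also have "\<dots> \<le> p * real (card (\<Union>\<theta>\<in>\<Theta>. D \<theta>))" using cUD p01 by (intro mult_left_mono) auto
        finally show ?thesis by simp
      qed
      also have "\<dots> = ?e" by (simp add: exp_of_nat_mult[symmetric] mult.commute)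
      finally show ?thesis using False by simp
    qed
  qed
  also have "\<dots> = bprob (E - S) p ?bad + ?e"
    using finE by (subst bexp_add) (simp add: bexp_const)
  also have "bprob (E - S) p ?bad = bprob E p (\<lambda>X. ?bad (X - S))"
    using finE by (intro bexp_restrict[symmetric]) (auto simp: S_def)
  also have "\<dots> \<le> (\<Sum>\<theta>\<in>\<Theta>. bprob E p (\<lambda>X. real (card {v \<in> U \<theta>. good J (X - star \<Theta>) \<theta> v}) < g))"
  proof (rule bprob_union_bound[OF fin\<Theta>])
    fix X assume X: "X \<subseteq> E" "?bad (X - S)"
    have "X - S = X - star \<Theta>" using X(1) by (auto simp: S_def)
    then show "\<exists>\<theta>\<in>\<Theta>. real (card {v \<in> U \<theta>. good J (X - star \<Theta>) \<theta> v}) < g" using X(2) by simp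
  qed
  also have "\<dots> \<le> (\<Sum>\<theta>\<in>\<Theta>. real n * err J)" using few by (rule sum_mono)
  also have "\<dots> \<le> real (m + 1) * (real n * err J)"
    unfolding sum_constant using c\<Theta> err_nonneg by (intro mult_right_mono) auto
  also have "\<dots> \<le> exp (- c1 * (m + 1))" using tiny by (simp only: mult.assoc)
  also have "\<dots> \<le> exp (- c1 * y J ^ d * card \<Theta>)"
  proof -
    have "y J ^ d * card \<Theta> \<le> 1 * real (m + 1)"
      using y01 c\<Theta> by (intro mult_mono power_le_one) auto
    then have "c1 * (y J ^ d * card \<Theta>) \<le> c1 * (1 * real (m + 1))" using c1 by (intro mult_left_mono) auto
    then show ?thesis by (simp add: mult.assoc)
  qed
  also have "\<dots> = ?e" by (simp add: exp_of_nat_mult[symmetric] mult.commute)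
  finally show ?thesis by (simp add: \<Theta>_def)
qed

text \<open>Planting the chain gives \<open>p ^ length fs\<close>. What remains is increasing for
  the sides and decreasing for the exits, so Harris' inequality splits it into two factors that are
  bounded separately.\<close>

lemma chain_prob:
  assumes adm: "admissible d n fs" and len: "length fs \<le> m + 1"
  shows "bprob E p (\<lambda>X. chain d K J X fs) \<le> p ^ length fs * (2 / \<zeta> ^ (d + 1) * chain_weight fs)"
proof -
  let ?B = "set fs"
  have BE: "?B \<subseteq> E" using admissible_faces[OF adm] by blast
  have fin: "\<forall>f\<in>?B. finite f" using BE k_subsetsD(3) by blast
  have cB: "card ?B = length fs" using admissible_distinct[OF adm] by (rule distinct_card)
  have "bprob E p (\<lambda>X. chain d K J X fs)
      \<le> bexp E p (\<lambda>X. of_bool (?B \<subseteq> X) * of_bool (all_alive {} (sides K fs) X \<and> blocked fs X))"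
  proof (rule bexp_mono)
    fix X assume X: "X \<subseteq> E"
    show "of_bool (chain d K J X fs)
      \<le> of_bool (?B \<subseteq> X) * (of_bool (all_alive {} (sides K fs) X \<and> blocked fs X) :: real)"
      using chain_imp[of X fs, OF _ fin] chain_admissible[of d K J X fs n] X by auto
  qed
  also have "\<dots> = p ^ length fs * bprob E p (\<lambda>X. all_alive {} (sides K fs) (X \<union> ?B) \<and> blocked fs (X \<union> ?B))"
    using bexp_superset[OF finE BE] cB by simp
  \<comment> \<open>The planted faces are kept in the increasing event and dropped from the
    decreasing one, which only enlarges the latter.\<close>
  also have "\<dots> \<le> p ^ length fs * bprob E p (\<lambda>X. all_alive ?B (sides K fs) X \<and> blocked fs X)"
  proof (intro mult_left_mono bprob_mono conjI)
    fix X assume *: "all_alive {} (sides K fs) (X \<union> ?B) \<and> blocked fs (X \<union> ?B)"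
    then show "all_alive ?B (sides K fs) X" by (simp add: all_alive_def)
    show "blocked fs X"
      unfolding blocked_def
    proof (intro ballI allI impI notI)
      fix \<theta> v assume t: "\<theta> \<in> exits fs" "v \<notin> \<Union> (set fs) \<and> insert v \<theta> \<in> X" "good J X \<theta> v"
      have "good J (X \<union> ?B) \<theta> v" by (rule good_mono[OF t(3)]) blast
      then show False using * t unfolding blocked_def by blast
    qed
  qed (use p01 in auto)
  also have "\<dots> \<le> p ^ length fs * (bprob E p (all_alive ?B (sides K fs)) * bprob E p (blocked fs))"
  proof (intro mult_left_mono bprob_harris[OF finE])
    show "all_alive ?B (sides K fs) Y" if "X \<subseteq> Y" "all_alive ?B (sides K fs) X" for X Y
      using that all_alive_mono by blast
    show "blocked fs X" if "X \<subseteq> Y" "blocked fs Y" for X Y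
      unfolding blocked_def
    proof (intro ballI allI impI notI)
      fix \<theta> v assume t: "\<theta> \<in> exits fs" "v \<notin> \<Union> (set fs) \<and> insert v \<theta> \<in> X" "good J X \<theta> v"
      have "good J Y \<theta> v" by (rule good_mono[OF t(3) that(1)])
      then show False using that t unfolding blocked_def by blast
    qed
  qed (use p01 in auto)
  also have "\<dots> \<le> p ^ length fs * ((1 / \<zeta> ^ (d + 1) * side_weight fs) * (2 * exp (- c1 * y J ^ d) ^ card (exits fs)))"
  proof (intro mult_left_mono mult_mono blocked_bound adm len)
    have "bprob E p (all_alive ?B (sides K fs)) \<le> weight ?B (sides K fs)"
    proof (rule all_alive_bound[where W = "\<Union> (set fs)"])
      show "targets (\<Union> (set fs)) (sides K fs)"
        unfolding targets_def
      proof (intro conjI ballI)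
        show "distinct (map fst (sides K fs))" using sides_props(2)[OF adm] .
        fix x assume "x \<in> set (sides K fs)"
        moreover obtain \<theta> u k where x: "x = (\<theta>, u, k)" by (cases x)
        ultimately have "\<theta> \<in> F \<and> u \<notin> \<theta> \<and> k = K \<and> insert u \<theta> \<subseteq> \<Union> (set (tl fs))"
          using sides_props(1)[OF adm, of K] by auto
        moreover have "\<Union> (set (tl fs)) \<subseteq> \<Union> (set fs)" by (cases fs) auto
        ultimately show "case x of (\<theta>, u, k) \<Rightarrow> \<theta> \<in> F \<and> u \<notin> \<theta> \<and> k \<le> K \<and> insert u \<theta> \<subseteq> \<Union> (set fs)"
          unfolding x by auto
      qed
      have "size_of (sides K fs) = (\<Sum>x\<leftarrow>sides K fs. (d + 1) ^ K)"
        unfolding size_of_def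
        using sides_props(1)[OF adm, of K] by (intro arg_cong[where f = sum_list] map_cong) auto
      also have "\<dots> = length (sides K fs) * (d + 1) ^ K" by (simp add: sum_list_triv)
      also have "\<dots> \<le> ((d + 1) * (m + 1)) * (d + 1) ^ K"
        using sides_props(3)[OF adm, of K] len by (meson le_trans mult_le_mono1 mult_le_mono2)
      finally have "size_of (sides K fs) \<le> ((d + 1) * (m + 1)) * (d + 1) ^ K" .
      moreover have "card (\<Union> (set fs)) \<le> (d + 1) * (m + 1)"
        using Union_admissible(3)[OF adm] len by (meson le_trans mult_le_mono2)
      ultimately have "card (\<Union> (set fs)) + size_of (sides K fs) \<le> (d + 1) * (m + 1) * (1 + (d + 1) ^ K)"
        unfolding distrib_left mult_1_right by (rule add_mono[rotated])
      then show "card (\<Union> (set fs)) + size_of (sides K fs) \<le> h" using small(2) by linarith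
      show "\<Union> (set fs) \<subseteq> {1..n}" using Union_admissible(1)[OF adm] .
    qed auto
    also have "\<dots> \<le> (if fresh fs then 1 else 1 / \<zeta> ^ (d + 1)) * side_weight fs"
      by (rule side_weight_bound[OF adm])
    also have "\<dots> \<le> 1 / \<zeta> ^ (d + 1) * side_weight fs"
    proof (intro mult_right_mono side_weight_nonneg)
      have "\<zeta> ^ (d + 1) \<le> 1" using \<zeta> by (intro power_le_one) auto
      then show "(if fresh fs then 1 else 1 / \<zeta> ^ (d + 1)) \<le> 1 / \<zeta> ^ (d + 1)" using \<zeta>(1) by simp
    qed
    finally show "bprob E p (all_alive ?B (sides K fs)) \<le> 1 / \<zeta> ^ (d + 1) * side_weight fs" .
  qed (use p01 \<zeta> side_weight_nonneg in \<open>auto intro!: bexp_nonneg\<close>)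
  also have "\<dots> = p ^ length fs * (2 / \<zeta> ^ (d + 1) * chain_weight fs)"
    by (simp add: chain_weight_eq[OF adm] mult_ac)
  finally show ?thesis .
qed

text \<open>The next face is a facet of attachment plus one vertex. After a fresh face only the
  \<open>d\<close> facets with its new vertex qualify. For a non-fresh continuation the vertex is
  old, which replaces the factor \<open>n\<close> by the number of chain vertices.\<close>

lemma ext_cover:
  assumes adm: "admissible d n fs"
  shows "\<exists>P. finite P \<and> card P \<le> (if fresh fs then d else (d + 1) * length fs) \<and>
    (\<forall>f'\<in>E \<inter> ext d fs. \<exists>\<theta>\<in>P. \<exists>v\<in>{1..n}. f' = insert v \<theta> \<and> (\<not> fresh (f' # fs) \<longrightarrow> v \<in> \<Union> (set fs)))"
proof -
  obtain f gs where fs: "fs = f # gs" using adm by (cases fs) auto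
  have remove: "\<exists>w\<in>g. g \<inter> f' = g - {w}" if "g \<in> set fs" "card (g \<inter> f') = d" for g f'
  proof -
    note g = k_subsetsD[OF admissible_faces[OF adm that(1)]]
    have "card (g - g \<inter> f') = 1" using g that(2) by (subst card_Diff_subset) auto
    then obtain w where "g - g \<inter> f' = {w}" by (auto simp: card_1_singleton_iff)
    then show ?thesis by (intro bexI[of _ w]) auto
  qed
  have new: "\<exists>v\<in>{1..n}. f' = insert v (g \<inter> f') \<and> (\<not> fresh (f' # fs) \<longrightarrow> v \<in> \<Union> (set fs))"
    if f': "f' \<in> E" and g: "g \<in> set fs" "card (g \<inter> f') = d" for f' g
  proof -
    obtain v where v: "f' = insert v (g \<inter> f')" "v \<in> {1..n}" using face_inter[OF f' g(2)] by metis
    have "v \<in> f'" using v(1) by blast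
    then have "\<not> fresh (f' # fs) \<longrightarrow> v \<in> \<Union> (set fs)" using fs by auto
    then show ?thesis using v by blast
  qed
  show ?thesis
  proof (cases "fresh fs")
    case True
    obtain v0 where v0: "f = insert v0 (f \<inter> \<Union> (set gs))" "card (f \<inter> \<Union> (set gs)) = d"
      using fresh_face[of d n f gs] adm True fs by metis
    define T where "T = f \<inter> \<Union> (set gs)"
    have finT: "finite T" using v0(2) d T_def by (metis card.infinite not_one_le_zero)
    show ?thesis
    proof (intro exI[of _ "(\<lambda>w. f - {w}) ` T"] conjI ballI)
      show "card ((\<lambda>w. f - {w}) ` T) \<le> (if fresh fs then d else (d + 1) * length fs)"
        using card_image_le[OF finT, of "\<lambda>w. f - {w}"] v0(2) True by (simp add: T_def)
      fix f' assume f': "f' \<in> E \<inter> ext d fs"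
      have c: "card (f \<inter> f') = d" "\<not> f \<inter> f' \<subseteq> \<Union> (set gs)" using f' True by (auto simp: ext_def fs)
      obtain w where w: "w \<in> f" "f \<inter> f' = f - {w}" using remove[of f f'] c fs by auto
      have "w \<in> T"
      proof (rule ccontr)
        assume "w \<notin> T"
        then have "w = v0" using w(1) v0(1) T_def by blast
        then have "f - {w} \<subseteq> \<Union> (set gs)" using v0(1) by blast
        then show False using c(2) w(2) by simp
      qed
      then show "\<exists>\<theta>\<in>(\<lambda>w. f - {w}) ` T. \<exists>v\<in>{1..n}. f' = insert v \<theta> \<and> (\<not> fresh (f' # fs) \<longrightarrow> v \<in> \<Union> (set fs))"
        using new[of f' f] f' c(1) fs w(2) by (metis IntD1 imageI list.set_intros(1))
    qed (use finT in simp)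
  next
    case False
    define P where "P = (\<lambda>(g, w). g - {w}) ` (SIGMA g:set fs. g)"
    have fing: "finite g" "card g = d + 1" if "g \<in> set fs" for g
      using k_subsetsD[OF admissible_faces[OF adm that]] by auto
    show ?thesis
    proof (intro exI[of _ P] conjI ballI)
      show "finite P" unfolding P_def using fing by auto
      have "card P \<le> card (SIGMA g:set fs. g)" unfolding P_def using fing by (intro card_image_le) auto
      also have "\<dots> = (\<Sum>g\<in>set fs. card g)" using fing by (intro card_SigmaI) auto
      also have "\<dots> = (\<Sum>g\<in>set fs. d + 1)" using fing by (intro sum.cong) auto
      also have "\<dots> \<le> (d + 1) * length fs"
        using card_length[of fs] by (simp add: mult.commute del: mult_Suc mult_Suc_right)
      finally show "card P \<le> (if fresh fs then d else (d + 1) * length fs)" using False by simp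
      fix f' assume f': "f' \<in> E \<inter> ext d fs"
      obtain g where g: "g \<in> set fs" "card (g \<inter> f') = d"
        using ext_attach[of f' d fs] f' fs by blast
      obtain w where w: "w \<in> g" "g \<inter> f' = g - {w}" using remove[OF g] by blast
      then have "g \<inter> f' \<in> P" using g(1) unfolding P_def by force
      then show "\<exists>\<theta>\<in>P. \<exists>v\<in>{1..n}. f' = insert v \<theta> \<and> (\<not> fresh (f' # fs) \<longrightarrow> v \<in> \<Union> (set fs))"
        using new[of f' g] f' g by blast
    qed
  qed
qed

text \<open>Non-fresh faces are rare, since only few vertices are old. Weighting them with a large \<open>\<Omega>\<close>
  absorbs the many ways to continue after them.\<close>

definition potential :: "nat set list \<Rightarrow> real" where
  "potential fs = (if fresh fs then 1 else \<Omega>)"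

lemma ext_sum:
  assumes adm: "admissible d n fs" and len: "length fs \<le> m + 1"
  shows "(\<Sum>f'\<in>E \<inter> ext d fs. p * (if fresh fs then z K ^ (d - 1) * exp (- c1 * y J ^ d) else 1 / \<zeta> ^ (d + 2))
      * potential (f' # fs)) \<le> lam * potential fs"
proof -
  define fac where "fac = (if fresh fs then z K ^ (d - 1) * exp (- c1 * y J ^ d) else 1 / \<zeta> ^ (d + 2))"
  define V where "V = \<Union> (set fs)"
  define A where "A = E \<inter> ext d fs"
  have finA: "finite A" using finE by (simp add: A_def)
  obtain P where P0: "finite P \<and> card P \<le> (if fresh fs then d else (d + 1) * length fs) \<and>
    (\<forall>f'\<in>A. \<exists>\<theta>\<in>P. \<exists>v\<in>{1..n}. f' = insert v \<theta> \<and> (\<not> fresh (f' # fs) \<longrightarrow> v \<in> V))"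
    using ext_cover[OF adm] unfolding A_def V_def by (elim exE)
  then have P: "finite P" "card P \<le> (if fresh fs then d else (d + 1) * length fs)"
    "\<And>f'. f' \<in> A \<Longrightarrow> \<exists>\<theta>\<in>P. \<exists>v\<in>{1..n}. f' = insert v \<theta> \<and> (\<not> fresh (f' # fs) \<longrightarrow> v \<in> V)"
    by (simp_all only: Ball_def)
  have finV: "finite V" and cV: "card V \<le> (d + 1) * (m + 1)"
    using Union_admissible[OF adm] len unfolding V_def by (simp, meson le_trans mult_le_mono2)
  have "{f' \<in> A. fresh (f' # fs)} \<subseteq> (\<lambda>(\<theta>, v). insert v \<theta>) ` (P \<times> {1..n})"
    using P(3) by fastforce
  then have "card {f' \<in> A. fresh (f' # fs)} \<le> card (P \<times> {1..n})"
    using P(1) by (meson card_image_le card_mono finite_SigmaI finite_atLeastAtMost finite_imageI le_trans)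
  then have c1': "card {f' \<in> A. fresh (f' # fs)} \<le> card P * n" by (simp add: card_cartesian_product)
  have "{f' \<in> A. \<not> fresh (f' # fs)} \<subseteq> (\<lambda>(\<theta>, v). insert v \<theta>) ` (P \<times> V)"
    using P(3) by fastforce
  then have "card {f' \<in> A. \<not> fresh (f' # fs)} \<le> card (P \<times> V)"
    using P(1) finV by (meson card_image_le card_mono finite_SigmaI finite_imageI le_trans)
  also have "\<dots> \<le> card P * ((d + 1) * (m + 1))"
    using cV by (simp only: card_cartesian_product mult_le_mono2)
  finally have c2': "card {f' \<in> A. \<not> fresh (f' # fs)} \<le> card P * ((d + 1) * (m + 1))" .
  have "(\<Sum>f'\<in>A. potential (f' # fs)) = (\<Sum>f'\<in>{f' \<in> A. fresh (f' # fs)}. potential (f' # fs))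
      + (\<Sum>f'\<in>{f' \<in> A. \<not> fresh (f' # fs)}. potential (f' # fs))"
    using finA by (subst sum.union_disjoint[symmetric]) (auto intro!: sum.cong)
  also have "\<dots> = real (card {f' \<in> A. fresh (f' # fs)}) + real (card {f' \<in> A. \<not> fresh (f' # fs)}) * \<Omega>"
    by (simp add: potential_def del: fresh.simps)
  also have "\<dots> \<le> real (card P * n) + real (card P * ((d + 1) * (m + 1))) * \<Omega>"
    using c1' c2' \<Omega> by (intro add_mono mult_right_mono) (simp_all only: of_nat_le_iff)
  also have "\<dots> = real (card P) * (real n + real ((d + 1) * (m + 1)) * \<Omega>)"
    by (simp add: algebra_simps)
  finally have S: "(\<Sum>f'\<in>A. potential (f' # fs)) \<le> real (card P) * (real n + real ((d + 1) * (m + 1)) * \<Omega>)" .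
  have fac0: "0 \<le> fac" using zpos[of K] \<zeta> by (auto simp: fac_def less_imp_le)
  have q: "0 \<le> real n + real ((d + 1) * (m + 1)) * \<Omega>" using \<Omega> by (intro add_nonneg_nonneg mult_nonneg_nonneg) auto
  have "(\<Sum>f'\<in>A. p * fac * potential (f' # fs)) = p * fac * (\<Sum>f'\<in>A. potential (f' # fs))"
    by (simp only: sum_distrib_left)
  also have "\<dots> \<le> p * fac * (real (card P) * (real n + real ((d + 1) * (m + 1)) * \<Omega>))"
    using S fac0 p01 by (intro mult_left_mono) auto
  also have "\<dots> \<le> lam * potential fs"
  proof (cases "fresh fs")
    case True
    then have "real (card P) \<le> real d" using P(2) by simp
    then have "p * fac * (real (card P) * (real n + real ((d + 1) * (m + 1)) * \<Omega>))
        \<le> p * fac * (real d * (real n + real ((d + 1) * (m + 1)) * \<Omega>))"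
      using fac0 p01 q by (intro mult_left_mono mult_right_mono) auto
    also have "\<dots> = z K ^ (d - 1) * exp (- c1 * y J ^ d) * p * (d * real n + d * (d + 1) * (m + 1) * \<Omega>)"
      using True by (simp add: fac_def algebra_simps)
    also have "\<dots> \<le> lam" by (rule step_fresh)
    finally show ?thesis using True by (simp add: potential_def)
  next
    case False
    then have "card P \<le> (d + 1) * (m + 1)" using P(2) len by (simp only: if_False) (meson le_trans mult_le_mono2)
    then have "real (card P) \<le> real ((d + 1) * (m + 1))" by (simp only: of_nat_le_iff)
    then have "p * fac * (real (card P) * (real n + real ((d + 1) * (m + 1)) * \<Omega>))
        \<le> p * fac * (real ((d + 1) * (m + 1)) * (real n + real ((d + 1) * (m + 1)) * \<Omega>))"
      using fac0 p01 q by (intro mult_left_mono mult_right_mono) auto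
    also have "\<dots> = p / \<zeta> ^ (d + 2) * ((d + 1) * (m + 1) * (real n + (d + 1) * (m + 1) * \<Omega>))"
      using False by (simp add: fac_def)
    also have "\<dots> \<le> lam * \<Omega>" by (rule step_old)
    finally show ?thesis using False by (simp add: potential_def)
  qed
  finally show ?thesis unfolding fac_def A_def .
qed

section \<open>The weighted number of chains\<close>

definition lists :: "nat \<Rightarrow> nat set list set" where
  "lists l = {fs. admissible d n fs \<and> length fs = l}"

lemma finite_lists: "finite (lists l)"
proof (rule finite_subset)
  show "lists l \<subseteq> {fs. set fs \<subseteq> E \<and> length fs = l}"
    using admissible_faces by (auto simp: lists_def)
  show "finite {fs. set fs \<subseteq> E \<and> length fs = l}" using finE by (rule finite_lists_length_eq)
qed

lemma lists_Suc:
  assumes "l \<ge> 1"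
  shows "lists (Suc l) = (\<lambda>(fs, f'). f' # fs) ` (SIGMA fs:lists l. E \<inter> ext d fs)" (is "?L = ?R")
proof
  show "?L \<subseteq> ?R"
  proof
    fix fs assume fs: "fs \<in> ?L"
    then obtain f' f gs where "fs = f' # f # gs" using assms
      by (auto simp: lists_def length_Suc_conv Suc_le_eq gr0_conv_Suc)
    then show "fs \<in> ?R" using fs by (intro image_eqI[of _ _ "(f # gs, f')"]) (auto simp: lists_def)
  qed
  show "?R \<subseteq> ?L"
  proof
    fix gs assume "gs \<in> ?R"
    then obtain fs f' where g: "gs = f' # fs" "fs \<in> lists l" "f' \<in> E \<inter> ext d fs" by auto
    then obtain f hs where "fs = f # hs" using assms by (cases fs) (auto simp: lists_def)
    then show "gs \<in> ?L" using g by (auto simp: lists_def)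
  qed
qed

lemma total_bound:
  assumes "l \<le> m"
  shows "(\<Sum>fs\<in>lists (Suc l). p ^ Suc l * chain_weight fs * potential fs) \<le> lam ^ l * (p * real n ^ (d + 1) * \<Omega>)"
  using assms
proof (induction l)
  case 0
  have "lists (Suc 0) = (\<lambda>f. [f]) ` E"
    by (auto simp: lists_def length_Suc_conv)
  then have "(\<Sum>fs\<in>lists (Suc 0). p ^ Suc 0 * chain_weight fs * potential fs) = (\<Sum>f\<in>E. p * \<Omega>)"
    by (simp add: sum.reindex inj_on_def potential_def)
  also have "\<dots> = real (card E) * (p * \<Omega>)" by simp
  also have "\<dots> \<le> real (n ^ (d + 1)) * (p * \<Omega>)"
  proof (intro mult_right_mono)
    have "E = {K. K \<subseteq> {1..n} \<and> card K = d + 1}" by (simp add: k_subsets_def)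
    then have "card E = n choose (d + 1)" using n_subsets[of "{1..n}" "d + 1"] by simp
    also have "\<dots> \<le> n ^ (d + 1)"
      by (cases "d + 1 \<le> n") (auto intro: binomial_le_pow simp: binomial_eq_0 simp del: power_Suc)
    finally show "real (card E) \<le> real (n ^ (d + 1))" by (simp only: of_nat_le_iff)
  qed (use p01 \<Omega> in auto)
  finally show ?case by (simp add: mult_ac)
next
  case (Suc l)
  let ?fac = "\<lambda>fs. if fresh fs then z K ^ (d - 1) * exp (- c1 * y J ^ d) else 1 / \<zeta> ^ (d + 2)"
  have inj: "inj_on (\<lambda>(fs, f'). f' # fs) (SIGMA fs:lists (Suc l). E \<inter> ext d fs)"
    by (rule inj_onI) auto
  have l1: "1 \<le> Suc l" by simp
  have cw: "chain_weight (f' # fs) = ?fac fs * chain_weight fs" if "fs \<in> lists (Suc l)" for f' fs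
    using that by (cases fs) (auto simp: lists_def simp del: fresh.simps)
  have "(\<Sum>fs\<in>lists (Suc (Suc l)). p ^ Suc (Suc l) * chain_weight fs * potential fs)
     = (\<Sum>(fs, f')\<in>(SIGMA fs:lists (Suc l). E \<inter> ext d fs). p ^ Suc (Suc l) * chain_weight (f' # fs) * potential (f' # fs))"
    unfolding lists_Suc[OF l1] sum.reindex[OF inj] by (intro sum.cong refl) (simp add: case_prod_beta)
  also have "\<dots> = (\<Sum>fs\<in>lists (Suc l). \<Sum>f'\<in>E \<inter> ext d fs. p ^ Suc (Suc l) * chain_weight (f' # fs) * potential (f' # fs))"
    using finite_lists finE by (subst sum.Sigma) auto
  also have "\<dots> = (\<Sum>fs\<in>lists (Suc l). p ^ Suc l * chain_weight fs * (\<Sum>f'\<in>E \<inter> ext d fs. p * ?fac fs * potential (f' # fs)))"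
  proof (intro sum.cong refl)
    fix fs assume "fs \<in> lists (Suc l)"
    then show "(\<Sum>f'\<in>E \<inter> ext d fs. p ^ Suc (Suc l) * chain_weight (f' # fs) * potential (f' # fs))
        = p ^ Suc l * chain_weight fs * (\<Sum>f'\<in>E \<inter> ext d fs. p * ?fac fs * potential (f' # fs))"
      unfolding sum_distrib_left by (intro sum.cong refl) (simp only: cw power_Suc mult_ac)
  qed
  also have "\<dots> \<le> (\<Sum>fs\<in>lists (Suc l). p ^ Suc l * chain_weight fs * (lam * potential fs))"
    using Suc.prems p01 chain_weight_nonneg
    by (intro sum_mono mult_left_mono ext_sum) (auto simp: lists_def)
  also have "\<dots> = lam * (\<Sum>fs\<in>lists (Suc l). p ^ Suc l * chain_weight fs * potential fs)"
    unfolding sum_distrib_left by (intro sum.cong refl) (simp only: mult_ac)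
  also have "\<dots> \<le> lam * (lam ^ l * (p * real n ^ (d + 1) * \<Omega>))"
    using Suc lam by (intro mult_left_mono) auto
  finally show ?case by (simp only: power_Suc mult.assoc)
qed

lemma drop_prob:
  "bprob E p (\<lambda>X. \<exists>\<theta> u. u \<notin> \<theta> \<and> insert u \<theta> \<in> X \<and> drops J X \<theta> u)
     \<le> 2 / \<zeta> ^ (d + 1) * (lam ^ m * (p * real n ^ (d + 1) * \<Omega>))"
proof -
  have "bprob E p (\<lambda>X. \<exists>\<theta> u. u \<notin> \<theta> \<and> insert u \<theta> \<in> X \<and> drops J X \<theta> u)
      \<le> (\<Sum>fs\<in>lists (Suc m). bprob E p (\<lambda>X. chain d K J X fs))"
  proof (rule bprob_union_bound[OF finite_lists])
    fix X assume X: "X \<subseteq> E" "\<exists>\<theta> u. u \<notin> \<theta> \<and> insert u \<theta> \<in> X \<and> drops J X \<theta> u"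
    then obtain \<theta> u where *: "u \<notin> \<theta>" "insert u \<theta> \<in> X" "drops J X \<theta> u" by blast
    have "card \<sigma> = d + 1" if "\<sigma> \<in> X" for \<sigma> using X(1) that k_subsetsD(1) by blast
    from drop_imp_chain[OF this *, of K m] J
    obtain fs where fs: "chain d K J X fs" "length fs = m + 1" by blast
    then have "fs \<in> lists (Suc m)" using chain_admissible[OF fs(1) X(1)] by (simp add: lists_def)
    then show "\<exists>fs\<in>lists (Suc m). chain d K J X fs" using fs(1) by blast
  qed
  also have "\<dots> \<le> (\<Sum>fs\<in>lists (Suc m). 2 / \<zeta> ^ (d + 1) * (p ^ Suc m * chain_weight fs * potential fs))"
  proof (rule sum_mono)
    fix fs assume fs: "fs \<in> lists (Suc m)"
    then have "bprob E p (\<lambda>X. chain d K J X fs) \<le> p ^ length fs * (2 / \<zeta> ^ (d + 1) * chain_weight fs)"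
      by (intro chain_prob) (auto simp: lists_def)
    also have "\<dots> = 2 / \<zeta> ^ (d + 1) * (p ^ Suc m * chain_weight fs * 1)"
      using fs by (simp add: lists_def)
    also have "\<dots> \<le> 2 / \<zeta> ^ (d + 1) * (p ^ Suc m * chain_weight fs * potential fs)"
      using \<zeta> p01 chain_weight_nonneg \<Omega> by (intro mult_left_mono mult_nonneg_nonneg) (auto simp: potential_def)
    finally show "bprob E p (\<lambda>X. chain d K J X fs) \<le> 2 / \<zeta> ^ (d + 1) * (p ^ Suc m * chain_weight fs * potential fs)" .
  qed
  also have "\<dots> \<le> 2 / \<zeta> ^ (d + 1) * (lam ^ m * (p * real n ^ (d + 1) * \<Omega>))"
    unfolding sum_distrib_left[symmetric] using total_bound[OF order_refl] \<zeta> by (intro mult_left_mono) auto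
  finally show ?thesis .
qed

text \<open>With overwhelming probability some vertex of a block beside a fixed facet is
  \<open>good\<close> at level \<open>Suc J\<close>. This does not make its own face present, but a
  partner alive at \<open>Suc J\<close> names a face of \<open>X\<close> that is \<open>good\<close>
  at level \<open>J\<close>; hence the extra round.\<close>

lemma no_good_prob:
  "bprob E p (\<lambda>X. \<not> (\<exists>\<theta> v. v \<notin> \<theta> \<and> insert v \<theta> \<in> X \<and> good J X \<theta> v)) \<le> err (Suc J)"
proof -
  have "0 < p * (real n - real (2 * b + d + d * H))" using c1 by linarith
  then have "real (2 * b + d + d * H) < real n" using ppos by (simp add: zero_less_mult_iff)
  then have n: "b + d \<le> n" by linarith
  define \<tau> where "\<tau> = {1..d}"
  define V where "V = {d<..d + b}"
  have \<tau>: "\<tau> \<in> F" using n by (auto simp: \<tau>_def k_subsets_def)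
  have V: "V \<subseteq> {1..n} - \<tau>" "card V = b" "\<forall>v\<in>V. usable {} \<tau> v"
    using n by (auto simp: V_def \<tau>_def usable_def)
  have "bprob E p (\<lambda>X. \<not> (\<exists>\<theta> v. v \<notin> \<theta> \<and> insert v \<theta> \<in> X \<and> good J X \<theta> v))
     \<le> bprob E p (\<lambda>X. real (card {v \<in> V. good (Suc J) (X - star {}) \<tau> v}) < y (Suc J) ^ d * real b)"
  proof (rule bprob_mono)
    fix X :: "nat set set" assume no: "\<not> (\<exists>\<theta> v. v \<notin> \<theta> \<and> insert v \<theta> \<in> X \<and> good J X \<theta> v)"
    have "\<not> good (Suc J) (X - star {}) \<tau> v" for v
    proof
      assume g: "good (Suc J) (X - star {}) \<tau> v"
      have "1 \<in> \<tau>" using d by (simp add: \<tau>_def)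
      then have "alive (Suc J) (X - star {}) (insert v \<tau> - {1}) 1" using g unfolding good_def by (rule bspec[rotated])
      then obtain x where "x \<notin> insert v \<tau> - {1}" "insert x (insert v \<tau> - {1}) \<in> X - star {}"
        "good J (X - star {}) (insert v \<tau> - {1}) x" unfolding alive_Suc by blast
      moreover have "X - star {} = X" by (simp add: star_def)
      ultimately show False using no by metis
    qed
    then have "{v \<in> V. good (Suc J) (X - star {}) \<tau> v} = {}" by blast
    moreover have "0 < y (Suc J) ^ d * real b" using ypos[of "Suc J"] b by simp
    ultimately show "real (card {v \<in> V. good (Suc J) (X - star {}) \<tau> v}) < y (Suc J) ^ d * real b"
      by (simp only: card.empty of_nat_0)
  qed
  also have "\<dots> \<le> err (Suc J)"
    using JH by (intro blocks[where m = 0] \<tau> V) (auto simp: spread_def)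
  finally show ?thesis .
qed

lemma collapsible_prob:
  "bprob E p (\<lambda>X. collapsible d (full_skeleton d n \<union> X))
     \<le> err (Suc J) + 2 / \<zeta> ^ (d + 1) * (lam ^ m * (p * real n ^ (d + 1) * \<Omega>))"
proof -
  have "bprob E p (\<lambda>X. collapsible d (full_skeleton d n \<union> X))
    \<le> bprob E p (\<lambda>X. \<not> (\<exists>\<theta> v. v \<notin> \<theta> \<and> insert v \<theta> \<in> X \<and> good J X \<theta> v))
      + bprob E p (\<lambda>X. \<exists>\<theta> u. u \<notin> \<theta> \<and> insert u \<theta> \<in> X \<and> drops J X \<theta> u)"
  proof (rule bprob_disj, rule ccontr)
    fix X assume X: "X \<subseteq> E" "collapsible d (full_skeleton d n \<union> X)"
    assume "\<not> ((\<not> (\<exists>\<theta> v. v \<notin> \<theta> \<and> insert v \<theta> \<in> X \<and> good J X \<theta> v)) \<or>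
       (\<exists>\<theta> u. u \<notin> \<theta> \<and> insert u \<theta> \<in> X \<and> drops J X \<theta> u))"
    then obtain \<theta> v where g: "v \<notin> \<theta>" "insert v \<theta> \<in> X" "good J X \<theta> v"
      and nd: "\<And>\<theta> u. u \<notin> \<theta> \<Longrightarrow> insert u \<theta> \<in> X \<Longrightarrow> \<not> drops J X \<theta> u" by blast
    have Y: "{\<sigma> \<in> full_skeleton d n \<union> X. card \<sigma> = d + 1} = X"
      using X(1) k_subsetsD(1) by (auto simp: full_skeleton_def)
    have "\<not> collapsible d (full_skeleton d n \<union> X)"
    proof (rule not_collapsible_if_stable[where J = J and v = v and \<theta> = \<theta>, OF d])
      show "alive (Suc J) {\<sigma> \<in> full_skeleton d n \<union> X. card \<sigma> = d + 1} \<eta> u"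
        if "u \<notin> \<eta>" "insert u \<eta> \<in> {\<sigma> \<in> full_skeleton d n \<union> X. card \<sigma> = d + 1}"
          "alive J {\<sigma> \<in> full_skeleton d n \<union> X. card \<sigma> = d + 1} \<eta> u" for \<eta> u
        using nd that unfolding Y by blast
    qed (simp_all only: Y g not_False_eq_True)
    then show False using X(2) by blast
  qed
  then show ?thesis using no_good_prob drop_prob by linarith
qed

end

section \<open>The fixed point and the choice of constants\<close>

text \<open>The derivative of \<open>threshold_fun d\<close> at \<open>x\<close> is negative exactly
  when this ratio exceeds \<open>1 / d\<close>, so monotonicity carries a nonpositive derivative
  from \<open>t\<close> to every smaller \<open>x\<close>.\<close>

lemma neg_ln_ratio_antimono:
  fixes x t :: real
  assumes "0 < x" "x \<le> t" "t < 1"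
  shows "(1 - t) * (- ln (1 - t)) / t \<le> (1 - x) * (- ln (1 - x)) / x"
proof (rule DERIV_nonpos_imp_nonincreasing[OF assms(2)])
  fix u assume u: "x \<le> u" "u \<le> t"
  then have u01: "0 < u" "u < 1" using assms by auto
  have "((\<lambda>x. (1 - x) * (- ln (1 - x)) / x) has_real_derivative (ln (1 - u) + u) / u\<^sup>2) (at u)"
    using u01 by (auto intro!: derivative_eq_intros simp: field_simps power2_eq_square)
  moreover have "(ln (1 - u) + u) / u\<^sup>2 \<le> 0"
    using ln_le_minus_one[of "1 - u"] u01 by (intro divide_nonpos_nonneg) auto
  ultimately show "\<exists>D. ((\<lambda>x. (1 - x) * (- ln (1 - x)) / x) has_real_derivative D) (at u) \<and> D \<le> 0"
    by blast
qed

lemma threshold_fun_deriv: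
  assumes "0 < x" "x < 1"
  shows "(threshold_fun d has_real_derivative
    (x - real d * ((1 - x) * (- ln (1 - x)))) / ((1 - x) * x ^ (d + 1))) (at x)"
proof -
  have "(threshold_fun d has_real_derivative
      ((1 / (1 - x)) * x ^ d - (- ln (1 - x)) * (real d * x ^ (d - 1))) / (x ^ d * x ^ d)) (at x)"
    unfolding threshold_fun_def[abs_def] using assms
    by (auto intro!: derivative_eq_intros simp: diff_divide_distrib add_divide_distrib)
  also have "((1 / (1 - x)) * x ^ d - (- ln (1 - x)) * (real d * x ^ (d - 1))) / (x ^ d * x ^ d)
    = (x - real d * ((1 - x) * (- ln (1 - x)))) / ((1 - x) * x ^ (d + 1))"
    using assms by (cases d) (auto simp: field_simps)
  finally show ?thesis .
qed

text \<open>The iteration decreases from \<open>1\<close> and stays above a minimizer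
  \<open>s\<close> of \<open>threshold_fun d\<close>, where \<open>s < f s\<close>; so it converges
  to a fixed point \<open>t \<ge> s\<close>. A derivative of at least \<open>1\<close> at
  \<open>t\<close> would make \<open>threshold_fun d\<close> nonincreasing on \<open>{s..t}\<close>,
  hence \<open>c = threshold_fun d t \<le> c_crit d\<close>.\<close>

lemma upper_fixed_point:
  fixes c :: real
  assumes d: "d \<ge> 2" and c: "c > c_crit d"
  defines "f \<equiv> \<lambda>x. 1 - exp (- c * x ^ d)"
  obtains t where "0 < c" "0 < t" "t < 1" "f t = t" "(\<lambda>k. (f ^^ k) 1) \<longlonglongrightarrow> t"
    "real d * c * t ^ (d - 1) * exp (- c * t ^ d) < 1"
proof -
  obtain s where s: "0 < s" "s < 1" "c_crit d = threshold_fun d s"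
    using c_crit_is_min(1)[OF d] by auto
  have "ln (1 - s) < 0" using s by simp
  then have "0 < threshold_fun d s" using s unfolding threshold_fun_def by (intro divide_pos_pos) auto
  then have c0: "0 < c" using c s by linarith
  have mono: "f x \<le> f x'" if "0 \<le> x" "x \<le> x'" for x x'
    using that c0 by (auto simp: f_def power_mono)
  have fs: "s < f s"
  proof -
    have "- ln (1 - s) < c * s ^ d" using c s by (simp add: threshold_fun_def field_simps)
    then have "exp (- c * s ^ d) < exp (ln (1 - s))" by simp
    then show ?thesis using s by (simp add: f_def)
  qed
  define a where "a k = (f ^^ k) 1" for k
  have a_Suc: "a (Suc k) = f (a k)" for k by (simp add: a_def)
  have lb: "s \<le> a k" for k
  proof (induction k)
    case (Suc k)
    then show ?case using mono[of s "a k"] fs s by (simp add: a_Suc)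
  qed (use s in \<open>simp add: a_def\<close>)
  have dec: "a (Suc k) \<le> a k" for k
  proof (induction k)
    case 0
    then show ?case by (simp add: a_def f_def)
  next
    case (Suc k)
    have "0 \<le> a (Suc k)" using lb[of "Suc k"] s by linarith
    then show ?case using mono[OF _ Suc.IH] by (simp add: a_Suc)
  qed
  then have "decseq a" by (simp add: decseq_Suc_iff)
  then obtain t where t: "a \<longlonglongrightarrow> t" "\<And>k. t \<le> a k"
    using decseq_convergent[of a s] lb by blast
  have st: "s \<le> t" using t(1) lb by (intro LIMSEQ_le_const[of a]) auto
  have "(\<lambda>k. f (a k)) \<longlonglongrightarrow> f t" unfolding f_def by (intro tendsto_intros t(1))
  moreover have "(\<lambda>k. f (a k)) \<longlonglongrightarrow> t" using LIMSEQ_Suc[OF t(1)] by (simp add: a_Suc)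
  ultimately have ft: "f t = t" using LIMSEQ_unique by blast
  have t01: "0 < t" "t < 1"
    using st s(1) ft exp_gt_zero[of "- c * t ^ d"] unfolding f_def by linarith+
  have e: "exp (- c * t ^ d) = 1 - t" using ft by (simp add: f_def)
  then have ct: "c * t ^ d = - ln (1 - t)" by (metis ln_exp minus_mult_left minus_minus)
  have "real d * c * t ^ (d - 1) * exp (- c * t ^ d) < 1"
  proof (rule ccontr)
    assume "\<not> ?thesis"
    then have ge: "1 \<le> real d * c * t ^ (d - 1) * (1 - t)" unfolding e by linarith
    have "t ^ d = t * t ^ (d - 1)" using d by (cases d) auto
    then have "t * 1 \<le> t * (real d * c * t ^ (d - 1) * (1 - t))" using ge t01 by (intro mult_left_mono) auto
    also have "\<dots> = real d * (1 - t) * (c * t ^ d)" using \<open>t ^ d = t * t ^ (d - 1)\<close> by simp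
    \<comment> \<open>The identity \<open>c * t ^ d = - ln (1 - t)\<close> eliminates
      \<open>c\<close>; in this form the condition passes from \<open>t\<close> to all smaller
      arguments.\<close>
    finally have gt: "1 \<le> real d * ((1 - t) * (- ln (1 - t)) / t)"
      using t01 by (simp add: ct field_simps)
    have "threshold_fun d t \<le> threshold_fun d s"
    proof (rule DERIV_nonpos_imp_nonincreasing[OF st])
      fix x assume x: "s \<le> x" "x \<le> t"
      then have x01: "0 < x" "x < 1" using s t01 by auto
      have "1 \<le> real d * ((1 - x) * (- ln (1 - x)) / x)"
        using gt mult_left_mono[OF neg_ln_ratio_antimono[OF x01(1) x(2) t01(2)], of "real d"] by linarith
      then have "x \<le> real d * ((1 - x) * (- ln (1 - x)))" using x01 by (simp add: field_simps)
      then have "(x - real d * ((1 - x) * (- ln (1 - x)))) / ((1 - x) * x ^ (d + 1)) \<le> 0"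
        using x01 by (intro divide_nonpos_nonneg) auto
      then show "\<exists>D. (threshold_fun d has_real_derivative D) (at x) \<and> D \<le> 0"
        using threshold_fun_deriv[OF x01] by blast
    qed
    moreover have "threshold_fun d t = c" using ct t01 by (simp add: threshold_fun_def field_simps)
    ultimately show False using c s by linarith
  qed
  then show thesis using that[of t] c0 t01 ft t(1) by (simp add: a_def[abs_def])
qed

section \<open>Recursions with slack\<close>

primrec lower_seq :: "nat \<Rightarrow> real \<Rightarrow> nat \<Rightarrow> real" where
  "lower_seq d c 0 = 1"
| "lower_seq d c (Suc k) = 1 - exp (- c * lower_seq d c k ^ d)"

text \<open>The recursion of \<open>z\<close> in \<open>upper_run\<close> with equality:
  \<open>1 + \<eta>\<close> stands for the block and discretization loss
  \<open>exp (p * (b + 1))\<close>, the added \<open>\<eta>\<close> for the concentration error and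
  the explored vertices. At \<open>\<eta> = 0\<close> the quotient cancels and both sequences are
  iterates of the same map.\<close>

primrec upper_seq :: "nat \<Rightarrow> real \<Rightarrow> real \<Rightarrow> nat \<Rightarrow> real" where
  "upper_seq d c \<eta> 0 = 1"
| "upper_seq d c \<eta> (Suc k) = upper_seq d c \<eta> k ^ d *
     ((1 + \<eta>) * (1 - exp (- c * lower_seq d (c - 2 * \<eta>) k ^ d)) / lower_seq d (c - 2 * \<eta>) k ^ d) + \<eta>"

lemma lower_seq_iterate: "lower_seq d c k = ((\<lambda>x. 1 - exp (- c * x ^ d)) ^^ k) 1"
  by (induction k) auto

lemma lower_seq_bounds:
  assumes "0 < c" "0 < x" "x \<le> 1" "x \<le> 1 - exp (- c * x ^ d)"
  shows "x \<le> lower_seq d c k" "lower_seq d c k \<le> 1"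
proof -
  show "x \<le> lower_seq d c k"
  proof (induction k)
    case (Suc k)
    then have "c * x ^ d \<le> c * lower_seq d c k ^ d" using assms by (intro mult_left_mono power_mono) auto
    then have "exp (- c * lower_seq d c k ^ d) \<le> exp (- c * x ^ d)" by simp
    then show ?case unfolding lower_seq.simps using assms(4) by linarith
  qed (use assms in simp)
  show "lower_seq d c k \<le> 1" by (cases k) auto
qed

text \<open>First \<open>x\<close> slightly below the fixed point, then \<open>K\<close>, then \<open>\<eta>\<close>.\<close>

lemma constants:
  fixes c :: real
  assumes d: "d \<ge> 2" and c: "c > c_crit d"
  obtains \<eta> x K where "0 < \<eta>" "\<eta> \<le> 1" "0 < c - 2 * \<eta>" "0 < x" "x < 1"
    "x \<le> 1 - exp (- (c - 2 * \<eta>) * x ^ d)"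
    "upper_seq d c \<eta> K \<le> 1"
    "real d * c * upper_seq d c \<eta> K ^ (d - 1) * exp (- (c - \<eta>) * x ^ d) < 1"
proof -
  obtain t where c0: "0 < c" and t: "0 < t" "t < 1" "1 - exp (- c * t ^ d) = t"
    and lim: "(\<lambda>k. ((\<lambda>x. 1 - exp (- c * x ^ d)) ^^ k) 1) \<longlonglongrightarrow> t"
    and \<rho>: "real d * c * t ^ (d - 1) * exp (- c * t ^ d) < 1"
    using upper_fixed_point[OF assms] by metis
  have lim': "(\<lambda>k. lower_seq d c k) \<longlonglongrightarrow> t" using lim by (simp add: lower_seq_iterate)
  \<comment> \<open>The slope of \<open>g\<close> at \<open>t\<close> is negative, so points
    slightly below \<open>t\<close> satisfy \<open>x < 1 - exp (- c * x ^ d)\<close>. Such an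
    \<open>x\<close> bounds \<open>lower_seq\<close> from below for every number of rounds, and the
    strict inequality survives a small \<open>\<eta>\<close>.\<close>
  define g where "g x = 1 - exp (- c * x ^ d) - x" for x
  have "(g has_real_derivative (exp (- c * t ^ d) * (c * (real d * t ^ (d - 1))) - 1)) (at t)"
    unfolding g_def by (auto intro!: derivative_eq_intros)
  moreover have "exp (- c * t ^ d) * (c * (real d * t ^ (d - 1))) - 1 < 0" using \<rho> by (simp add: mult_ac)
  ultimately obtain \<delta> where \<delta>: "0 < \<delta>" "\<And>h. 0 < h \<Longrightarrow> h < \<delta> \<Longrightarrow> g t < g (t - h)"
    using DERIV_neg_dec_left by blast
  have gt: "g t = 0" using t by (simp add: g_def)
  have "((\<lambda>x. real d * c * t ^ (d - 1) * exp (- c * x ^ d)) \<longlongrightarrow> real d * c * t ^ (d - 1) * exp (- c * t ^ d)) (at_left t)"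
    by (intro tendsto_intros)
  then have "\<forall>\<^sub>F x in at_left t. real d * c * t ^ (d - 1) * exp (- c * x ^ d) < 1"
    using \<rho> by (rule order_tendstoD)
  moreover have "\<forall>\<^sub>F x in at_left t. max (t - \<delta>) 0 < x \<and> x < t"
    using t \<delta> by (intro eventually_at_leftI[of "max (t - \<delta>) 0"]) auto
  ultimately have "\<forall>\<^sub>F x in at_left t. real d * c * t ^ (d - 1) * exp (- c * x ^ d) < 1 \<and> max (t - \<delta>) 0 < x \<and> x < t"
    by (rule eventually_conj)
  from eventually_happens'[OF trivial_limit_at_left_real this]
  obtain x where x: "real d * c * t ^ (d - 1) * exp (- c * x ^ d) < 1" "t - \<delta> < x" "0 < x" "x < t"
    by auto
  have gx: "x < 1 - exp (- c * x ^ d)"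
    using \<delta>(2)[of "t - x"] x gt by (simp add: g_def)
  have "(\<lambda>k. real d * c * lower_seq d c k ^ (d - 1) * exp (- c * x ^ d)) \<longlonglongrightarrow> real d * c * t ^ (d - 1) * exp (- c * x ^ d)"
    by (intro tendsto_intros lim')
  then have "\<forall>\<^sub>F k in sequentially. real d * c * lower_seq d c k ^ (d - 1) * exp (- c * x ^ d) < 1"
    using x(1) by (rule order_tendstoD)
  moreover have "\<forall>\<^sub>F k in sequentially. lower_seq d c k < 1" using lim' t(2) by (rule order_tendstoD)
  ultimately have "\<forall>\<^sub>F k in sequentially. real d * c * lower_seq d c k ^ (d - 1) * exp (- c * x ^ d) < 1 \<and> lower_seq d c k < 1"
    by (rule eventually_conj)
  from eventually_happens'[OF sequentially_bot this] obtain K where K: "real d * c * lower_seq d c K ^ (d - 1) * exp (- c * x ^ d) < 1" "lower_seq d c K < 1"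
    by auto
  have pos: "0 < lower_seq d c k" for k
    using lower_seq_bounds(1)[of c x d k] c0 x t gx by simp
  have eta: "((\<lambda>\<eta>::real. \<eta>) \<longlongrightarrow> 0) (at_right 0)" by (rule tendsto_ident_at)
  have eta2: "((\<lambda>\<eta>. c - 2 * \<eta>) \<longlongrightarrow> c) (at_right 0)" by (auto intro!: tendsto_eq_intros)
  have ltend: "((\<lambda>\<eta>. lower_seq d (c - 2 * \<eta>) k) \<longlongrightarrow> lower_seq d c k) (at_right 0)" for k
  proof (induction k)
    case (Suc k)
    then show ?case unfolding lower_seq.simps by (intro tendsto_intros eta2)
  qed simp
  have utend: "((\<lambda>\<eta>. upper_seq d c \<eta> k) \<longlongrightarrow> lower_seq d c k) (at_right 0)" for k
  proof (induction k)
    case (Suc k)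
    have "((\<lambda>\<eta>. upper_seq d c \<eta> (Suc k)) \<longlongrightarrow> lower_seq d c k ^ d *
        ((1 + 0) * (1 - exp (- c * lower_seq d c k ^ d)) / lower_seq d c k ^ d) + 0) (at_right 0)"
      unfolding upper_seq.simps using pos[of k] by (intro tendsto_intros eta eta2 ltend Suc.IH) auto
    then show ?case using pos[of k] by simp
  qed simp
  have "\<forall>\<^sub>F \<eta> in at_right 0. 0 < c - 2 * \<eta>" using eta2 c0 by (rule order_tendstoD)
  moreover have "\<forall>\<^sub>F \<eta> in at_right 0. x < 1 - exp (- (c - 2 * \<eta>) * x ^ d)"
  proof (rule order_tendstoD(1)[OF _ gx])
    show "((\<lambda>\<eta>. 1 - exp (- (c - 2 * \<eta>) * x ^ d)) \<longlongrightarrow> 1 - exp (- c * x ^ d)) (at_right 0)"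
      by (intro tendsto_intros eta2)
  qed
  moreover have "\<forall>\<^sub>F \<eta> in at_right 0. upper_seq d c \<eta> K < 1" using utend K(2) by (rule order_tendstoD)
  moreover have "\<forall>\<^sub>F \<eta> in at_right 0. real d * c * upper_seq d c \<eta> K ^ (d - 1) * exp (- (c - \<eta>) * x ^ d) < 1"
  proof (rule order_tendstoD(2)[OF _ K(1)])
    have "((\<lambda>\<eta>. c - \<eta>) \<longlongrightarrow> c) (at_right 0)" by (auto intro!: tendsto_eq_intros)
    then show "((\<lambda>\<eta>. real d * c * upper_seq d c \<eta> K ^ (d - 1) * exp (- (c - \<eta>) * x ^ d)) \<longlongrightarrow>
        real d * c * lower_seq d c K ^ (d - 1) * exp (- c * x ^ d)) (at_right 0)"
      by (intro tendsto_intros utend)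
  qed
  moreover have "\<forall>\<^sub>F \<eta>::real in at_right 0. 0 < \<eta> \<and> \<eta> < 1" by (intro eventually_at_rightI[of 0 1]) auto
  ultimately have "\<forall>\<^sub>F \<eta> in at_right 0. 0 < c - 2 * \<eta> \<and> x < 1 - exp (- (c - 2 * \<eta>) * x ^ d) \<and>
     upper_seq d c \<eta> K < 1 \<and> real d * c * upper_seq d c \<eta> K ^ (d - 1) * exp (- (c - \<eta>) * x ^ d) < 1 \<and> 0 < \<eta> \<and> \<eta> < 1"
    by eventually_elim auto
  from eventually_happens'[OF trivial_limit_at_right_real this] obtain \<eta> where "0 < c - 2 * \<eta>" "x < 1 - exp (- (c - 2 * \<eta>) * x ^ d)"
     "upper_seq d c \<eta> K < 1" "real d * c * upper_seq d c \<eta> K ^ (d - 1) * exp (- (c - \<eta>) * x ^ d) < 1" "0 < \<eta>" "\<eta> < 1"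
    by auto
  then show thesis using x t by (intro that[of \<eta> x K]) auto
qed

lemma upper_seq_ge:
  assumes "0 < \<eta>" "\<eta> \<le> 1" "0 < c" and y: "\<And>k. 0 < lower_seq d (c - 2 * \<eta>) k"
  shows "\<eta> \<le> upper_seq d c \<eta> k"
proof (induction k)
  case (Suc k)
  have "0 \<le> c * lower_seq d (c - 2 * \<eta>) k ^ d"
    using y[of k] assms(3) by (intro mult_nonneg_nonneg zero_le_power) auto
  then have "0 \<le> (1 + \<eta>) * (1 - exp (- c * lower_seq d (c - 2 * \<eta>) k ^ d)) / lower_seq d (c - 2 * \<eta>) k ^ d"
    using y[of k] assms(1) by (intro divide_nonneg_pos mult_nonneg_nonneg) auto
  moreover have "0 \<le> upper_seq d c \<eta> k ^ d" using Suc assms by simp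
  ultimately show ?case unfolding upper_seq.simps by (simp only: le_add_same_cancel2 mult_nonneg_nonneg)
qed (use assms in simp)

lemma power_superadditive:
  fixes a b :: real
  assumes "0 \<le> a" "0 \<le> b" "d \<ge> 1"
  shows "a ^ d + b ^ d \<le> (a + b) ^ d"
  using assms(3)
proof (induction d rule: dec_induct)
  case (step d)
  have "a ^ Suc d + b ^ Suc d \<le> (a ^ d + b ^ d) * (a + b)"
    using assms by (simp add: algebra_simps)
  also have "\<dots> \<le> (a + b) ^ d * (a + b)" using step.IH assms by (intro mult_right_mono) auto
  finally show ?case by (simp add: mult.commute)
qed simp

text \<open>\<open>lower_seq\<close> runs with \<open>c - 2 * \<eta>\<close> while the rounds
  achieve \<open>c - \<eta>\<close>; the two exponentials differ by at least
  \<open>\<delta>\<close>, uniformly because of the floor \<open>x\<close>. Superadditivity of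
  powers turns this into the slack \<open>\<delta> ^ d\<close>.\<close>

lemma lower_seq_gap:
  assumes "0 < \<eta>" "0 < c - 2 * \<eta>" "0 < x" "\<And>k. x \<le> lower_seq d (c - 2 * \<eta>) k"
    "\<And>k. lower_seq d (c - 2 * \<eta>) k \<le> 1" "d \<ge> 1"
  defines "\<gamma> \<equiv> (exp (- (c - \<eta>)) * (exp (\<eta> * x ^ d) - 1)) ^ d"
  shows "0 < \<gamma>"
    and "lower_seq d (c - 2 * \<eta>) (Suc j) ^ d + \<gamma> \<le> (1 - exp (- (c - \<eta>) * lower_seq d (c - 2 * \<eta>) j ^ d)) ^ d"
proof -
  define \<delta> where "\<delta> = exp (- (c - \<eta>)) * (exp (\<eta> * x ^ d) - 1)"
  have \<delta>: "0 < \<delta>" using assms(1,3) by (simp add: \<delta>_def)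
  then show "0 < \<gamma>" by (simp add: \<gamma>_def \<delta>_def)
  define w where "w = lower_seq d (c - 2 * \<eta>) j ^ d"
  have w: "x ^ d \<le> w" "w \<le> 1" "0 \<le> w"
    using assms(3) assms(4)[of j] assms(5)[of j] unfolding w_def
    by (auto intro!: power_mono power_le_one zero_le_power intro: order_trans[of 0 x])
  have "exp (- (c - 2 * \<eta>) * w) - exp (- (c - \<eta>) * w) = exp (- (c - \<eta>) * w) * (exp (\<eta> * w) - 1)"
    by (simp add: exp_add[symmetric] right_diff_distrib) (simp add: algebra_simps)
  also have "\<dots> \<ge> \<delta>"
    unfolding \<delta>_def
  proof (intro mult_mono)
    have "(c - \<eta>) * w \<le> (c - \<eta>) * 1" using w assms(1,2) by (intro mult_left_mono) auto
    then show "exp (- (c - \<eta>)) \<le> exp (- (c - \<eta>) * w)"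
      by (simp only: exp_le_cancel_iff mult_minus_left neg_le_iff_le mult_1_right)
    show "exp (\<eta> * x ^ d) - 1 \<le> exp (\<eta> * w) - 1" using w assms(1) by simp
  qed (use assms(1,3) in auto)
  finally have le: "lower_seq d (c - 2 * \<eta>) (Suc j) + \<delta> \<le> 1 - exp (- (c - \<eta>) * w)"
    by (simp add: w_def)
  have nn: "0 \<le> lower_seq d (c - 2 * \<eta>) (Suc j)" using assms(3) assms(4)[of "Suc j"] by linarith
  have "lower_seq d (c - 2 * \<eta>) (Suc j) ^ d + \<delta> ^ d \<le> (lower_seq d (c - 2 * \<eta>) (Suc j) + \<delta>) ^ d"
    using nn \<delta> assms(6) by (intro power_superadditive) auto
  also have "\<dots> \<le> (1 - exp (- (c - \<eta>) * w)) ^ d" using le nn \<delta> by (intro power_mono) auto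
  finally show "lower_seq d (c - 2 * \<eta>) (Suc j) ^ d + \<gamma> \<le> (1 - exp (- (c - \<eta>) * lower_seq d (c - 2 * \<eta>) j ^ d)) ^ d"
    by (simp add: \<gamma>_def \<delta>_def w_def)
qed

lemma (in lower_run) err_le: "err j \<le> (1 + real (d * b * n)) ^ j * exp (- (\<gamma>\<^sup>2 / 2) * b)"
proof (induction j)
  case (Suc j)
  let ?e = "exp (- (\<gamma>\<^sup>2 / 2) * b)" and ?a = "real (d * b * n)"
  have "err (Suc j) \<le> ?a * ((1 + ?a) ^ j * ?e) + 1 * ?e"
    using Suc.IH by (simp add: mult_left_mono)
  also have "\<dots> \<le> ?a * ((1 + ?a) ^ j * ?e) + (1 + ?a) ^ j * ?e"
    by (intro add_left_mono mult_right_mono one_le_power) auto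
  also have "\<dots> = (1 + ?a) ^ Suc j * ?e" by (simp add: algebra_simps)
  finally show ?case .
qed simp

text \<open>Here \<open>n\<close> is about \<open>r ^ 8\<close>, the chains have length \<open>r\<close>, and blocks and the penalty of
  non-fresh faces have size \<open>r ^ 4\<close>.\<close>

lemma collapsible_prob_bound:
  fixes d n r K :: nat and c \<eta> x lam Z \<kappa> :: real
  assumes d: "d \<ge> 1" and \<eta>: "0 < \<eta>" "\<eta> \<le> 1" "0 < c - 2 * \<eta>"
    and x: "0 < x" "x < 1" "x \<le> 1 - exp (- (c - 2 * \<eta>) * x ^ d)"
    and zK: "upper_seq d c \<eta> K \<le> 1" and Z: "\<And>k. k < K \<Longrightarrow> upper_seq d c \<eta> k ^ d \<le> Z" "0 \<le> Z"
    and lam: "0 \<le> lam" and \<kappa>: "\<kappa> = ((exp (- (c - \<eta>)) * (exp (\<eta> * x ^ d) - 1)) ^ d)\<^sup>2 / 2"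
    and rn: "r ^ 8 \<le> n" "n \<le> (r + 1) ^ 8" and r: "r \<ge> 1" "c \<le> real r ^ 8"
    and A2: "c * (2 * real r ^ 4 + real d + real d * ((real r + 1) + (real K + (real d + 1) * real r + 1) * (real r ^ 4 + real d))) / real r ^ 8 \<le> \<eta>"
    and A3: "c * (real r ^ 4 + 1) / real r ^ 8 \<le> ln (1 + \<eta>)"
    and A4: "Z * (c * exp (real r) * exp (real r * (real K + (real d + 1) * real r + 1) - \<kappa> * real r ^ 4))
       + (real d + 1) * (real r + 1) * (1 + (real d + 1) ^ K) * (c / real r ^ 8) / \<eta> ^ (d + 1) \<le> \<eta>"
    and A5: "(d + 1) * (r + 1) \<le> r ^ 4"
    and A6: "1 + real d * real r ^ 4 * (real r + 1) ^ 8 \<le> exp (real r)" "(real r + 1) ^ 8 \<le> exp (real r)" "real r + 1 \<le> exp (real r)"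
    and A7: "2 * real r + real r * (real K + (real d + 1) * real r + 1) + c * (real r + 1) \<le> \<kappa> * real r ^ 4"
    and A8: "upper_seq d c \<eta> K ^ (d - 1) * exp (- (c - \<eta>) * x ^ d) * (real d * c + real d * (real d + 1) * (real r + 1) * (c / real r ^ 4)) \<le> lam"
    and A9: "1 / \<eta> ^ (d + 2) * ((real d + 1) * (real r + 1) * (c + (real d + 1) * (real r + 1) * (c / real r ^ 4))) \<le> lam * real r ^ 4"
  shows "measure_pmf.prob (random_complex d n (c / real n)) {X. collapsible d X}
    \<le> exp (real r * (real K + (real d + 1) * real r + 1) - \<kappa> * real r ^ 4)
      + 2 / \<eta> ^ (d + 1) * (lam ^ r * (c * (real r + 1) ^ (8 * d) * real r ^ 4))"
proof -
  define p where "p = c / real n"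
  define b where "b = r ^ 4"
  \<comment> \<open>The least level at which \<open>drop_imp_chain\<close> yields a chain of
    \<open>r + 1\<close> faces.\<close>
  define J where "J = K + (d + 1) * r"
  \<comment> \<open>Spread budget: \<open>r + 1\<close> for the exits of a chain, then
    \<open>b + d\<close> for each of \<open>J + 1\<close> rounds, the last of which serves
    \<open>no_good_prob\<close>.\<close>
  define H where "H = (r + 1) + (J + 1) * (b + d)"
  \<comment> \<open>At most \<open>(d + 1) * (r + 1)\<close> chain vertices and as many sides, each
    of size \<open>(d + 1) ^ K\<close>.\<close>
  define h where "h = (d + 1) * (r + 1) * (1 + (d + 1) ^ K)"
  define y where "y = lower_seq d (c - 2 * \<eta>)"
  define z where "z = upper_seq d c \<eta>"
  define \<gamma> where "\<gamma> = (exp (- (c - \<eta>)) * (exp (\<eta> * x ^ d) - 1)) ^ d"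
  define T where "T = exp (real r * (real K + (real d + 1) * real r + 1) - \<kappa> * real r ^ 4)"
  have c0: "0 < c" using \<eta> by linarith
  have r8: "0 < real r ^ 8" "0 < real r ^ 4" using r by auto
  have nr: "real r ^ 8 \<le> real n" "real n \<le> (real r + 1) ^ 8"
    using rn by (metis of_nat_le_iff of_nat_power, metis of_nat_le_iff of_nat_power of_nat_add of_nat_1)
  have n0: "0 < real n" using nr r8 by linarith
  have p: "0 < p" "p \<le> 1" "p * real n = c" "p \<le> c / real r ^ 8"
  proof -
    show "0 < p" "p * real n = c" using c0 n0 by (auto simp: p_def)
    have "c \<le> real n" using r(2) nr(1) by linarith
    then show "p \<le> 1" using n0 by (simp add: p_def)
    show "p \<le> c / real r ^ 8" unfolding p_def
      by (intro divide_left_mono mult_pos_pos) (use c0 n0 nr(1) r8(1) in linarith)+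
  qed
  have pb: "p * real r ^ 4 \<le> c / real r ^ 4"
  proof -
    have "p * real r ^ 4 \<le> c / real r ^ 8 * real r ^ 4" using p r8 by (intro mult_right_mono) auto
    also have "\<dots> = c / real r ^ 4" using r8 by (simp add: field_simps power_add[symmetric])
    finally show ?thesis .
  qed
  have yb: "x \<le> y k" "y k \<le> 1" for k
    using lower_seq_bounds[of "c - 2 * \<eta>" x d k] \<eta> x by (auto simp: y_def)
  have ypos: "0 < y k" for k using yb(1)[of k] x by linarith
  have gap: "0 < \<gamma>" "y (Suc j) ^ d + \<gamma> \<le> (1 - exp (- (c - \<eta>) * y j ^ d)) ^ d" for j
    using lower_seq_gap(1)[of \<eta> c x d] lower_seq_gap(2)[of \<eta> c x d j] \<eta> x yb d unfolding y_def \<gamma>_def by auto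
  have \<kappa>\<gamma>: "\<kappa> = \<gamma>\<^sup>2 / 2" by (simp add: \<kappa> \<gamma>_def)
  have Hr: "real H = (real r + 1) + (real K + (real d + 1) * real r + 1) * (real r ^ 4 + real d)"
    by (simp add: H_def J_def b_def algebra_simps)
  interpret lower_run p d n b H y "c - \<eta>" \<gamma>
  proof
    show "1 \<le> b" using r by (simp add: b_def)
    show "0 < c - \<eta>" using \<eta> by linarith
    have "p * real (2 * b + d + d * H) \<le> c / real r ^ 8 * real (2 * b + d + d * H)"
      using p by (intro mult_right_mono) auto
    also have "\<dots> \<le> \<eta>" using A2 by (simp add: Hr b_def)
    finally show "c - \<eta> \<le> p * (real n - real (2 * b + d + d * H))"
      using p(3) by (simp only: right_diff_distrib)
    show "0 \<le> y j" for j using ypos[of j] by simp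
  qed (use p d yb gap in auto)
  \<comment> \<open>A round multiplies the error by a polynomial in \<open>r\<close>, crudely by
    \<open>exp r\<close>. About \<open>(d + 1) * r\<close> rounds thus cost \<open>exp\<close> of a
    quadratic in \<open>r\<close>, which the block exponent \<open>\<kappa> * r ^ 4\<close>
    outweighs.\<close>
  have erT: "err j \<le> T" if j: "j \<le> J + 1" for j
  proof -
    have "real (d * b * n) \<le> real d * real r ^ 4 * (real r + 1) ^ 8"
      using nr(2) by (simp add: b_def mult_left_mono)
    then have "1 + real (d * b * n) \<le> exp (real r)" using A6(1) by linarith
    then have "(1 + real (d * b * n)) ^ j \<le> exp (real r) ^ j" by (intro power_mono) auto
    also have "\<dots> \<le> exp (real r) ^ (J + 1)" using j by (intro power_increasing) auto
    also have "\<dots> = exp (real r * (real K + (real d + 1) * real r + 1))"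
    proof -
      have "real (J + 1) * real r = real r * (real K + (real d + 1) * real r + 1)"
        by (simp add: J_def algebra_simps)
      then show ?thesis by (simp only: exp_of_nat_mult[symmetric])
    qed
    finally have "(1 + real (d * b * n)) ^ j * exp (- (\<gamma>\<^sup>2 / 2) * b)
        \<le> exp (real r * (real K + (real d + 1) * real r + 1)) * exp (- (\<gamma>\<^sup>2 / 2) * b)"
      by (intro mult_right_mono) auto
    also have "\<dots> = T" by (simp add: T_def \<kappa>\<gamma> b_def exp_add[symmetric])
    finally show ?thesis using err_le[of j] by linarith
  qed
  have nT: "real n * T \<le> exp (real r) * T" using nr(2) A6(2) by (intro mult_right_mono) (auto simp: T_def)
  have upr: "\<eta> \<le> z k" for k
    unfolding z_def using upper_seq_ge[of \<eta> c d k] \<eta> c0 ypos by (simp add: y_def)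
  have zn: "0 \<le> z k" for k using upr[of k] \<eta> by linarith
  interpret upper_run p d n b H y "c - \<eta>" \<gamma> K h z \<eta>
  proof
    show "1 + K * (b + d) \<le> H"
    proof -
      have "K * (b + d) \<le> (J + 1) * (b + d)" by (intro mult_le_mono1) (simp add: J_def)
      then show ?thesis by (simp add: H_def)
    qed
    fix k assume k: "k < K"
    let ?q = "(1 - exp (- (p * real n) * y k ^ d)) / y k ^ d"
    have "p * (real b + 1) \<le> c / real r ^ 8 * (real r ^ 4 + 1)"
      using p(4) unfolding b_def of_nat_power by (intro mult_right_mono) auto
    also have "\<dots> \<le> ln (1 + \<eta>)" using A3 by simp
    finally have "exp (p * (real b + 1)) \<le> exp (ln (1 + \<eta>))" by (simp only: exp_le_cancel_iff)
    then have e1: "exp (p * (real b + 1)) \<le> 1 + \<eta>" using \<eta> by simp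
    have q0: "0 \<le> ?q"
    proof -
      have "0 \<le> p * real n * y k ^ d" using p(1) ypos[of k] by (intro mult_nonneg_nonneg) auto
      then show ?thesis using ypos[of k] by (intro divide_nonneg_pos) auto
    qed
    have kJ: "k \<le> J + 1" using k by (simp add: J_def)
    have "p * real n ^ 2 * err k = c * (real n * err k)"
      using p(3) by (simp only: power2_eq_square mult.assoc[symmetric])
    also have "\<dots> \<le> c * (real n * T)" using erT[OF kJ] c0 by (intro mult_left_mono) auto
    also have "\<dots> \<le> c * (exp (real r) * T)" using nT c0 by (intro mult_left_mono) auto
    finally have e2: "p * real n ^ 2 * err k \<le> c * (exp (real r) * T)" .
    have "z k ^ d * (p * real n ^ 2 * err k) \<le> Z * (c * (exp (real r) * T))"
    proof (rule mult_mono)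
      show "z k ^ d \<le> Z" unfolding z_def by (rule Z(1)[OF k])
    qed (use Z(2) e2 p(1) err_nonneg in auto)
    moreover have "real h * p / \<eta> ^ (d + 1) \<le> real h * (c / real r ^ 8) / \<eta> ^ (d + 1)"
      using p(4) \<eta>(1) by (intro divide_right_mono mult_left_mono) auto
    moreover have "real h = (real d + 1) * (real r + 1) * (1 + (real d + 1) ^ K)"
      by (simp only: h_def of_nat_mult of_nat_add of_nat_power of_nat_1)
    ultimately have e3: "z k ^ d * (p * real n ^ 2 * err k) + real h * p / \<eta> ^ (d + 1) \<le> \<eta>"
      using A4 by (simp add: T_def mult.assoc)
    have "z k ^ d * (exp (p * (real b + 1)) * ?q) \<le> z k ^ d * ((1 + \<eta>) * ?q)"
      using e1 q0 zn by (intro mult_left_mono mult_right_mono) auto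
    then have "z k ^ d * (exp (p * (real b + 1)) * ?q) + z k ^ d * (p * real n ^ 2 * err k) + real h * p / \<eta> ^ (d + 1)
        \<le> z k ^ d * ((1 + \<eta>) * ?q) + \<eta>" using e3 by linarith
    also have "\<dots> = z (Suc k)" by (simp add: z_def y_def p(3))
    finally show "z k ^ d * (exp (p * (real b + 1)) * (1 - exp (- (p * real n) * y k ^ d)) / y k ^ d + p * (real n)\<^sup>2 * err k)
        + real h * p / \<eta> ^ (d + 1) \<le> z (Suc k)"
      by (simp only: distrib_left times_divide_eq_right)
  qed (use \<eta> upr ypos p in \<open>auto simp: z_def\<close>)
  interpret chain_run p d n b H y "c - \<eta>" \<gamma> K h z \<eta> J r "real r ^ 4" lam
  proof
    show "real (r + 1) * real n * err J \<le> exp (- (c - \<eta>) * real (r + 1))"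
    proof -
      have "real (r + 1) * real n * err J \<le> exp (real r) * exp (real r) * T"
        using A6(3) nr(2) A6(2) erT[of J] err_nonneg by (intro mult_mono) auto
      also have "\<dots> = exp (2 * real r + real r * (real K + (real d + 1) * real r + 1) - \<kappa> * real r ^ 4)"
        by (simp add: T_def exp_add[symmetric])
      also have "\<dots> \<le> exp (- c * (real r + 1))" using A7 by simp
      also have "\<dots> \<le> exp (- (c - \<eta>) * real (r + 1))" using \<eta>(1) by (simp add: algebra_simps)
      finally show ?thesis .
    qed
    show "z K ^ (d - 1) * exp (- (c - \<eta>) * y J ^ d) * p * (real d * real n + real (d * (d + 1) * (r + 1)) * real r ^ 4) \<le> lam"
    proof -
      have ex: "exp (- (c - \<eta>) * y J ^ d) \<le> exp (- (c - \<eta>) * x ^ d)"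
      proof -
        have "(c - \<eta>) * x ^ d \<le> (c - \<eta>) * y J ^ d" using yb(1)[of J] x \<eta> by (intro mult_left_mono power_mono) auto
        then show ?thesis by (simp only: exp_le_cancel_iff mult_minus_left neg_le_iff_le)
      qed
      have "p * (real d * real n + real (d * (d + 1) * (r + 1)) * real r ^ 4)
          = real d * (p * real n) + real d * (real d + 1) * (real r + 1) * (p * real r ^ 4)"
        by (simp add: algebra_simps)
      also have "\<dots> \<le> real d * c + real d * (real d + 1) * (real r + 1) * (c / real r ^ 4)"
        unfolding p(3) using pb by (intro add_left_mono mult_left_mono) auto
      finally have 1: "p * (real d * real n + real (d * (d + 1) * (r + 1)) * real r ^ 4)
          \<le> real d * c + real d * (real d + 1) * (real r + 1) * (c / real r ^ 4)" .
      have "z K ^ (d - 1) * exp (- (c - \<eta>) * y J ^ d) * (p * (real d * real n + real (d * (d + 1) * (r + 1)) * real r ^ 4))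
        \<le> z K ^ (d - 1) * exp (- (c - \<eta>) * x ^ d) * (real d * c + real d * (real d + 1) * (real r + 1) * (c / real r ^ 4))"
        using 1 ex zn p(1) by (intro mult_mono mult_left_mono) auto
      then show ?thesis using A8 by (simp add: z_def mult.assoc)
    qed
    show "p / \<eta> ^ (d + 2) * (real ((d + 1) * (r + 1)) * (real n + real ((d + 1) * (r + 1)) * real r ^ 4)) \<le> lam * real r ^ 4"
    proof -
      have "p / \<eta> ^ (d + 2) * (real ((d + 1) * (r + 1)) * (real n + real ((d + 1) * (r + 1)) * real r ^ 4))
        = 1 / \<eta> ^ (d + 2) * ((real d + 1) * (real r + 1) * (p * real n + (real d + 1) * (real r + 1) * (p * real r ^ 4)))"
        by (simp add: algebra_simps add_divide_distrib)
      also have "\<dots> \<le> 1 / \<eta> ^ (d + 2) * ((real d + 1) * (real r + 1) * (c + (real d + 1) * (real r + 1) * (c / real r ^ 4)))"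
        unfolding p(3) using pb \<eta>(1) by (intro mult_left_mono add_left_mono) auto
      also have "\<dots> \<le> lam * real r ^ 4" by (rule A9)
      finally show ?thesis .
    qed
    show "(d + 1) * (r + 1) \<le> b" using A5 by (simp add: b_def)
  qed (use zK lam r in \<open>auto simp: z_def J_def H_def h_def\<close>)
  have "measure_pmf.prob (random_complex d n (c / real n)) {X. collapsible d X}
      = bprob E p (\<lambda>X. collapsible d (full_skeleton d n \<union> X))"
    unfolding p_def[symmetric] using p by (intro prob_random_complex) auto
  also have "\<dots> \<le> err (Suc J) + 2 / \<eta> ^ (d + 1) * (lam ^ r * (p * real n ^ (d + 1) * real r ^ 4))"
    by (rule collapsible_prob)
  also have "\<dots> \<le> T + 2 / \<eta> ^ (d + 1) * (lam ^ r * (c * (real r + 1) ^ (8 * d) * real r ^ 4))"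
  proof (intro add_mono mult_left_mono mult_right_mono)
    show "err (Suc J) \<le> T" by (rule erT) simp
    have "p * real n ^ (d + 1) = c * real n ^ d" using p(3) by (simp add: mult.assoc[symmetric])
    also have "\<dots> \<le> c * ((real r + 1) ^ 8) ^ d" using nr c0 by (intro mult_left_mono power_mono) auto
    finally show "p * real n ^ (d + 1) \<le> c * (real r + 1) ^ (8 * d)" by (simp add: power_mult)
  qed (use \<eta> lam in auto)
  finally show ?thesis by (simp add: T_def)
qed

theorem mainTheorem1:
  fixes d :: nat and c :: real
  assumes "d \<ge> 2" and "c > c_crit d"
  shows "(\<lambda>n. measure_pmf.prob (random_complex d n (c / real n)) {X. collapsible d X}) \<longlonglongrightarrow> 0"
proof -
  obtain \<eta> x K where \<eta>: "0 < \<eta>" "\<eta> \<le> 1" "0 < c - 2 * \<eta>" and x: "0 < x" "x < 1"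
    "x \<le> 1 - exp (- (c - 2 * \<eta>) * x ^ d)" and zK: "upper_seq d c \<eta> K \<le> 1"
    and rate: "real d * c * upper_seq d c \<eta> K ^ (d - 1) * exp (- (c - \<eta>) * x ^ d) < 1"
    using constants[OF assms] by metis
  have c0: "0 < c" using \<eta> by linarith
  have low: "0 < lower_seq d (c - 2 * \<eta>) k" for k
    using lower_seq_bounds(1)[of "c - 2 * \<eta>" x d k] \<eta> x by linarith
  have zn: "0 \<le> upper_seq d c \<eta> k" for k
    using upper_seq_ge[OF \<eta>(1,2) c0 low, of k] \<eta>(1) by linarith
  define \<Phi> where "\<Phi> = upper_seq d c \<eta> K ^ (d - 1) * exp (- (c - \<eta>) * x ^ d)"
  have \<Phi>0: "0 \<le> \<Phi>" using zn by (simp add: \<Phi>_def)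
  \<comment> \<open>Strictly above the limiting ratio, so that the vanishing share of non-fresh
    continuations in \<open>E8\<close> still fits.\<close>
  obtain lam where lam: "\<Phi> * (real d * c) < lam" "0 < lam" "lam < 1"
  proof -
    have "max 0 (\<Phi> * (real d * c)) < 1" using rate by (simp add: \<Phi>_def mult_ac)
    then obtain l where "max 0 (\<Phi> * (real d * c)) < l" "l < 1" using dense by blast
    then show thesis by (intro that[of l]) auto
  qed
  define Z where "Z = (\<Sum>k<K. upper_seq d c \<eta> k ^ d)"
  have Z: "upper_seq d c \<eta> k ^ d \<le> Z" if "k < K" for k
    unfolding Z_def using that zn by (intro member_le_sum) auto
  have Z0: "0 \<le> Z" using zn by (simp add: Z_def sum_nonneg)
  define \<kappa> where "\<kappa> = ((exp (- (c - \<eta>)) * (exp (\<eta> * x ^ d) - 1)) ^ d)\<^sup>2 / 2"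
  have \<kappa>: "0 < \<kappa>" using \<eta> x by (simp add: \<kappa>_def)
  define D k where "D = real d" and "k = real K"
  have D: "0 < D" and k: "0 \<le> k" using assms(1) by (auto simp: D_def k_def)
  define T where "T r = exp (real r * (k + (D + 1) * real r + 1) - \<kappa> * real r ^ 4)" for r :: nat
  have E1: "\<forall>\<^sub>F r::nat in at_top. c \<le> real r ^ 8" by real_asymp
  have E2: "\<forall>\<^sub>F r::nat in at_top. c * (2 * real r ^ 4 + D + D * ((real r + 1) + (k + (D + 1) * real r + 1) * (real r ^ 4 + D))) / real r ^ 8 \<le> \<eta>"
  proof -
    have "(\<lambda>r::nat. c * (2 * real r ^ 4 + D + D * ((real r + 1) + (k + (D + 1) * real r + 1) * (real r ^ 4 + D))) / real r ^ 8) \<longlonglongrightarrow> 0"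
      using c0 D k by real_asymp
    from order_tendstoD(2)[OF this \<eta>(1)] show ?thesis by eventually_elim simp
  qed
  have E3: "\<forall>\<^sub>F r::nat in at_top. c * (real r ^ 4 + 1) / real r ^ 8 \<le> ln (1 + \<eta>)"
  proof -
    have "(\<lambda>r::nat. c * (real r ^ 4 + 1) / real r ^ 8) \<longlonglongrightarrow> 0" using c0 by real_asymp
    moreover have "0 < ln (1 + \<eta>)" using \<eta> by simp
    ultimately have "\<forall>\<^sub>F r::nat in at_top. c * (real r ^ 4 + 1) / real r ^ 8 < ln (1 + \<eta>)" by (rule order_tendstoD)
    then show ?thesis by eventually_elim simp
  qed
  have E4: "\<forall>\<^sub>F r::nat in at_top. Z * (c * exp (real r) * exp (real r * (k + (D + 1) * real r + 1) - \<kappa> * real r ^ 4))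
       + (D + 1) * (real r + 1) * (1 + (D + 1) ^ K) * (c / real r ^ 8) / \<eta> ^ (d + 1) \<le> \<eta>"
  proof -
    have "(\<lambda>r::nat. exp (real r) * exp (real r * (k + (D + 1) * real r + 1) - \<kappa> * real r ^ 4)) \<longlonglongrightarrow> 0"
      using \<kappa> D k by real_asymp
    moreover have "(\<lambda>r::nat. (real r + 1) / real r ^ 8) \<longlonglongrightarrow> 0" by real_asymp
    ultimately have "(\<lambda>r::nat. Z * c * (exp (real r) * exp (real r * (k + (D + 1) * real r + 1) - \<kappa> * real r ^ 4))
       + (D + 1) * (1 + (D + 1) ^ K) * c / \<eta> ^ (d + 1) * ((real r + 1) / real r ^ 8)) \<longlonglongrightarrow>
       Z * c * 0 + (D + 1) * (1 + (D + 1) ^ K) * c / \<eta> ^ (d + 1) * 0"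
      by (intro tendsto_add tendsto_mult tendsto_const)
    then have "(\<lambda>r::nat. Z * c * (exp (real r) * exp (real r * (k + (D + 1) * real r + 1) - \<kappa> * real r ^ 4))
       + (D + 1) * (1 + (D + 1) ^ K) * c / \<eta> ^ (d + 1) * ((real r + 1) / real r ^ 8)) \<longlonglongrightarrow> 0" by simp
    from order_tendstoD(2)[OF this \<eta>(1)] show ?thesis
      by eventually_elim (simp add: mult_ac)
  qed
  have E5: "\<forall>\<^sub>F r::nat in at_top. (d + 1) * (r + 1) \<le> r ^ 4"
  proof -
    have "\<forall>\<^sub>F r::nat in at_top. (D + 1) * (real r + 1) \<le> real r ^ 4" using D by real_asymp
    then show ?thesis
    proof eventually_elim
      case (elim r)
      then have "real ((d + 1) * (r + 1)) \<le> real (r ^ 4)" by (simp add: D_def algebra_simps)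
      then show ?case by (simp only: of_nat_le_iff)
    qed
  qed
  have E6: "\<forall>\<^sub>F r::nat in at_top. 1 + D * real r ^ 4 * (real r + 1) ^ 8 \<le> exp (real r)"
    "\<forall>\<^sub>F r::nat in at_top. (real r + 1) ^ 8 \<le> exp (real r)" "\<forall>\<^sub>F r::nat in at_top. real r + 1 \<le> exp (real r)"
    using D by real_asymp+
  have E7: "\<forall>\<^sub>F r::nat in at_top. 2 * real r + real r * (k + (D + 1) * real r + 1) + c * (real r + 1) \<le> \<kappa> * real r ^ 4"
    using \<kappa> D k c0 by real_asymp
  have lim: "(\<lambda>r::nat. D * (D + 1) * (real r + 1) * (c / real r ^ 4)) \<longlonglongrightarrow> 0"
    using c0 D by real_asymp
  have E8: "\<forall>\<^sub>F r::nat in at_top. \<Phi> * (D * c + D * (D + 1) * (real r + 1) * (c / real r ^ 4)) \<le> lam"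
  proof -
    have "(\<lambda>r::nat. \<Phi> * (D * c + D * (D + 1) * (real r + 1) * (c / real r ^ 4))) \<longlonglongrightarrow> \<Phi> * (D * c + 0)"
      by (intro tendsto_intros lim)
    moreover have "\<Phi> * (D * c + 0) < lam" using lam by (simp add: D_def)
    ultimately have "\<forall>\<^sub>F r::nat in at_top. \<Phi> * (D * c + D * (D + 1) * (real r + 1) * (c / real r ^ 4)) < lam"
      by (rule order_tendstoD)
    then show ?thesis by eventually_elim simp
  qed
  have E9: "\<forall>\<^sub>F r::nat in at_top. 1 / \<eta> ^ (d + 2) * ((D + 1) * (real r + 1) * (c + (D + 1) * (real r + 1) * (c / real r ^ 4))) \<le> lam * real r ^ 4"
  proof -
    define q where "q = 1 / \<eta> ^ (d + 2)"
    have "0 < q" using \<eta> by (simp add: q_def)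
    then have "\<forall>\<^sub>F r::nat in at_top. q * ((D + 1) * (real r + 1) * (c + (D + 1) * (real r + 1) * (c / real r ^ 4))) \<le> lam * real r ^ 4"
      using D c0 lam(2) by real_asymp
    then show ?thesis by (simp add: q_def)
  qed
  define g where "g r = T r + 2 / \<eta> ^ (d + 1) * (lam ^ r * (c * (real r + 1) ^ (8 * d) * real r ^ 4))" for r :: nat
  have g: "g \<longlonglongrightarrow> 0"
  proof -
    have 1: "T \<longlonglongrightarrow> 0" unfolding T_def using \<kappa> D k by real_asymp
    define a where "a = - ln lam"
    have a: "0 < a" using lam by (simp add: a_def)
    have "(\<lambda>r::nat. exp (- a * real r) * (real r + 1) powr (8 * D) * real r ^ 4) \<longlonglongrightarrow> 0"
      using a D by real_asymp
    moreover have "exp (- a * real r) * (real r + 1) powr (8 * D) * real r ^ 4 = lam ^ r * (real r + 1) ^ (8 * d) * real r ^ 4" for r :: nat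
    proof -
      have "exp (- a * real r) = lam ^ r" using lam by (simp add: a_def exp_of_nat_mult mult.commute[of "ln lam"])
      moreover have "(real r + 1) powr (8 * D) = (real r + 1) ^ (8 * d)"
        using powr_realpow[of "real r + 1" "8 * d"] by (simp add: D_def)
      ultimately show ?thesis by simp
    qed
    ultimately have 2: "(\<lambda>r::nat. lam ^ r * (real r + 1) ^ (8 * d) * real r ^ 4) \<longlonglongrightarrow> 0" by (simp only:)
    have "(\<lambda>r. T r + 2 / \<eta> ^ (d + 1) * c * (lam ^ r * (real r + 1) ^ (8 * d) * real r ^ 4)) \<longlonglongrightarrow> 0 + 2 / \<eta> ^ (d + 1) * c * 0"
      by (intro tendsto_add tendsto_mult tendsto_const 1 2)
    then show ?thesis by (simp add: g_def[abs_def] mult_ac)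
  qed
  \<comment> \<open>Every \<open>n\<close> lies between the eighth powers of \<open>R n\<close> and
    \<open>R n + 1\<close>, so estimates in \<open>r\<close> that are uniform over such
    \<open>n\<close> cover all \<open>n\<close>.\<close>
  define R where "R n = nat \<lfloor>root 8 (real n)\<rfloor>" for n :: nat
  have Rlim: "filterlim R at_top sequentially" unfolding R_def by real_asymp
  have Rn: "R n ^ 8 \<le> n" "n \<le> (R n + 1) ^ 8" for n
  proof -
    have r0: "0 \<le> root 8 (real n)" by simp
    have "real (R n) \<le> root 8 (real n)" unfolding R_def using r0 by simp
    then have "real (R n) ^ 8 \<le> root 8 (real n) ^ 8" by (intro power_mono) auto
    then have "real (R n ^ 8) \<le> real n" by simp
    then show "R n ^ 8 \<le> n" by (simp only: of_nat_le_iff)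
    have "root 8 (real n) \<le> real (R n) + 1" unfolding R_def using r0 by linarith
    then have "root 8 (real n) ^ 8 \<le> (real (R n) + 1) ^ 8" using r0 by (intro power_mono) auto
    then have "real n \<le> real ((R n + 1) ^ 8)" by (simp add: add.commute)
    then show "n \<le> (R n + 1) ^ 8" by (simp only: of_nat_le_iff)
  qed
  have "\<forall>\<^sub>F r in at_top. \<forall>n. r ^ 8 \<le> n \<longrightarrow> n \<le> (r + 1) ^ 8 \<longrightarrow>
      measure_pmf.prob (random_complex d n (c / real n)) {X. collapsible d X} \<le> g r"
    using eventually_ge_at_top[of "1::nat"] E1 E2 E3 E4 E5 E6 E7 E8 E9
  proof eventually_elim
    case (elim r)
    show ?case
    proof (intro allI impI)
      fix n assume n: "r ^ 8 \<le> n" "n \<le> (r + 1) ^ 8"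
      show "measure_pmf.prob (random_complex d n (c / real n)) {X. collapsible d X} \<le> g r"
        unfolding g_def T_def D_def k_def
        using elim assms(1) \<eta> x zK Z Z0 lam(2) n unfolding \<Phi>_def D_def k_def
        by (intro collapsible_prob_bound[where Z = Z and x = x, OF _ _ _ _ _ _ _ _ _ _ _ \<kappa>_def]) auto
    qed
  qed
  from eventually_compose_filterlim[OF this Rlim]
  have le: "\<forall>\<^sub>F n in sequentially. measure_pmf.prob (random_complex d n (c / real n)) {X. collapsible d X} \<le> g (R n)"
    by eventually_elim (use Rn in blast)
  have "(\<lambda>n. g (R n)) \<longlonglongrightarrow> 0" by (rule filterlim_compose[OF g Rlim])
  then show ?thesis
    by (rule tendsto_sandwich[OF _ le tendsto_const, rotated]) simp
qed

end
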